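(* For any bimorphism $\odot\colon(\mathcal M,\mathcal N)\to\mathcal L$ of Mackey 2-functors $\mathcal M,\mathcal N,\mathcal L$ for a Cartesian spannable pair $(\mathbb G;\mathbb J)$, and any $(i\colon H\to G)\in\mathbb J$, the left and right projection maps are mutually inverse isomorphisms: $$\mathrm{Rp}^1_{X,Y}\colon X\odot_G i_*(Y)\rightleftarrows i_*(i^*X\odot_H Y)\colon\mathrm{Lp}^1_{X,Y}\qquad\text{for all }X\in\mathcal M(G),\ Y\in\mathcal N(H),$$ $$\mathrm{Rp}^2_{Y,X}\colon i_*(Y)\odot_G X\rightleftarrows i_*(Y\odot_H i^*X)\colon\mathrm{Lp}^2_{Y,X}\qquad\text{for all }X\in\mathcal N(G),\ Y\in\mathcal M(H).$$
   Context: Fix a commutative ring $\Bbbk$. $\mathbb A$ denotes either $\mathsf{ADD}_\Bbbk$, the 2-category of (possibly large) additive $\Bbbk$-linear categories, $\Bbbk$-linear functors and natural transformations, or its full 2-subcategory $\mathsf{ADD}_\Bbbk^{ic}$ of idempotent complete ones. A spannable pair $(\mathbb G;\mathbb J)$ consists of: (1) an essentially small $(2,1)$-category $\mathbb G$ (Hom categories are small groupoids; up to equivalence only a small set of objects), which (2) is extensive (it has finite coproducts and for all $G,H$ the pseudofunctor $\mathbb G/G\times\mathbb G/H\to\mathbb G/(G\sqcup H)$, $(u,v)\mapsto u\sqcup v$, is a biequivalence); (3) a 2-full 2-subcategory $\mathbb J\subseteq\mathbb G$ containing all equivalences and closed under isomorphic 1-cells, such that (4) for $i\colon H\to G$ in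 $\mathbb J$ and any $u\colon K\to G$ there is a pseudopullback ("Mackey square") $p\colon P\to H$, $q\colon P\to K$, $\gamma\colon ip\overset{\sim}{\Rightarrow}uq$, with $q\in\mathbb J$; and (5) for every finite family $u_\ell\colon H_\ell\to G$, the induced $\sqcup_\ell H_\ell\to G$ is in $\mathbb J$ iff every $u_\ell$ is. The pair is Cartesian if moreover $\mathbb G$ has finite products and products of 1-morphisms in $\mathbb J$ are again in $\mathbb J$. A Mackey 2-functor for $(\mathbb G;\mathbb J)$ is a 2-functor $\mathcal M\colon\mathbb G^{op}\to\mathbb A$ (write $u^*=\mathcal M(u)$) such that: (1) it sends finite coproducts to direct sums; (2) for $i\in\mathbb J$, $i^*$ has a left adjoint $i_!$ and a right adjoint $i_*$; (3) for every Mackey square with $i,q\in\mathbb J$ the mates $\gamma_!\colon q_!p^*\Rightarrow u^*i_!$ and $(\gamma^{-1})_*\colon u^*i_*\Rightarrow q_*p^*$ are invertible; (4) $i_!\simeq i_*$ for $i\in\mathbb J$. Standing assumption: all Mackey 2-functors are rectified, i.e. come with chosen adjunctions $(i_!\dashv i^*,{}^\ell\eta,{}^\ell\varepsilon)$ and $(i^*\dashv i_*,{}^r\eta,{}^r\varepsilon)$ for $i\in\mathbb J$ with $i_!=i_*$ as functors, the pseudofunctors $i\mapsto i_!$ and $i\mapsto i_*$ on $\mathbb J$ equal, $(\gamma_!)^{-1}=(\gamma^{-1})_*$ for all Mackey squares, and ${}^r\varepsilon\circ{}^\ell\eta=\mathrm{id}$. A pairing $\odot\colon(\mathcal M,\mathcal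 N)\to\mathcal L$ is a pseudonatural transformation $\mathcal M\otimes\mathcal N\to\mathcal L$, where $(\mathcal M\otimes\mathcal N)(G)=\mathcal M(G)\otimes\mathcal N(G)$ is the tensor product in $\mathbb A$ classifying $\Bbbk$-bilinear functors; concretely, $\Bbbk$-bilinear functors $\odot_G\colon\mathcal M(G)\times\mathcal N(G)\to\mathcal L(G)$ with natural isomorphisms $\odot_u\colon u^*(X_1\odot_GX_2)\xrightarrow{\sim}u^*X_1\odot_Hu^*X_2$ for $u\colon H\to G$, compatible with identities, composition and 2-cells. Its external version is $X\boxdot Y:=\pi_1^*X\odot_{G_1\times G_2}\pi_2^*Y\in\mathcal L(G_1\times G_2)$ for $X\in\mathcal M(G_1)$, $Y\in\mathcal N(G_2)$ ($\pi_k$ the projections), with isomorphisms $\boxdot_{u_1,u_2}\colon(u_1\times u_2)^*(X\boxdot Y)\cong u_1^*X\boxdot u_2^*Y$ induced by $\odot_{u_1\times u_2}$. The pairing is a bimorphism if for all $i_1\colon H_1\to G_1$, $i_2\colon H_2\to G_2$ in $\mathbb J$ the right mate $(i_1)_*X\boxdot(i_2)_*Y\to(i_1\times i_2)_*(X\boxdot Y)$ of $\boxdot_{i_1,i_2}$ and the left mate $(i_1\times i_2)_!(X\boxdot Y)\to(i_1)_!X\boxdot(i_2)_!Y$ of $\boxdot_{i_1,i_2}^{-1}$ are mutually inverse (equivalently: all right mates are invertible; equivalently: all left mates are invertible). Projection maps: $\mathrm{Rp}^1_{X,Y}=i_*(i^*X\odot_H{}^r\varepsilon)\circ i_*(\odot_i)\circ{}^r\eta$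 and $\mathrm{Rp}^2_{Y,X}=i_*({}^r\varepsilon\odot_Hi^*X)\circ i_*(\odot_i)\circ{}^r\eta$; dually $\mathrm{Lp}^1_{X,Y}={}^\ell\varepsilon\circ i_!(\odot_i^{-1})\circ i_!(i^*X\odot_H{}^\ell\eta)\colon i_!(i^*X\odot_HY)\to X\odot_Gi_!Y$ and $\mathrm{Lp}^2_{Y,X}={}^\ell\varepsilon\circ i_!(\odot_i^{-1})\circ i_!({}^\ell\eta\odot_Hi^*X)\colon i_!(Y\odot_Hi^*X)\to i_!Y\odot_GX$. *)

theory Defs
  imports "HOL-Algebra.Module" "HOL-Library.FuncSet"
begin

section \<open>Categories\<close>

text \<open>
  Objects and arrows live in carrier sets, and everything is relativised to them; no size
  condition is needed, since the elements of a HOL type always form a set.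
  Composition is written in applicative order.
\<close>

record ('o, 'm) cat =
  Ob :: "'o set"
  Arr :: "'m set"
  Dom :: "'m \<Rightarrow> 'o"
  Cod :: "'m \<Rightarrow> 'o"
  Idn :: "'o \<Rightarrow> 'm"
  Cmp :: "'m \<Rightarrow> 'm \<Rightarrow> 'm"  (infixr \<open>\<cdot>\<index>\<close> 75)

definition homs :: "('o, 'm, 'x) cat_scheme \<Rightarrow> 'o \<Rightarrow> 'o \<Rightarrow> 'm set" where
  "homs C a b = {f \<in> Arr C. Dom C f = a \<and> Cod C f = b}"

definition category :: "('o, 'm, 'x) cat_scheme \<Rightarrow> bool" where
  "category C \<longleftrightarrow>
    (\<forall>f \<in> Arr C. Dom C f \<in> Ob C \<and> Cod C f \<in> Ob C) \<and>
    (\<forall>a \<in> Ob C. Idn C a \<in> homs C a a) \<and>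
    (\<forall>a b c f g. f \<in> homs C a b \<longrightarrow> g \<in> homs C b c \<longrightarrow> g \<cdot>\<^bsub>C\<^esub> f \<in> homs C a c) \<and>
    (\<forall>a b f. f \<in> homs C a b \<longrightarrow> f \<cdot>\<^bsub>C\<^esub> Idn C a = f \<and> Idn C b \<cdot>\<^bsub>C\<^esub> f = f) \<and>
    (\<forall>a b c d f g h. f \<in> homs C a b \<longrightarrow> g \<in> homs C b c \<longrightarrow> h \<in> homs C c d \<longrightarrow>
        (h \<cdot>\<^bsub>C\<^esub> g) \<cdot>\<^bsub>C\<^esub> f = h \<cdot>\<^bsub>C\<^esub> (g \<cdot>\<^bsub>C\<^esub> f))"

definition mutually_inverse ::
  "('o, 'm, 'x) cat_scheme \<Rightarrow> 'o \<Rightarrow> 'o \<Rightarrow> 'm \<Rightarrow> 'm \<Rightarrow> bool" where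
  "mutually_inverse C a b f g \<longleftrightarrow>
    f \<in> homs C a b \<and> g \<in> homs C b a \<and> g \<cdot>\<^bsub>C\<^esub> f = Idn C a \<and> f \<cdot>\<^bsub>C\<^esub> g = Idn C b"

definition isos :: "('o, 'm, 'x) cat_scheme \<Rightarrow> 'o \<Rightarrow> 'o \<Rightarrow> 'm set" where
  "isos C a b = {f. \<exists>g. mutually_inverse C a b f g}"

definition inv_arr :: "('o, 'm, 'x) cat_scheme \<Rightarrow> 'm \<Rightarrow> 'm" where
  "inv_arr C f = (THE g. mutually_inverse C (Dom C f) (Cod C f) f g)"

record ('o, 'm, 'p, 'n) ftr =
  FO :: "'o \<Rightarrow> 'p"
  FA :: "'m \<Rightarrow> 'n"

definition is_functor ::
  "('o, 'm, 'x) cat_scheme \<Rightarrow> ('p, 'n, 'y) cat_scheme \<Rightarrow> ('o, 'm, 'p, 'n) ftr \<Rightarrow> bool" where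
  "is_functor C D F \<longleftrightarrow>
    (\<forall>a \<in> Ob C. FO F a \<in> Ob D) \<and>
    (\<forall>a b f. f \<in> homs C a b \<longrightarrow> FA F f \<in> homs D (FO F a) (FO F b)) \<and>
    (\<forall>a \<in> Ob C. FA F (Idn C a) = Idn D (FO F a)) \<and>
    (\<forall>a b c f g. f \<in> homs C a b \<longrightarrow> g \<in> homs C b c \<longrightarrow>
        FA F (g \<cdot>\<^bsub>C\<^esub> f) = FA F g \<cdot>\<^bsub>D\<^esub> FA F f)"

definition id_ftr :: "('o, 'm, 'o, 'm) ftr" where
  "id_ftr = \<lparr>FO = (\<lambda>a. a), FA = (\<lambda>f. f)\<rparr>"

definition comp_ftr ::
  "('p, 'n, 'q, 'l) ftr \<Rightarrow> ('o, 'm, 'p, 'n) ftr \<Rightarrow> ('o, 'm, 'q, 'l) ftr" where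
  "comp_ftr G F = \<lparr>FO = (\<lambda>a. FO G (FO F a)), FA = (\<lambda>f. FA G (FA F f))\<rparr>"

definition nat_trans ::
  "('o, 'm, 'x) cat_scheme \<Rightarrow> ('p, 'n, 'y) cat_scheme \<Rightarrow>
   ('o, 'm, 'p, 'n) ftr \<Rightarrow> ('o, 'm, 'p, 'n) ftr \<Rightarrow> ('o \<Rightarrow> 'n) \<Rightarrow> bool" where
  "nat_trans C D F G t \<longleftrightarrow>
    (\<forall>a \<in> Ob C. t a \<in> homs D (FO F a) (FO G a)) \<and>
    (\<forall>a b f. f \<in> homs C a b \<longrightarrow> t b \<cdot>\<^bsub>D\<^esub> FA F f = FA G f \<cdot>\<^bsub>D\<^esub> t a)"

text \<open>\<open>F\<close> is left adjoint to \<open>G\<close>, with unit \<open>\<eta>\<close> and counit \<open>\<epsilon>\<close>.\<close>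

definition adjunction ::
  "('o, 'm, 'x) cat_scheme \<Rightarrow> ('p, 'n, 'y) cat_scheme \<Rightarrow>
   ('o, 'm, 'p, 'n) ftr \<Rightarrow> ('p, 'n, 'o, 'm) ftr \<Rightarrow> ('o \<Rightarrow> 'm) \<Rightarrow> ('p \<Rightarrow> 'n) \<Rightarrow> bool" where
  "adjunction C D F G \<eta> \<epsilon> \<longleftrightarrow>
    is_functor C D F \<and> is_functor D C G \<and>
    nat_trans C C id_ftr (comp_ftr G F) \<eta> \<and>
    nat_trans D D (comp_ftr F G) id_ftr \<epsilon> \<and>
    (\<forall>a \<in> Ob C. \<epsilon> (FO F a) \<cdot>\<^bsub>D\<^esub> FA F (\<eta> a) = Idn D (FO F a)) \<and>
    (\<forall>b \<in> Ob D. FA G (\<epsilon> b) \<cdot>\<^bsub>C\<^esub> \<eta> (FO G b) = Idn C (FO G b))"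

text \<open>Equivalence of categories: a fully faithful and essentially surjective functor.\<close>

definition cat_equivalence ::
  "('o, 'm, 'x) cat_scheme \<Rightarrow> ('p, 'n, 'y) cat_scheme \<Rightarrow> ('o, 'm, 'p, 'n) ftr \<Rightarrow> bool" where
  "cat_equivalence C D F \<longleftrightarrow>
    is_functor C D F \<and>
    (\<forall>a \<in> Ob C. \<forall>b \<in> Ob C. bij_betw (FA F) (homs C a b) (homs D (FO F a) (FO F b))) \<and>
    (\<forall>d \<in> Ob D. \<exists>a \<in> Ob C. isos D (FO F a) d \<noteq> {})"

definition prod_cat ::
  "('o, 'm, 'x) cat_scheme \<Rightarrow> ('p, 'n, 'y) cat_scheme \<Rightarrow> ('o \<times> 'p, 'm \<times> 'n) cat" where
  "prod_cat C D =
    \<lparr>Ob = Ob C \<times> Ob D, Arr = Arr C \<times> Arr D,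
     Dom = map_prod (Dom C) (Dom D), Cod = map_prod (Cod C) (Cod D),
     Idn = map_prod (Idn C) (Idn D),
     Cmp = (\<lambda>(g, g') (f, f'). (g \<cdot>\<^bsub>C\<^esub> f, g' \<cdot>\<^bsub>D\<^esub> f'))\<rparr>"

definition family_cat ::
  "nat \<Rightarrow> (nat \<Rightarrow> ('o, 'm, 'x) cat_scheme) \<Rightarrow> (nat \<Rightarrow> 'o, nat \<Rightarrow> 'm) cat" where
  "family_cat n C =
    \<lparr>Ob = (\<Pi>\<^sub>E l\<in>{..<n}. Ob (C l)), Arr = (\<Pi>\<^sub>E l\<in>{..<n}. Arr (C l)),
     Dom = (\<lambda>f. \<lambda>l\<in>{..<n}. Dom (C l) (f l)), Cod = (\<lambda>f. \<lambda>l\<in>{..<n}. Cod (C l) (f l)),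
     Idn = (\<lambda>a. \<lambda>l\<in>{..<n}. Idn (C l) (a l)),
     Cmp = (\<lambda>g f. \<lambda>l\<in>{..<n}. g l \<cdot>\<^bsub>C l\<^esub> f l)\<rparr>"


section \<open>Additive linear categories\<close>

text \<open>The fields \<open>mult\<close> and \<open>one\<close> of the Hom modules are irrelevant.\<close>

record ('k, 'o, 'm) lincat = "('o, 'm) cat" +
  HomMod :: "'o \<Rightarrow> 'o \<Rightarrow> ('k, 'm) module"

definition linear_category ::
  "('k, 'r) ring_scheme \<Rightarrow> ('k, 'o, 'm, 'x) lincat_scheme \<Rightarrow> bool" where
  "linear_category R C \<longleftrightarrow>
    category C \<and>
    (\<forall>a \<in> Ob C. \<forall>b \<in> Ob C. module R (HomMod C a b) \<and> carrier (HomMod C a b) = homs C a b) \<and>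
    (\<forall>a b c f f' g. f \<in> homs C a b \<longrightarrow> f' \<in> homs C a b \<longrightarrow> g \<in> homs C b c \<longrightarrow>
        g \<cdot>\<^bsub>C\<^esub> (f \<oplus>\<^bsub>HomMod C a b\<^esub> f') = (g \<cdot>\<^bsub>C\<^esub> f) \<oplus>\<^bsub>HomMod C a c\<^esub> (g \<cdot>\<^bsub>C\<^esub> f')) \<and>
    (\<forall>a b c f g g'. f \<in> homs C a b \<longrightarrow> g \<in> homs C b c \<longrightarrow> g' \<in> homs C b c \<longrightarrow>
        (g \<oplus>\<^bsub>HomMod C b c\<^esub> g') \<cdot>\<^bsub>C\<^esub> f = (g \<cdot>\<^bsub>C\<^esub> f) \<oplus>\<^bsub>HomMod C a c\<^esub> (g' \<cdot>\<^bsub>C\<^esub> f)) \<and>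
    (\<forall>a b c f g. \<forall>r \<in> carrier R. f \<in> homs C a b \<longrightarrow> g \<in> homs C b c \<longrightarrow>
        g \<cdot>\<^bsub>C\<^esub> (r \<odot>\<^bsub>HomMod C a b\<^esub> f) = r \<odot>\<^bsub>HomMod C a c\<^esub> (g \<cdot>\<^bsub>C\<^esub> f) \<and>
        (r \<odot>\<^bsub>HomMod C b c\<^esub> g) \<cdot>\<^bsub>C\<^esub> f = r \<odot>\<^bsub>HomMod C a c\<^esub> (g \<cdot>\<^bsub>C\<^esub> f))"

definition biproduct ::
  "('k, 'o, 'm, 'x) lincat_scheme \<Rightarrow> 'o \<Rightarrow> 'o \<Rightarrow> 'o \<Rightarrow> 'm \<Rightarrow> 'm \<Rightarrow> 'm \<Rightarrow> 'm \<Rightarrow> bool" where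
  "biproduct C a b s i1 i2 p1 p2 \<longleftrightarrow>
    s \<in> Ob C \<and> i1 \<in> homs C a s \<and> i2 \<in> homs C b s \<and> p1 \<in> homs C s a \<and> p2 \<in> homs C s b \<and>
    p1 \<cdot>\<^bsub>C\<^esub> i1 = Idn C a \<and> p2 \<cdot>\<^bsub>C\<^esub> i2 = Idn C b \<and>
    p1 \<cdot>\<^bsub>C\<^esub> i2 = \<zero>\<^bsub>HomMod C b a\<^esub> \<and> p2 \<cdot>\<^bsub>C\<^esub> i1 = \<zero>\<^bsub>HomMod C a b\<^esub> \<and>
    (i1 \<cdot>\<^bsub>C\<^esub> p1) \<oplus>\<^bsub>HomMod C s s\<^esub> (i2 \<cdot>\<^bsub>C\<^esub> p2) = Idn C s"

definition additive_category ::
  "('k, 'r) ring_scheme \<Rightarrow> ('k, 'o, 'm, 'x) lincat_scheme \<Rightarrow> bool" where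
  "additive_category R C \<longleftrightarrow>
    linear_category R C \<and>
    (\<exists>z \<in> Ob C. \<forall>a \<in> Ob C. (\<exists>!f. f \<in> homs C z a) \<and> (\<exists>!f. f \<in> homs C a z)) \<and>
    (\<forall>a \<in> Ob C. \<forall>b \<in> Ob C. \<exists>s i1 i2 p1 p2. biproduct C a b s i1 i2 p1 p2)"

definition idempotent_complete :: "('o, 'm, 'x) cat_scheme \<Rightarrow> bool" where
  "idempotent_complete C \<longleftrightarrow>
    (\<forall>a \<in> Ob C. \<forall>e \<in> homs C a a. e \<cdot>\<^bsub>C\<^esub> e = e \<longrightarrow>
      (\<exists>b \<in> Ob C. \<exists>r \<in> homs C a b. \<exists>s \<in> homs C b a. r \<cdot>\<^bsub>C\<^esub> s = Idn C b \<and> s \<cdot>\<^bsub>C\<^esub> r = e))"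

text \<open>
  The objects of the target 2-category: all additive categories if \<open>ic\<close> is false, the
  idempotent complete ones if \<open>ic\<close> is true.
\<close>

definition target_object ::
  "('k, 'r) ring_scheme \<Rightarrow> bool \<Rightarrow> ('k, 'o, 'm, 'x) lincat_scheme \<Rightarrow> bool" where
  "target_object R ic C \<longleftrightarrow> additive_category R C \<and> (ic \<longrightarrow> idempotent_complete C)"

definition linear_functor ::
  "('k, 'r) ring_scheme \<Rightarrow> ('k, 'o, 'm, 'x) lincat_scheme \<Rightarrow> ('k, 'p, 'n, 'y) lincat_scheme \<Rightarrow>
   ('o, 'm, 'p, 'n) ftr \<Rightarrow> bool" where
  "linear_functor R C D F \<longleftrightarrow>
    is_functor C D F \<and>
    (\<forall>a b f g. f \<in> homs C a b \<longrightarrow> g \<in> homs C a b \<longrightarrow>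
        FA F (f \<oplus>\<^bsub>HomMod C a b\<^esub> g) = FA F f \<oplus>\<^bsub>HomMod D (FO F a) (FO F b)\<^esub> FA F g) \<and>
    (\<forall>a b f. \<forall>r \<in> carrier R. f \<in> homs C a b \<longrightarrow>
        FA F (r \<odot>\<^bsub>HomMod C a b\<^esub> f) = r \<odot>\<^bsub>HomMod D (FO F a) (FO F b)\<^esub> FA F f)"


section \<open>2-categories\<close>

text \<open>
  Strict 2-categories, given by the category \<open>Under\<close> of 0-cells and 1-cells, the category
  \<open>Vert\<close> of 1-cells and 2-cells under vertical composition, and horizontal composition of
  2-cells.
\<close>

record ('g, 'h, 'c) twocat =
  Under :: "('g, 'h) cat"
  Vert :: "('h, 'c) cat"
  HCmp :: "'c \<Rightarrow> 'c \<Rightarrow> 'c"  (infixr \<open>\<star>\<index>\<close> 78)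

abbreviation src :: "('g, 'h, 'c) twocat \<Rightarrow> 'h \<Rightarrow> 'g" where
  "src T u \<equiv> Dom (Under T) u"

abbreviation trg :: "('g, 'h, 'c) twocat \<Rightarrow> 'h \<Rightarrow> 'g" where
  "trg T u \<equiv> Cod (Under T) u"

abbreviation cells1 :: "('g, 'h, 'c) twocat \<Rightarrow> 'g \<Rightarrow> 'g \<Rightarrow> 'h set" where
  "cells1 T a b \<equiv> homs (Under T) a b"

abbreviation cells2 :: "('g, 'h, 'c) twocat \<Rightarrow> 'h \<Rightarrow> 'h \<Rightarrow> 'c set" where
  "cells2 T u v \<equiv> homs (Vert T) u v"

abbreviation id1 :: "('g, 'h, 'c) twocat \<Rightarrow> 'g \<Rightarrow> 'h" where
  "id1 T a \<equiv> Idn (Under T) a"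

abbreviation id2 :: "('g, 'h, 'c) twocat \<Rightarrow> 'h \<Rightarrow> 'c" where
  "id2 T u \<equiv> Idn (Vert T) u"

abbreviation comp1 :: "('g, 'h, 'c) twocat \<Rightarrow> 'h \<Rightarrow> 'h \<Rightarrow> 'h"  (infixr \<open>\<bullet>\<index>\<close> 80) where
  "v \<bullet>\<^bsub>T\<^esub> u \<equiv> Cmp (Under T) v u"

abbreviation vcomp :: "('g, 'h, 'c) twocat \<Rightarrow> 'c \<Rightarrow> 'c \<Rightarrow> 'c"  (infixr \<open>\<diamondop>\<index>\<close> 75) where
  "\<beta> \<diamondop>\<^bsub>T\<^esub> \<alpha> \<equiv> Cmp (Vert T) \<beta> \<alpha>"

abbreviation whisker_left :: "('g, 'h, 'c) twocat \<Rightarrow> 'h \<Rightarrow> 'c \<Rightarrow> 'c"  (infixr \<open>\<rhd>\<index>\<close> 78) where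
  "v \<rhd>\<^bsub>T\<^esub> \<alpha> \<equiv> id2 T v \<star>\<^bsub>T\<^esub> \<alpha>"

abbreviation whisker_right :: "('g, 'h, 'c) twocat \<Rightarrow> 'c \<Rightarrow> 'h \<Rightarrow> 'c"  (infixl \<open>\<lhd>\<index>\<close> 78) where
  "\<alpha> \<lhd>\<^bsub>T\<^esub> u \<equiv> \<alpha> \<star>\<^bsub>T\<^esub> id2 T u"

definition two_category :: "('g, 'h, 'c) twocat \<Rightarrow> bool" where
  "two_category T \<longleftrightarrow>
    category (Under T) \<and> category (Vert T) \<and> Ob (Vert T) = Arr (Under T) \<and>
    (\<forall>u v \<alpha>. \<alpha> \<in> cells2 T u v \<longrightarrow> src T u = src T v \<and> trg T u = trg T v) \<and>
    (\<forall>u u' v v' \<alpha> \<beta>. \<alpha> \<in> cells2 T u u' \<longrightarrow> \<beta> \<in> cells2 T v v' \<longrightarrow> trg T u = src T v \<longrightarrow>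
        \<beta> \<star>\<^bsub>T\<^esub> \<alpha> \<in> cells2 T (v \<bullet>\<^bsub>T\<^esub> u) (v' \<bullet>\<^bsub>T\<^esub> u')) \<and>
    (\<forall>a b c u v. u \<in> cells1 T a b \<longrightarrow> v \<in> cells1 T b c \<longrightarrow>
        id2 T v \<star>\<^bsub>T\<^esub> id2 T u = id2 T (v \<bullet>\<^bsub>T\<^esub> u)) \<and>
    (\<forall>u u' u'' v v' v'' \<alpha> \<alpha>' \<beta> \<beta>'.
        \<alpha> \<in> cells2 T u u' \<longrightarrow> \<alpha>' \<in> cells2 T u' u'' \<longrightarrow>
        \<beta> \<in> cells2 T v v' \<longrightarrow> \<beta>' \<in> cells2 T v' v'' \<longrightarrow> trg T u = src T v \<longrightarrow>
        (\<beta>' \<diamondop>\<^bsub>T\<^esub> \<beta>) \<star>\<^bsub>T\<^esub> (\<alpha>' \<diamondop>\<^bsub>T\<^esub> \<alpha>) = (\<beta>' \<star>\<^bsub>T\<^esub> \<alpha>') \<diamondop>\<^bsub>T\<^esub> (\<beta> \<star>\<^bsub>T\<^esub> \<alpha>)) \<and>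
    (\<forall>u u' v v' w w' \<alpha> \<beta> \<gamma>.
        \<alpha> \<in> cells2 T u u' \<longrightarrow> \<beta> \<in> cells2 T v v' \<longrightarrow> \<gamma> \<in> cells2 T w w' \<longrightarrow>
        trg T u = src T v \<longrightarrow> trg T v = src T w \<longrightarrow>
        (\<gamma> \<star>\<^bsub>T\<^esub> \<beta>) \<star>\<^bsub>T\<^esub> \<alpha> = \<gamma> \<star>\<^bsub>T\<^esub> (\<beta> \<star>\<^bsub>T\<^esub> \<alpha>)) \<and>
    (\<forall>u v \<alpha>. \<alpha> \<in> cells2 T u v \<longrightarrow>
        id1 T (trg T u) \<rhd>\<^bsub>T\<^esub> \<alpha> = \<alpha> \<and> \<alpha> \<lhd>\<^bsub>T\<^esub> id1 T (src T u) = \<alpha>)"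

definition two_one_category :: "('g, 'h, 'c) twocat \<Rightarrow> bool" where
  "two_one_category T \<longleftrightarrow>
    two_category T \<and> (\<forall>u v. cells2 T u v = isos (Vert T) u v)"

definition hom_cat :: "('g, 'h, 'c) twocat \<Rightarrow> 'g \<Rightarrow> 'g \<Rightarrow> ('h, 'c) cat" where
  "hom_cat T a b =
    \<lparr>Ob = cells1 T a b,
     Arr = {\<alpha> \<in> Arr (Vert T). Dom (Vert T) \<alpha> \<in> cells1 T a b \<and> Cod (Vert T) \<alpha> \<in> cells1 T a b},
     Dom = Dom (Vert T), Cod = Cod (Vert T), Idn = Idn (Vert T), Cmp = Cmp (Vert T)\<rparr>"

definition internal_equivalence :: "('g, 'h, 'c) twocat \<Rightarrow> 'g \<Rightarrow> 'g \<Rightarrow> 'h \<Rightarrow> bool" where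
  "internal_equivalence T a b u \<longleftrightarrow>
    u \<in> cells1 T a b \<and>
    (\<exists>v \<in> cells1 T b a. isos (Vert T) (v \<bullet>\<^bsub>T\<^esub> u) (id1 T a) \<noteq> {} \<and>
                        isos (Vert T) (u \<bullet>\<^bsub>T\<^esub> v) (id1 T b) \<noteq> {})"

definition prod_twocat ::
  "('g, 'h, 'c) twocat \<Rightarrow> ('g', 'h', 'c') twocat \<Rightarrow> ('g \<times> 'g', 'h \<times> 'h', 'c \<times> 'c') twocat" where
  "prod_twocat S T =
    \<lparr>Under = prod_cat (Under S) (Under T), Vert = prod_cat (Vert S) (Vert T),
     HCmp = (\<lambda>(\<beta>, \<beta>') (\<alpha>, \<alpha>'). (\<beta> \<star>\<^bsub>S\<^esub> \<alpha>, \<beta>' \<star>\<^bsub>T\<^esub> \<alpha>'))\<rparr>"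

text \<open>
  The pseudo-slice over \<open>X\<close>. An object is a 1-cell \<open>u\<close> with target \<open>X\<close>; a 1-cell \<open>(u, v, f, \<phi>)\<close>
  from \<open>u\<close> to \<open>v\<close> consists of \<open>f\<close> between the sources and an invertible \<open>\<phi>: u \<Rightarrow> v f\<close>; a 2-cell
  is a 2-cell \<open>\<theta>: f \<Rightarrow> f'\<close> compatible with \<open>\<phi>\<close> and \<open>\<phi>'\<close>, recorded with its source and target.
\<close>

definition slice_arrows :: "('g, 'h, 'c) twocat \<Rightarrow> 'g \<Rightarrow> ('h \<times> 'h \<times> 'h \<times> 'c) set" where
  "slice_arrows T X =
    {(u, v, f, \<phi>). u \<in> Arr (Under T) \<and> trg T u = X \<and> v \<in> Arr (Under T) \<and> trg T v = X \<and>
       f \<in> cells1 T (src T u) (src T v) \<and> \<phi> \<in> isos (Vert T) u (v \<bullet>\<^bsub>T\<^esub> f)}"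

definition slice_under :: "('g, 'h, 'c) twocat \<Rightarrow> 'g \<Rightarrow> ('h, 'h \<times> 'h \<times> 'h \<times> 'c) cat" where
  "slice_under T X =
    \<lparr>Ob = {u \<in> Arr (Under T). trg T u = X}, Arr = slice_arrows T X,
     Dom = (\<lambda>(u, v, f, \<phi>). u), Cod = (\<lambda>(u, v, f, \<phi>). v),
     Idn = (\<lambda>u. (u, u, id1 T (src T u), id2 T u)),
     Cmp = (\<lambda>(_, w, g, \<psi>) (u, _, f, \<phi>). (u, w, g \<bullet>\<^bsub>T\<^esub> f, (\<psi> \<lhd>\<^bsub>T\<^esub> f) \<diamondop>\<^bsub>T\<^esub> \<phi>))\<rparr>"

definition slice_vert ::
  "('g, 'h, 'c) twocat \<Rightarrow> 'g \<Rightarrow>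
   ('h \<times> 'h \<times> 'h \<times> 'c, ('h \<times> 'h \<times> 'h \<times> 'c) \<times> ('h \<times> 'h \<times> 'h \<times> 'c) \<times> 'c) cat" where
  "slice_vert T X =
    \<lparr>Ob = slice_arrows T X,
     Arr = {((u, v, f, \<phi>), (u', v', f', \<phi>'), \<theta>).
              (u, v, f, \<phi>) \<in> slice_arrows T X \<and> (u', v', f', \<phi>') \<in> slice_arrows T X \<and>
              u = u' \<and> v = v' \<and> \<theta> \<in> cells2 T f f' \<and> (v \<rhd>\<^bsub>T\<^esub> \<theta>) \<diamondop>\<^bsub>T\<^esub> \<phi> = \<phi>'},
     Dom = (\<lambda>(x, y, \<theta>). x), Cod = (\<lambda>(x, y, \<theta>). y),
     Idn = (\<lambda>(u, v, f, \<phi>). ((u, v, f, \<phi>), (u, v, f, \<phi>), id2 T f)),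
     Cmp = (\<lambda>(_, z, \<theta>') (x, _, \<theta>). (x, z, \<theta>' \<diamondop>\<^bsub>T\<^esub> \<theta>))\<rparr>"

definition slice ::
  "('g, 'h, 'c) twocat \<Rightarrow> 'g \<Rightarrow>
   ('h, 'h \<times> 'h \<times> 'h \<times> 'c, ('h \<times> 'h \<times> 'h \<times> 'c) \<times> ('h \<times> 'h \<times> 'h \<times> 'c) \<times> 'c) twocat" where
  "slice T X =
    \<lparr>Under = slice_under T X, Vert = slice_vert T X,
     HCmp = (\<lambda>(x', y', \<theta>') (x, y, \<theta>).
       (x' \<cdot>\<^bsub>slice_under T X\<^esub> x, y' \<cdot>\<^bsub>slice_under T X\<^esub> y, \<theta>' \<star>\<^bsub>T\<^esub> \<theta>))\<rparr>"

record ('g, 'h, 'c, 'g', 'h', 'c') pftr =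
  P0 :: "'g \<Rightarrow> 'g'"
  P1 :: "'h \<Rightarrow> 'h'"
  P2 :: "'c \<Rightarrow> 'c'"
  Pcomp :: "'h \<Rightarrow> 'h \<Rightarrow> 'c'"
  Punit :: "'g \<Rightarrow> 'c'"

definition pseudofunctor ::
  "('g, 'h, 'c) twocat \<Rightarrow> ('g', 'h', 'c') twocat \<Rightarrow> ('g, 'h, 'c, 'g', 'h', 'c') pftr \<Rightarrow> bool" where
  "pseudofunctor S T F \<longleftrightarrow>
    (\<forall>a \<in> Ob (Under S). P0 F a \<in> Ob (Under T)) \<and>
    (\<forall>a b. a \<in> Ob (Under S) \<longrightarrow> b \<in> Ob (Under S) \<longrightarrow>
        is_functor (hom_cat S a b) (hom_cat T (P0 F a) (P0 F b)) \<lparr>FO = P1 F, FA = P2 F\<rparr>) \<and>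
    (\<forall>a b c f g. f \<in> cells1 S a b \<longrightarrow> g \<in> cells1 S b c \<longrightarrow>
        Pcomp F g f \<in> isos (Vert T) (P1 F g \<bullet>\<^bsub>T\<^esub> P1 F f) (P1 F (g \<bullet>\<^bsub>S\<^esub> f))) \<and>
    (\<forall>a \<in> Ob (Under S). Punit F a \<in> isos (Vert T) (id1 T (P0 F a)) (P1 F (id1 S a))) \<and>
    (\<forall>f f' g g' \<alpha> \<beta>. \<alpha> \<in> cells2 S f f' \<longrightarrow> \<beta> \<in> cells2 S g g' \<longrightarrow> trg S f = src S g \<longrightarrow>
        P2 F (\<beta> \<star>\<^bsub>S\<^esub> \<alpha>) \<diamondop>\<^bsub>T\<^esub> Pcomp F g f = Pcomp F g' f' \<diamondop>\<^bsub>T\<^esub> (P2 F \<beta> \<star>\<^bsub>T\<^esub> P2 F \<alpha>)) \<and>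
    (\<forall>a b c d f g h. f \<in> cells1 S a b \<longrightarrow> g \<in> cells1 S b c \<longrightarrow> h \<in> cells1 S c d \<longrightarrow>
        Pcomp F h (g \<bullet>\<^bsub>S\<^esub> f) \<diamondop>\<^bsub>T\<^esub> (P1 F h \<rhd>\<^bsub>T\<^esub> Pcomp F g f) =
        Pcomp F (h \<bullet>\<^bsub>S\<^esub> g) f \<diamondop>\<^bsub>T\<^esub> (Pcomp F h g \<lhd>\<^bsub>T\<^esub> P1 F f)) \<and>
    (\<forall>a b f. f \<in> cells1 S a b \<longrightarrow>
        Pcomp F (id1 S b) f \<diamondop>\<^bsub>T\<^esub> (Punit F b \<lhd>\<^bsub>T\<^esub> P1 F f) = id2 T (P1 F f) \<and>
        Pcomp F f (id1 S a) \<diamondop>\<^bsub>T\<^esub> (P1 F f \<rhd>\<^bsub>T\<^esub> Punit F a) = id2 T (P1 F f))"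

text \<open>
  Biequivalence: a pseudofunctor that is an equivalence on Hom categories and surjective on
  objects up to internal equivalence.
\<close>

definition biequivalence ::
  "('g, 'h, 'c) twocat \<Rightarrow> ('g', 'h', 'c') twocat \<Rightarrow> ('g, 'h, 'c, 'g', 'h', 'c') pftr \<Rightarrow> bool" where
  "biequivalence S T F \<longleftrightarrow>
    pseudofunctor S T F \<and>
    (\<forall>a \<in> Ob (Under S). \<forall>b \<in> Ob (Under S).
        cat_equivalence (hom_cat S a b) (hom_cat T (P0 F a) (P0 F b))
          \<lparr>FO = P1 F, FA = P2 F\<rparr>) \<and>
    (\<forall>c \<in> Ob (Under T). \<exists>a \<in> Ob (Under S). \<exists>e. internal_equivalence T (P0 F a) c e)"


section \<open>Finite products and coproducts, pseudopullbacks\<close>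

text \<open>
  Products and coproducts are meant in the bicategorical sense: the universal property is an
  equivalence, not an isomorphism, of Hom categories.
\<close>

definition is_coproduct ::
  "('g, 'h, 'c) twocat \<Rightarrow> nat \<Rightarrow> (nat \<Rightarrow> 'g) \<Rightarrow> 'g \<Rightarrow> (nat \<Rightarrow> 'h) \<Rightarrow> bool" where
  "is_coproduct T n H S \<iota> \<longleftrightarrow>
    S \<in> Ob (Under T) \<and> (\<forall>l<n. \<iota> l \<in> cells1 T (H l) S) \<and>
    (\<forall>X \<in> Ob (Under T).
      cat_equivalence (hom_cat T S X) (family_cat n (\<lambda>l. hom_cat T (H l) X))
        \<lparr>FO = (\<lambda>f. \<lambda>l\<in>{..<n}. f \<bullet>\<^bsub>T\<^esub> \<iota> l), FA = (\<lambda>\<alpha>. \<lambda>l\<in>{..<n}. \<alpha> \<lhd>\<^bsub>T\<^esub> \<iota> l)\<rparr>)"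

definition is_product ::
  "('g, 'h, 'c) twocat \<Rightarrow> nat \<Rightarrow> (nat \<Rightarrow> 'g) \<Rightarrow> 'g \<Rightarrow> (nat \<Rightarrow> 'h) \<Rightarrow> bool" where
  "is_product T n H P pr \<longleftrightarrow>
    P \<in> Ob (Under T) \<and> (\<forall>l<n. pr l \<in> cells1 T P (H l)) \<and>
    (\<forall>X \<in> Ob (Under T).
      cat_equivalence (hom_cat T X P) (family_cat n (\<lambda>l. hom_cat T X (H l)))
        \<lparr>FO = (\<lambda>f. \<lambda>l\<in>{..<n}. pr l \<bullet>\<^bsub>T\<^esub> f), FA = (\<lambda>\<alpha>. \<lambda>l\<in>{..<n}. pr l \<rhd>\<^bsub>T\<^esub> \<alpha>)\<rparr>)"

definition has_finite_coproducts :: "('g, 'h, 'c) twocat \<Rightarrow> bool" where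
  "has_finite_coproducts T \<longleftrightarrow>
    (\<forall>n H. (\<forall>l<n. H l \<in> Ob (Under T)) \<longrightarrow> (\<exists>S \<iota>. is_coproduct T n H S \<iota>))"

definition has_finite_products :: "('g, 'h, 'c) twocat \<Rightarrow> bool" where
  "has_finite_products T \<longleftrightarrow>
    (\<forall>n H. (\<forall>l<n. H l \<in> Ob (Under T)) \<longrightarrow> (\<exists>P pr. is_product T n H P pr))"

definition two_family :: "'a \<Rightarrow> 'a \<Rightarrow> nat \<Rightarrow> 'a" where
  "two_family x y = (\<lambda>l. if l = 0 then x else y)"

text \<open>
  A choice of binary coproducts of objects and of 1-cells. Since coproducts are bicategorical,
  \<open>u \<squnion> v\<close> commutes with the injections only up to the chosen isomorphisms \<open>csq1\<close> and \<open>csq2\<close>.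
\<close>

record ('g, 'h, 'c) coprods =
  csum :: "'g \<Rightarrow> 'g \<Rightarrow> 'g"
  inj1 :: "'g \<Rightarrow> 'g \<Rightarrow> 'h"
  inj2 :: "'g \<Rightarrow> 'g \<Rightarrow> 'h"
  csum1 :: "'h \<Rightarrow> 'h \<Rightarrow> 'h"
  csq1 :: "'h \<Rightarrow> 'h \<Rightarrow> 'c"
  csq2 :: "'h \<Rightarrow> 'h \<Rightarrow> 'c"

definition coproduct_choice ::
  "('g, 'h, 'c) twocat \<Rightarrow> ('g, 'h, 'c) coprods \<Rightarrow> bool" where
  "coproduct_choice T Q \<longleftrightarrow>
    (\<forall>G \<in> Ob (Under T). \<forall>H \<in> Ob (Under T).
        is_coproduct T 2 (two_family G H) (csum Q G H) (two_family (inj1 Q G H) (inj2 Q G H))) \<and>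
    (\<forall>K G L H u v. u \<in> cells1 T K G \<longrightarrow> v \<in> cells1 T L H \<longrightarrow>
        csum1 Q u v \<in> cells1 T (csum Q K L) (csum Q G H) \<and>
        csq1 Q u v \<in> isos (Vert T) (csum1 Q u v \<bullet>\<^bsub>T\<^esub> inj1 Q K L) (inj1 Q G H \<bullet>\<^bsub>T\<^esub> u) \<and>
        csq2 Q u v \<in> isos (Vert T) (csum1 Q u v \<bullet>\<^bsub>T\<^esub> inj2 Q K L) (inj2 Q G H \<bullet>\<^bsub>T\<^esub> v))"

text \<open>
  The 2-cell \<open>\<omega>: s \<Rightarrow> t\<close> between 1-cells out of \<open>K \<squnion> L\<close> determined by its restrictions along the
  two injections; these are prescribed up to invertible 2-cells \<open>r\<^sub>1\<close> and \<open>r\<^sub>2\<close>.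
\<close>

definition coproduct_cell ::
  "('g, 'h, 'c) twocat \<Rightarrow> ('g, 'h, 'c) coprods \<Rightarrow> 'g \<Rightarrow> 'g \<Rightarrow> 'h \<Rightarrow> 'h \<Rightarrow>
   'c \<Rightarrow> 'c \<Rightarrow> 'c \<Rightarrow> 'c \<Rightarrow> 'c" where
  "coproduct_cell T Q K L s t r1 a1 r2 a2 =
    (THE \<omega>. \<omega> \<in> cells2 T s t \<and>
      r1 \<diamondop>\<^bsub>T\<^esub> (\<omega> \<lhd>\<^bsub>T\<^esub> inj1 Q K L) = a1 \<and> r2 \<diamondop>\<^bsub>T\<^esub> (\<omega> \<lhd>\<^bsub>T\<^esub> inj2 Q K L) = a2)"

text \<open>
  The pseudofunctor \<open>(u, v) \<mapsto> u \<squnion> v\<close> from the product of the slices over \<open>G\<close> and \<open>H\<close> to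
  the slice over \<open>G \<squnion> H\<close>: its action on 1-cells and on 2-cells, its composition and unit
  constraints, and the resulting record.
\<close>

fun slice_sum1 ::
  "('g, 'h, 'c) twocat \<Rightarrow> ('g, 'h, 'c) coprods \<Rightarrow> 'g \<Rightarrow> 'g \<Rightarrow>
   ('h \<times> 'h \<times> 'h \<times> 'c) \<times> ('h \<times> 'h \<times> 'h \<times> 'c) \<Rightarrow> 'h \<times> 'h \<times> 'h \<times> 'c" where
  "slice_sum1 T Q G H ((u, u', f, \<phi>), (v, v', g, \<psi>)) =
    (csum1 Q u v, csum1 Q u' v', csum1 Q f g,
     coproduct_cell T Q (src T u) (src T v) (csum1 Q u v) (csum1 Q u' v' \<bullet>\<^bsub>T\<^esub> csum1 Q f g)
       ((csq1 Q u' v' \<lhd>\<^bsub>T\<^esub> f) \<diamondop>\<^bsub>T\<^esub> (csum1 Q u' v' \<rhd>\<^bsub>T\<^esub> csq1 Q f g))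
       ((inj1 Q G H \<rhd>\<^bsub>T\<^esub> \<phi>) \<diamondop>\<^bsub>T\<^esub> csq1 Q u v)
       ((csq2 Q u' v' \<lhd>\<^bsub>T\<^esub> g) \<diamondop>\<^bsub>T\<^esub> (csum1 Q u' v' \<rhd>\<^bsub>T\<^esub> csq2 Q f g))
       ((inj2 Q G H \<rhd>\<^bsub>T\<^esub> \<psi>) \<diamondop>\<^bsub>T\<^esub> csq2 Q u v))"

fun slice_sum2 ::
  "('g, 'h, 'c) twocat \<Rightarrow> ('g, 'h, 'c) coprods \<Rightarrow> 'g \<Rightarrow> 'g \<Rightarrow>
   (('h \<times> 'h \<times> 'h \<times> 'c) \<times> ('h \<times> 'h \<times> 'h \<times> 'c) \<times> 'c) \<times>
     (('h \<times> 'h \<times> 'h \<times> 'c) \<times> ('h \<times> 'h \<times> 'h \<times> 'c) \<times> 'c) \<Rightarrow>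
   ('h \<times> 'h \<times> 'h \<times> 'c) \<times> ('h \<times> 'h \<times> 'h \<times> 'c) \<times> 'c" where
  "slice_sum2 T Q G H
     (((u, u', f, \<phi>), (u1, u1', f1, \<phi>1), \<theta>), ((v, v', g, \<psi>), (v1, v1', g1, \<psi>1), \<kappa>)) =
    (slice_sum1 T Q G H ((u, u', f, \<phi>), (v, v', g, \<psi>)),
     slice_sum1 T Q G H ((u1, u1', f1, \<phi>1), (v1, v1', g1, \<psi>1)),
     coproduct_cell T Q (src T u) (src T v) (csum1 Q f g) (csum1 Q f1 g1)
       (csq1 Q f1 g1) ((inj1 Q (src T u') (src T v') \<rhd>\<^bsub>T\<^esub> \<theta>) \<diamondop>\<^bsub>T\<^esub> csq1 Q f g)
       (csq2 Q f1 g1) ((inj2 Q (src T u') (src T v') \<rhd>\<^bsub>T\<^esub> \<kappa>) \<diamondop>\<^bsub>T\<^esub> csq2 Q f g))"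

fun slice_sum_comp ::
  "('g, 'h, 'c) twocat \<Rightarrow> ('g, 'h, 'c) coprods \<Rightarrow> 'g \<Rightarrow> 'g \<Rightarrow>
   ('h \<times> 'h \<times> 'h \<times> 'c) \<times> ('h \<times> 'h \<times> 'h \<times> 'c) \<Rightarrow>
   ('h \<times> 'h \<times> 'h \<times> 'c) \<times> ('h \<times> 'h \<times> 'h \<times> 'c) \<Rightarrow>
   ('h \<times> 'h \<times> 'h \<times> 'c) \<times> ('h \<times> 'h \<times> 'h \<times> 'c) \<times> 'c" where
  "slice_sum_comp T Q G H
     ((u', u'', f', \<phi>'), (v', v'', g', \<psi>')) ((u, u1, f, \<phi>), (v, v1, g, \<psi>)) =
    (slice_sum1 T Q G H ((u', u'', f', \<phi>'), (v', v'', g', \<psi>'))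
       \<cdot>\<^bsub>slice_under T (csum Q G H)\<^esub> slice_sum1 T Q G H ((u, u1, f, \<phi>), (v, v1, g, \<psi>)),
     slice_sum1 T Q G H
       ((u', u'', f', \<phi>') \<cdot>\<^bsub>slice_under T G\<^esub> (u, u1, f, \<phi>),
        (v', v'', g', \<psi>') \<cdot>\<^bsub>slice_under T H\<^esub> (v, v1, g, \<psi>)),
     coproduct_cell T Q (src T u) (src T v)
       (csum1 Q f' g' \<bullet>\<^bsub>T\<^esub> csum1 Q f g) (csum1 Q (f' \<bullet>\<^bsub>T\<^esub> f) (g' \<bullet>\<^bsub>T\<^esub> g))
       (csq1 Q (f' \<bullet>\<^bsub>T\<^esub> f) (g' \<bullet>\<^bsub>T\<^esub> g))
       ((csq1 Q f' g' \<lhd>\<^bsub>T\<^esub> f) \<diamondop>\<^bsub>T\<^esub> (csum1 Q f' g' \<rhd>\<^bsub>T\<^esub> csq1 Q f g))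
       (csq2 Q (f' \<bullet>\<^bsub>T\<^esub> f) (g' \<bullet>\<^bsub>T\<^esub> g))
       ((csq2 Q f' g' \<lhd>\<^bsub>T\<^esub> g) \<diamondop>\<^bsub>T\<^esub> (csum1 Q f' g' \<rhd>\<^bsub>T\<^esub> csq2 Q f g)))"

fun slice_sum_unit ::
  "('g, 'h, 'c) twocat \<Rightarrow> ('g, 'h, 'c) coprods \<Rightarrow> 'g \<Rightarrow> 'g \<Rightarrow> 'h \<times> 'h \<Rightarrow>
   ('h \<times> 'h \<times> 'h \<times> 'c) \<times> ('h \<times> 'h \<times> 'h \<times> 'c) \<times> 'c" where
  "slice_sum_unit T Q G H (u, v) =
    (let K = src T u; L = src T v in
      (Idn (slice_under T (csum Q G H)) (csum1 Q u v),
       slice_sum1 T Q G H (Idn (slice_under T G) u, Idn (slice_under T H) v),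
       coproduct_cell T Q K L (id1 T (csum Q K L)) (csum1 Q (id1 T K) (id1 T L))
         (csq1 Q (id1 T K) (id1 T L)) (id2 T (inj1 Q K L))
         (csq2 Q (id1 T K) (id1 T L)) (id2 T (inj2 Q K L))))"

definition coproduct_slices ::
  "('g, 'h, 'c) twocat \<Rightarrow> ('g, 'h, 'c) coprods \<Rightarrow> 'g \<Rightarrow> 'g \<Rightarrow>
   ('h \<times> 'h,
    ('h \<times> 'h \<times> 'h \<times> 'c) \<times> ('h \<times> 'h \<times> 'h \<times> 'c),
    (('h \<times> 'h \<times> 'h \<times> 'c) \<times> ('h \<times> 'h \<times> 'h \<times> 'c) \<times> 'c) \<times>
      (('h \<times> 'h \<times> 'h \<times> 'c) \<times> ('h \<times> 'h \<times> 'h \<times> 'c) \<times> 'c),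
    'h,
    'h \<times> 'h \<times> 'h \<times> 'c,
    ('h \<times> 'h \<times> 'h \<times> 'c) \<times> ('h \<times> 'h \<times> 'h \<times> 'c) \<times> 'c) pftr" where
  "coproduct_slices T Q G H =
    \<lparr>P0 = (\<lambda>(u, v). csum1 Q u v),
     P1 = slice_sum1 T Q G H,
     P2 = slice_sum2 T Q G H,
     Pcomp = slice_sum_comp T Q G H,
     Punit = slice_sum_unit T Q G H\<rparr>"

definition extensive :: "('g, 'h, 'c) twocat \<Rightarrow> bool" where
  "extensive T \<longleftrightarrow>
    has_finite_coproducts T \<and>
    (\<forall>Q. coproduct_choice T Q \<longrightarrow>
      (\<forall>G \<in> Ob (Under T). \<forall>H \<in> Ob (Under T).
        biequivalence (prod_twocat (slice T G) (slice T H)) (slice T (csum Q G H))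
          (coproduct_slices T Q G H)))"

text \<open>
  The iso-comma category of the functors \<open>Hom(X, i)\<close> and \<open>Hom(X, u)\<close>; arrows are recorded with
  their source and target.
\<close>

definition isocomma ::
  "('g, 'h, 'c) twocat \<Rightarrow> 'g \<Rightarrow> 'h \<Rightarrow> 'h \<Rightarrow>
   ('h \<times> 'h \<times> 'c, ('h \<times> 'h \<times> 'c) \<times> ('h \<times> 'h \<times> 'c) \<times> 'c \<times> 'c) cat" where
  "isocomma T X i u =
    (let obs = {(a, b, \<delta>). a \<in> cells1 T X (src T i) \<and> b \<in> cells1 T X (src T u) \<and>
                           \<delta> \<in> isos (Vert T) (i \<bullet>\<^bsub>T\<^esub> a) (u \<bullet>\<^bsub>T\<^esub> b)}
     in
      \<lparr>Ob = obs,
       Arr = {((a, b, \<delta>), (a', b', \<delta>'), \<theta>, \<tau>).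
                (a, b, \<delta>) \<in> obs \<and> (a', b', \<delta>') \<in> obs \<and>
                \<theta> \<in> cells2 T a a' \<and> \<tau> \<in> cells2 T b b' \<and>
                \<delta>' \<diamondop>\<^bsub>T\<^esub> (i \<rhd>\<^bsub>T\<^esub> \<theta>) = (u \<rhd>\<^bsub>T\<^esub> \<tau>) \<diamondop>\<^bsub>T\<^esub> \<delta>},
       Dom = (\<lambda>(x, y, \<theta>, \<tau>). x), Cod = (\<lambda>(x, y, \<theta>, \<tau>). y),
       Idn = (\<lambda>(a, b, \<delta>). ((a, b, \<delta>), (a, b, \<delta>), id2 T a, id2 T b)),
       Cmp = (\<lambda>(_, z, \<theta>', \<tau>') (x, _, \<theta>, \<tau>). (x, z, \<theta>' \<diamondop>\<^bsub>T\<^esub> \<theta>, \<tau>' \<diamondop>\<^bsub>T\<^esub> \<tau>))\<rparr>)"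

definition pseudopullback ::
  "('g, 'h, 'c) twocat \<Rightarrow> 'h \<Rightarrow> 'h \<Rightarrow> 'h \<Rightarrow> 'h \<Rightarrow> 'c \<Rightarrow> bool" where
  "pseudopullback T i u p q \<gamma> \<longleftrightarrow>
    (\<exists>P H K G. p \<in> cells1 T P H \<and> q \<in> cells1 T P K \<and> i \<in> cells1 T H G \<and> u \<in> cells1 T K G \<and>
      \<gamma> \<in> isos (Vert T) (i \<bullet>\<^bsub>T\<^esub> p) (u \<bullet>\<^bsub>T\<^esub> q) \<and>
      (\<forall>X \<in> Ob (Under T).
        cat_equivalence (hom_cat T X P) (isocomma T X i u)
          \<lparr>FO = (\<lambda>w. (p \<bullet>\<^bsub>T\<^esub> w, q \<bullet>\<^bsub>T\<^esub> w, \<gamma> \<lhd>\<^bsub>T\<^esub> w)),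
           FA = (\<lambda>\<alpha>. let w = Dom (Vert T) \<alpha>; w' = Cod (Vert T) \<alpha> in
                   ((p \<bullet>\<^bsub>T\<^esub> w, q \<bullet>\<^bsub>T\<^esub> w, \<gamma> \<lhd>\<^bsub>T\<^esub> w),
                    (p \<bullet>\<^bsub>T\<^esub> w', q \<bullet>\<^bsub>T\<^esub> w', \<gamma> \<lhd>\<^bsub>T\<^esub> w'),
                    p \<rhd>\<^bsub>T\<^esub> \<alpha>, q \<rhd>\<^bsub>T\<^esub> \<alpha>))\<rparr>))"


section \<open>Spannable pairs\<close>

text \<open>
  A 2-full 2-subcategory is given by its set \<open>J\<close> of 1-cells; as it contains all equivalences,
  it contains all identities and therefore all objects.
\<close>

definition spannable_pair :: "('g, 'h, 'c) twocat \<Rightarrow> 'h set \<Rightarrow> bool" where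
  "spannable_pair T J \<longleftrightarrow>
    two_one_category T \<and> extensive T \<and>
    J \<subseteq> Arr (Under T) \<and>
    (\<forall>a b c i j. i \<in> J \<longrightarrow> j \<in> J \<longrightarrow> i \<in> cells1 T a b \<longrightarrow> j \<in> cells1 T b c \<longrightarrow> j \<bullet>\<^bsub>T\<^esub> i \<in> J) \<and>
    (\<forall>a b u. internal_equivalence T a b u \<longrightarrow> u \<in> J) \<and>
    (\<forall>i j. i \<in> J \<longrightarrow> isos (Vert T) i j \<noteq> {} \<longrightarrow> j \<in> J) \<and>
    (\<forall>G H K i u. i \<in> J \<longrightarrow> i \<in> cells1 T H G \<longrightarrow> u \<in> cells1 T K G \<longrightarrow>
        (\<exists>p q \<gamma>. pseudopullback T i u p q \<gamma> \<and> q \<in> J)) \<and>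
    (\<forall>n H S \<iota> G u w.
        is_coproduct T n H S \<iota> \<longrightarrow> (\<forall>l<n. u l \<in> cells1 T (H l) G) \<longrightarrow>
        w \<in> cells1 T S G \<longrightarrow> (\<forall>l<n. isos (Vert T) (w \<bullet>\<^bsub>T\<^esub> \<iota> l) (u l) \<noteq> {}) \<longrightarrow>
        (w \<in> J \<longleftrightarrow> (\<forall>l<n. u l \<in> J)))"

text \<open>
  A choice of binary products of objects and of 1-cells; as for coproducts, \<open>u\<^sub>1 \<times> u\<^sub>2\<close> commutes
  with the projections up to the chosen isomorphisms \<open>psq1\<close> and \<open>psq2\<close>.
\<close>

record ('g, 'h, 'c) prods =
  prd :: "'g \<Rightarrow> 'g \<Rightarrow> 'g"
  pr1 :: "'g \<Rightarrow> 'g \<Rightarrow> 'h"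
  pr2 :: "'g \<Rightarrow> 'g \<Rightarrow> 'h"
  prd1 :: "'h \<Rightarrow> 'h \<Rightarrow> 'h"
  psq1 :: "'h \<Rightarrow> 'h \<Rightarrow> 'c"
  psq2 :: "'h \<Rightarrow> 'h \<Rightarrow> 'c"

definition product_choice ::
  "('g, 'h, 'c) twocat \<Rightarrow> ('g, 'h, 'c) prods \<Rightarrow> bool" where
  "product_choice T Q \<longleftrightarrow>
    (\<forall>G1 \<in> Ob (Under T). \<forall>G2 \<in> Ob (Under T).
        is_product T 2 (two_family G1 G2) (prd Q G1 G2) (two_family (pr1 Q G1 G2) (pr2 Q G1 G2))) \<and>
    (\<forall>H1 G1 H2 G2 u1 u2. u1 \<in> cells1 T H1 G1 \<longrightarrow> u2 \<in> cells1 T H2 G2 \<longrightarrow>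
        prd1 Q u1 u2 \<in> cells1 T (prd Q H1 H2) (prd Q G1 G2) \<and>
        psq1 Q u1 u2 \<in> isos (Vert T) (pr1 Q G1 G2 \<bullet>\<^bsub>T\<^esub> prd1 Q u1 u2) (u1 \<bullet>\<^bsub>T\<^esub> pr1 Q H1 H2) \<and>
        psq2 Q u1 u2 \<in> isos (Vert T) (pr2 Q G1 G2 \<bullet>\<^bsub>T\<^esub> prd1 Q u1 u2) (u2 \<bullet>\<^bsub>T\<^esub> pr2 Q H1 H2))"

definition cartesian_spannable_pair :: "('g, 'h, 'c) twocat \<Rightarrow> 'h set \<Rightarrow> bool" where
  "cartesian_spannable_pair T J \<longleftrightarrow>
    spannable_pair T J \<and> has_finite_products T \<and>
    (\<forall>Q. product_choice T Q \<longrightarrow> (\<forall>i1 \<in> J. \<forall>i2 \<in> J. prd1 Q i1 i2 \<in> J))"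


section \<open>Mackey 2-functors\<close>

record ('k, 'g, 'h, 'c, 'o, 'm) twofun =
  MC :: "'g \<Rightarrow> ('k, 'o, 'm) lincat"
  Res :: "'h \<Rightarrow> ('o, 'm, 'o, 'm) ftr"
  Res2 :: "'c \<Rightarrow> 'o \<Rightarrow> 'm"

text \<open>
  Strict 2-functors to the 2-category of (idempotent complete) additive categories, contravariant
  on 1-cells and covariant on 2-cells. \<open>Res u\<close> is the restriction functor along \<open>u\<close>, and
  \<open>Res2 \<alpha> X\<close> is the component at \<open>X\<close> of the natural transformation associated with \<open>\<alpha>\<close>.
\<close>

definition two_functor ::
  "('k, 'r) ring_scheme \<Rightarrow> bool \<Rightarrow> ('g, 'h, 'c) twocat \<Rightarrow>
   ('k, 'g, 'h, 'c, 'o, 'm, 'x) twofun_scheme \<Rightarrow> bool" where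
  "two_functor R ic T M \<longleftrightarrow>
    (\<forall>G \<in> Ob (Under T). target_object R ic (MC M G)) \<and>
    (\<forall>H G u. u \<in> cells1 T H G \<longrightarrow> linear_functor R (MC M G) (MC M H) (Res M u)) \<and>
    (\<forall>G \<in> Ob (Under T).
        (\<forall>X \<in> Ob (MC M G). FO (Res M (id1 T G)) X = X) \<and>
        (\<forall>f \<in> Arr (MC M G). FA (Res M (id1 T G)) f = f)) \<and>
    (\<forall>K H G v u. v \<in> cells1 T K H \<longrightarrow> u \<in> cells1 T H G \<longrightarrow>
        (\<forall>X \<in> Ob (MC M G). FO (Res M (u \<bullet>\<^bsub>T\<^esub> v)) X = FO (Res M v) (FO (Res M u) X)) \<and>
        (\<forall>f \<in> Arr (MC M G). FA (Res M (u \<bullet>\<^bsub>T\<^esub> v)) f = FA (Res M v) (FA (Res M u) f))) \<and>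
    (\<forall>u u' \<alpha>. \<alpha> \<in> cells2 T u u' \<longrightarrow>
        nat_trans (MC M (trg T u)) (MC M (src T u)) (Res M u) (Res M u') (Res2 M \<alpha>)) \<and>
    (\<forall>H G u. u \<in> cells1 T H G \<longrightarrow>
        (\<forall>X \<in> Ob (MC M G). Res2 M (id2 T u) X = Idn (MC M H) (FO (Res M u) X))) \<and>
    (\<forall>u u' u'' \<alpha> \<beta>. \<alpha> \<in> cells2 T u u' \<longrightarrow> \<beta> \<in> cells2 T u' u'' \<longrightarrow>
        (\<forall>X \<in> Ob (MC M (trg T u)).
          Res2 M (\<beta> \<diamondop>\<^bsub>T\<^esub> \<alpha>) X = Res2 M \<beta> X \<cdot>\<^bsub>MC M (src T u)\<^esub> Res2 M \<alpha> X)) \<and>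
    (\<forall>u u' v v' \<alpha> \<beta>. \<alpha> \<in> cells2 T u u' \<longrightarrow> \<beta> \<in> cells2 T v v' \<longrightarrow> trg T v = src T u \<longrightarrow>
        (\<forall>X \<in> Ob (MC M (trg T u)).
          Res2 M (\<alpha> \<star>\<^bsub>T\<^esub> \<beta>) X
            = Res2 M \<beta> (FO (Res M u') X) \<cdot>\<^bsub>MC M (src T v)\<^esub> FA (Res M v) (Res2 M \<alpha> X)))"

text \<open>
  Rectified data: the single functor \<open>Ind i\<close> is both the left adjoint and the right adjoint of
  \<open>Res i\<close>, with units and counits \<open>lunit\<close>, \<open>lcounit\<close> and \<open>runit\<close>, \<open>rcounit\<close> respectively.
\<close>

record ('k, 'g, 'h, 'c, 'o, 'm) mackey = "('k, 'g, 'h, 'c, 'o, 'm) twofun" +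
  Ind :: "'h \<Rightarrow> ('o, 'm, 'o, 'm) ftr"
  lunit :: "'h \<Rightarrow> 'o \<Rightarrow> 'm"
  lcounit :: "'h \<Rightarrow> 'o \<Rightarrow> 'm"
  runit :: "'h \<Rightarrow> 'o \<Rightarrow> 'm"
  rcounit :: "'h \<Rightarrow> 'o \<Rightarrow> 'm"

text \<open>
  The mates of \<open>\<gamma>: i p \<Rightarrow> u q\<close>: the map \<open>q\<^sub>! p\<^sup>* Y \<rightarrow> u\<^sup>* i\<^sub>! Y\<close> induced by \<open>\<gamma>\<close> and the map
  \<open>u\<^sup>* i\<^sub>* Y \<rightarrow> q\<^sub>* p\<^sup>* Y\<close> induced by the inverse of \<open>\<gamma>\<close>.
\<close>

definition left_mate ::
  "('g, 'h, 'c) twocat \<Rightarrow> ('k, 'g, 'h, 'c, 'o, 'm) mackey \<Rightarrow>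
   'h \<Rightarrow> 'h \<Rightarrow> 'h \<Rightarrow> 'h \<Rightarrow> 'c \<Rightarrow> 'o \<Rightarrow> 'm" where
  "left_mate T M i u p q \<gamma> Y =
    (let D = MC M (src T u) in
      lcounit M q (FO (Res M u) (FO (Ind M i) Y))
      \<cdot>\<^bsub>D\<^esub> FA (Ind M q) (Res2 M \<gamma> (FO (Ind M i) Y))
      \<cdot>\<^bsub>D\<^esub> FA (Ind M q) (FA (Res M p) (lunit M i Y)))"

definition right_mate ::
  "('g, 'h, 'c) twocat \<Rightarrow> ('k, 'g, 'h, 'c, 'o, 'm) mackey \<Rightarrow>
   'h \<Rightarrow> 'h \<Rightarrow> 'h \<Rightarrow> 'h \<Rightarrow> 'c \<Rightarrow> 'o \<Rightarrow> 'm" where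
  "right_mate T M i u p q \<gamma> Y =
    (let D = MC M (src T u) in
      FA (Ind M q) (FA (Res M p) (rcounit M i Y))
      \<cdot>\<^bsub>D\<^esub> FA (Ind M q) (Res2 M (inv_arr (Vert T) \<gamma>) (FO (Ind M i) Y))
      \<cdot>\<^bsub>D\<^esub> runit M q (FO (Res M u) (FO (Ind M i) Y)))"

text \<open>
  The structure of the pseudofunctors \<open>i \<mapsto> i\<^sub>!\<close> and \<open>i \<mapsto> i\<^sub>*\<close> on \<open>J\<close>, obtained from the
  2-functor and the chosen adjunctions. For \<open>\<alpha>: i \<Rightarrow> j\<close> these are the maps \<open>j\<^sub>! Y \<rightarrow> i\<^sub>! Y\<close> and
  \<open>j\<^sub>* Y \<rightarrow> i\<^sub>* Y\<close>; for composable \<open>j\<close>, \<open>i\<close> the maps \<open>(i j)\<^sub>! Y \<rightarrow> i\<^sub>! j\<^sub>! Y\<close> and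
  \<open>i\<^sub>* j\<^sub>* Y \<rightarrow> (i j)\<^sub>* Y\<close>.
\<close>

definition shriek2 ::
  "('g, 'h, 'c) twocat \<Rightarrow> ('k, 'g, 'h, 'c, 'o, 'm) mackey \<Rightarrow> 'h \<Rightarrow> 'h \<Rightarrow> 'c \<Rightarrow> 'o \<Rightarrow> 'm" where
  "shriek2 T M i j \<alpha> Y =
    (let D = MC M (trg T i) in
      lcounit M j (FO (Ind M i) Y)
      \<cdot>\<^bsub>D\<^esub> FA (Ind M j) (Res2 M \<alpha> (FO (Ind M i) Y))
      \<cdot>\<^bsub>D\<^esub> FA (Ind M j) (lunit M i Y))"

definition star2 ::
  "('g, 'h, 'c) twocat \<Rightarrow> ('k, 'g, 'h, 'c, 'o, 'm) mackey \<Rightarrow> 'h \<Rightarrow> 'h \<Rightarrow> 'c \<Rightarrow> 'o \<Rightarrow> 'm" where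
  "star2 T M i j \<alpha> Y =
    (let D = MC M (trg T i) in
      FA (Ind M i) (rcounit M j Y)
      \<cdot>\<^bsub>D\<^esub> FA (Ind M i) (Res2 M \<alpha> (FO (Ind M j) Y))
      \<cdot>\<^bsub>D\<^esub> runit M i (FO (Ind M j) Y))"

definition shriek_comp ::
  "('g, 'h, 'c) twocat \<Rightarrow> ('k, 'g, 'h, 'c, 'o, 'm) mackey \<Rightarrow> 'h \<Rightarrow> 'h \<Rightarrow> 'o \<Rightarrow> 'm" where
  "shriek_comp T M i j Y =
    (let D = MC M (trg T i) in
      lcounit M (i \<bullet>\<^bsub>T\<^esub> j) (FO (Ind M i) (FO (Ind M j) Y))
      \<cdot>\<^bsub>D\<^esub> FA (Ind M (i \<bullet>\<^bsub>T\<^esub> j)) (FA (Res M j) (lunit M i (FO (Ind M j) Y)))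
      \<cdot>\<^bsub>D\<^esub> FA (Ind M (i \<bullet>\<^bsub>T\<^esub> j)) (lunit M j Y))"

definition star_comp ::
  "('g, 'h, 'c) twocat \<Rightarrow> ('k, 'g, 'h, 'c, 'o, 'm) mackey \<Rightarrow> 'h \<Rightarrow> 'h \<Rightarrow> 'o \<Rightarrow> 'm" where
  "star_comp T M i j Y =
    (let D = MC M (trg T i) in
      FA (Ind M (i \<bullet>\<^bsub>T\<^esub> j)) (rcounit M j Y)
      \<cdot>\<^bsub>D\<^esub> FA (Ind M (i \<bullet>\<^bsub>T\<^esub> j)) (FA (Res M j) (rcounit M i (FO (Ind M j) Y)))
      \<cdot>\<^bsub>D\<^esub> runit M (i \<bullet>\<^bsub>T\<^esub> j) (FO (Ind M i) (FO (Ind M j) Y)))"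

text \<open>
  Equality of the two pseudofunctors on 1-cells is built into the record \<open>mackey\<close>. The structure
  isomorphisms \<open>shriek_comp\<close> and \<open>star_comp\<close> (and likewise the unit isomorphisms, which are the
  left counit and the right unit at an identity 1-cell) point in opposite directions, so equality
  of the pseudofunctors means that they are inverse to each other.
\<close>

definition mackey_2functor ::
  "('k, 'r) ring_scheme \<Rightarrow> bool \<Rightarrow> ('g, 'h, 'c) twocat \<Rightarrow> 'h set \<Rightarrow>
   ('k, 'g, 'h, 'c, 'o, 'm) mackey \<Rightarrow> bool" where
  "mackey_2functor R ic T J M \<longleftrightarrow>
    two_functor R ic T M \<and>
    (\<forall>n H S \<iota>. is_coproduct T n H S \<iota> \<longrightarrow> (\<forall>l<n. H l \<in> Ob (Under T)) \<longrightarrow>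
        cat_equivalence (MC M S) (family_cat n (\<lambda>l. MC M (H l)))
          \<lparr>FO = (\<lambda>X. \<lambda>l\<in>{..<n}. FO (Res M (\<iota> l)) X),
           FA = (\<lambda>f. \<lambda>l\<in>{..<n}. FA (Res M (\<iota> l)) f)\<rparr>) \<and>
    (\<forall>H G i. i \<in> J \<longrightarrow> i \<in> cells1 T H G \<longrightarrow>
        linear_functor R (MC M H) (MC M G) (Ind M i) \<and>
        adjunction (MC M H) (MC M G) (Ind M i) (Res M i) (lunit M i) (lcounit M i) \<and>
        adjunction (MC M G) (MC M H) (Res M i) (Ind M i) (runit M i) (rcounit M i) \<and>
        (\<forall>Y \<in> Ob (MC M H). rcounit M i Y \<cdot>\<^bsub>MC M H\<^esub> lunit M i Y = Idn (MC M H) Y)) \<and>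
    (\<forall>i u p q \<gamma>. pseudopullback T i u p q \<gamma> \<longrightarrow> i \<in> J \<longrightarrow> q \<in> J \<longrightarrow>
        (\<forall>Y \<in> Ob (MC M (src T i)).
          mutually_inverse (MC M (src T u))
            (FO (Ind M q) (FO (Res M p) Y)) (FO (Res M u) (FO (Ind M i) Y))
            (left_mate T M i u p q \<gamma> Y) (right_mate T M i u p q \<gamma> Y))) \<and>
    (\<forall>i j \<alpha>. i \<in> J \<longrightarrow> j \<in> J \<longrightarrow> \<alpha> \<in> cells2 T i j \<longrightarrow>
        (\<forall>Y \<in> Ob (MC M (src T i)). shriek2 T M i j \<alpha> Y = star2 T M i j \<alpha> Y)) \<and>
    (\<forall>K H G j i. j \<in> J \<longrightarrow> i \<in> J \<longrightarrow> j \<in> cells1 T K H \<longrightarrow> i \<in> cells1 T H G \<longrightarrow>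
        (\<forall>Y \<in> Ob (MC M K).
          mutually_inverse (MC M G)
            (FO (Ind M (i \<bullet>\<^bsub>T\<^esub> j)) Y) (FO (Ind M i) (FO (Ind M j) Y))
            (shriek_comp T M i j Y) (star_comp T M i j Y))) \<and>
    (\<forall>G \<in> Ob (Under T). \<forall>X \<in> Ob (MC M G).
        mutually_inverse (MC M G) (FO (Ind M (id1 T G)) X) X
          (lcounit M (id1 T G) X) (runit M (id1 T G) X))"


section \<open>Pairings and bimorphisms\<close>

text \<open>
  \<open>pobj B G\<close> and \<open>parr B G\<close> are the bilinear functor at \<open>G\<close> on objects and arrows, and
  \<open>pres B u X Y\<close> is the isomorphism \<open>u\<^sup>*(X \<odot> Y) \<rightarrow> u\<^sup>*X \<odot> u\<^sup>*Y\<close>.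
\<close>

record ('g, 'h, 'o1, 'm1, 'o2, 'm2, 'o3, 'm3) pairing =
  pobj :: "'g \<Rightarrow> 'o1 \<Rightarrow> 'o2 \<Rightarrow> 'o3"
  parr :: "'g \<Rightarrow> 'm1 \<Rightarrow> 'm2 \<Rightarrow> 'm3"
  pres :: "'h \<Rightarrow> 'o1 \<Rightarrow> 'o2 \<Rightarrow> 'm3"

definition bilinear_functor ::
  "('k, 'r) ring_scheme \<Rightarrow> ('k, 'o1, 'm1, 'x) lincat_scheme \<Rightarrow> ('k, 'o2, 'm2, 'y) lincat_scheme \<Rightarrow>
   ('k, 'o3, 'm3, 'z) lincat_scheme \<Rightarrow>
   ('o1 \<Rightarrow> 'o2 \<Rightarrow> 'o3) \<Rightarrow> ('m1 \<Rightarrow> 'm2 \<Rightarrow> 'm3) \<Rightarrow> bool" where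
  "bilinear_functor R C D E F0 F1 \<longleftrightarrow>
    is_functor (prod_cat C D) E
      \<lparr>FO = (\<lambda>(X, Y). F0 X Y), FA = (\<lambda>(f, g). F1 f g)\<rparr> \<and>
    (\<forall>X \<in> Ob C. linear_functor R D E \<lparr>FO = (\<lambda>Y. F0 X Y), FA = (\<lambda>g. F1 (Idn C X) g)\<rparr>) \<and>
    (\<forall>Y \<in> Ob D. linear_functor R C E \<lparr>FO = (\<lambda>X. F0 X Y), FA = (\<lambda>f. F1 f (Idn D Y))\<rparr>)"

definition is_pairing ::
  "('k, 'r) ring_scheme \<Rightarrow> ('g, 'h, 'c) twocat \<Rightarrow>
   ('k, 'g, 'h, 'c, 'o1, 'm1) mackey \<Rightarrow> ('k, 'g, 'h, 'c, 'o2, 'm2) mackey \<Rightarrow>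
   ('k, 'g, 'h, 'c, 'o3, 'm3) mackey \<Rightarrow>
   ('g, 'h, 'o1, 'm1, 'o2, 'm2, 'o3, 'm3) pairing \<Rightarrow> bool" where
  "is_pairing R T M N L B \<longleftrightarrow>
    (\<forall>G \<in> Ob (Under T).
        bilinear_functor R (MC M G) (MC N G) (MC L G) (pobj B G) (parr B G)) \<and>
    (\<forall>H G u. u \<in> cells1 T H G \<longrightarrow>
        (\<forall>X \<in> Ob (MC M G). \<forall>Y \<in> Ob (MC N G).
          pres B u X Y \<in> isos (MC L H) (FO (Res L u) (pobj B G X Y))
            (pobj B H (FO (Res M u) X) (FO (Res N u) Y))) \<and>
        (\<forall>X X' Y Y' f g. f \<in> homs (MC M G) X X' \<longrightarrow> g \<in> homs (MC N G) Y Y' \<longrightarrow>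
          pres B u X' Y' \<cdot>\<^bsub>MC L H\<^esub> FA (Res L u) (parr B G f g)
            = parr B H (FA (Res M u) f) (FA (Res N u) g) \<cdot>\<^bsub>MC L H\<^esub> pres B u X Y)) \<and>
    (\<forall>G \<in> Ob (Under T). \<forall>X \<in> Ob (MC M G). \<forall>Y \<in> Ob (MC N G).
        pres B (id1 T G) X Y = Idn (MC L G) (pobj B G X Y)) \<and>
    (\<forall>K H G v u. v \<in> cells1 T K H \<longrightarrow> u \<in> cells1 T H G \<longrightarrow>
        (\<forall>X \<in> Ob (MC M G). \<forall>Y \<in> Ob (MC N G).
          pres B (u \<bullet>\<^bsub>T\<^esub> v) X Y
            = pres B v (FO (Res M u) X) (FO (Res N u) Y) \<cdot>\<^bsub>MC L K\<^esub> FA (Res L v) (pres B u X Y))) \<and>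
    (\<forall>u v \<alpha>. \<alpha> \<in> cells2 T u v \<longrightarrow>
        (\<forall>X \<in> Ob (MC M (trg T u)). \<forall>Y \<in> Ob (MC N (trg T u)).
          pres B v X Y \<cdot>\<^bsub>MC L (src T u)\<^esub> Res2 L \<alpha> (pobj B (trg T u) X Y)
            = parr B (src T u) (Res2 M \<alpha> X) (Res2 N \<alpha> Y) \<cdot>\<^bsub>MC L (src T u)\<^esub> pres B u X Y))"

text \<open>
  The external pairing is \<open>\<pi>\<^sub>1\<^sup>* X \<odot> \<pi>\<^sub>2\<^sup>* Y\<close>. Its restriction isomorphism along \<open>u\<^sub>1 \<times> u\<^sub>2\<close> uses that
  \<open>(u\<^sub>1 \<times> u\<^sub>2)\<^sup>* \<pi>\<^sub>k\<^sup>*\<close> equals \<open>(\<pi>\<^sub>k (u\<^sub>1 \<times> u\<^sub>2))\<^sup>*\<close>, which is identified with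
  \<open>(u\<^sub>k \<pi>\<^sub>k)\<^sup>* = \<pi>\<^sub>k\<^sup>* u\<^sub>k\<^sup>*\<close> by the chosen isomorphisms \<open>psq1\<close> and \<open>psq2\<close>.
\<close>

definition ext_obj ::
  "('g, 'h, 'c) prods \<Rightarrow>
   ('k, 'g, 'h, 'c, 'o1, 'm1) mackey \<Rightarrow> ('k, 'g, 'h, 'c, 'o2, 'm2) mackey \<Rightarrow>
   ('g, 'h, 'o1, 'm1, 'o2, 'm2, 'o3, 'm3) pairing \<Rightarrow> 'g \<Rightarrow> 'g \<Rightarrow> 'o1 \<Rightarrow> 'o2 \<Rightarrow> 'o3" where
  "ext_obj Q M N B G1 G2 X Y =
    pobj B (prd Q G1 G2) (FO (Res M (pr1 Q G1 G2)) X) (FO (Res N (pr2 Q G1 G2)) Y)"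

definition ext_arr ::
  "('g, 'h, 'c) prods \<Rightarrow>
   ('k, 'g, 'h, 'c, 'o1, 'm1) mackey \<Rightarrow> ('k, 'g, 'h, 'c, 'o2, 'm2) mackey \<Rightarrow>
   ('g, 'h, 'o1, 'm1, 'o2, 'm2, 'o3, 'm3) pairing \<Rightarrow> 'g \<Rightarrow> 'g \<Rightarrow> 'm1 \<Rightarrow> 'm2 \<Rightarrow> 'm3" where
  "ext_arr Q M N B G1 G2 f g =
    parr B (prd Q G1 G2) (FA (Res M (pr1 Q G1 G2)) f) (FA (Res N (pr2 Q G1 G2)) g)"

definition ext_res ::
  "('g, 'h, 'c) twocat \<Rightarrow> ('g, 'h, 'c) prods \<Rightarrow>
   ('k, 'g, 'h, 'c, 'o1, 'm1) mackey \<Rightarrow> ('k, 'g, 'h, 'c, 'o2, 'm2) mackey \<Rightarrow>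
   ('k, 'g, 'h, 'c, 'o3, 'm3) mackey \<Rightarrow>
   ('g, 'h, 'o1, 'm1, 'o2, 'm2, 'o3, 'm3) pairing \<Rightarrow> 'h \<Rightarrow> 'h \<Rightarrow> 'o1 \<Rightarrow> 'o2 \<Rightarrow> 'm3" where
  "ext_res T Q M N L B u1 u2 X Y =
    (let G1 = trg T u1; G2 = trg T u2; HH = prd Q (src T u1) (src T u2) in
      parr B HH (Res2 M (psq1 Q u1 u2) X) (Res2 N (psq2 Q u1 u2) Y)
      \<cdot>\<^bsub>MC L HH\<^esub> pres B (prd1 Q u1 u2) (FO (Res M (pr1 Q G1 G2)) X) (FO (Res N (pr2 Q G1 G2)) Y))"

definition ext_right_mate ::
  "('g, 'h, 'c) twocat \<Rightarrow> ('g, 'h, 'c) prods \<Rightarrow>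
   ('k, 'g, 'h, 'c, 'o1, 'm1) mackey \<Rightarrow> ('k, 'g, 'h, 'c, 'o2, 'm2) mackey \<Rightarrow>
   ('k, 'g, 'h, 'c, 'o3, 'm3) mackey \<Rightarrow>
   ('g, 'h, 'o1, 'm1, 'o2, 'm2, 'o3, 'm3) pairing \<Rightarrow> 'h \<Rightarrow> 'h \<Rightarrow> 'o1 \<Rightarrow> 'o2 \<Rightarrow> 'm3" where
  "ext_right_mate T Q M N L B i1 i2 X Y =
    (let G1 = trg T i1; G2 = trg T i2; D = MC L (prd Q G1 G2); k = prd1 Q i1 i2;
         X' = FO (Ind M i1) X; Y' = FO (Ind N i2) Y in
      FA (Ind L k) (ext_arr Q M N B (src T i1) (src T i2) (rcounit M i1 X) (rcounit N i2 Y))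
      \<cdot>\<^bsub>D\<^esub> FA (Ind L k) (ext_res T Q M N L B i1 i2 X' Y')
      \<cdot>\<^bsub>D\<^esub> runit L k (ext_obj Q M N B G1 G2 X' Y'))"

definition ext_left_mate ::
  "('g, 'h, 'c) twocat \<Rightarrow> ('g, 'h, 'c) prods \<Rightarrow>
   ('k, 'g, 'h, 'c, 'o1, 'm1) mackey \<Rightarrow> ('k, 'g, 'h, 'c, 'o2, 'm2) mackey \<Rightarrow>
   ('k, 'g, 'h, 'c, 'o3, 'm3) mackey \<Rightarrow>
   ('g, 'h, 'o1, 'm1, 'o2, 'm2, 'o3, 'm3) pairing \<Rightarrow> 'h \<Rightarrow> 'h \<Rightarrow> 'o1 \<Rightarrow> 'o2 \<Rightarrow> 'm3" where
  "ext_left_mate T Q M N L B i1 i2 X Y =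
    (let G1 = trg T i1; G2 = trg T i2; H1 = src T i1; H2 = src T i2;
         D = MC L (prd Q G1 G2); k = prd1 Q i1 i2;
         X' = FO (Ind M i1) X; Y' = FO (Ind N i2) Y in
      lcounit L k (ext_obj Q M N B G1 G2 X' Y')
      \<cdot>\<^bsub>D\<^esub> FA (Ind L k) (inv_arr (MC L (prd Q H1 H2)) (ext_res T Q M N L B i1 i2 X' Y'))
      \<cdot>\<^bsub>D\<^esub> FA (Ind L k) (ext_arr Q M N B H1 H2 (lunit M i1 X) (lunit N i2 Y)))"

definition bimorphism ::
  "('k, 'r) ring_scheme \<Rightarrow> ('g, 'h, 'c) twocat \<Rightarrow> 'h set \<Rightarrow> ('g, 'h, 'c) prods \<Rightarrow>
   ('k, 'g, 'h, 'c, 'o1, 'm1) mackey \<Rightarrow> ('k, 'g, 'h, 'c, 'o2, 'm2) mackey \<Rightarrow>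
   ('k, 'g, 'h, 'c, 'o3, 'm3) mackey \<Rightarrow>
   ('g, 'h, 'o1, 'm1, 'o2, 'm2, 'o3, 'm3) pairing \<Rightarrow> bool" where
  "bimorphism R T J Q M N L B \<longleftrightarrow>
    is_pairing R T M N L B \<and>
    (\<forall>i1 \<in> J. \<forall>i2 \<in> J. \<forall>X \<in> Ob (MC M (src T i1)). \<forall>Y \<in> Ob (MC N (src T i2)).
      mutually_inverse (MC L (prd Q (trg T i1) (trg T i2)))
        (ext_obj Q M N B (trg T i1) (trg T i2) (FO (Ind M i1) X) (FO (Ind N i2) Y))
        (FO (Ind L (prd1 Q i1 i2)) (ext_obj Q M N B (src T i1) (src T i2) X Y))
        (ext_right_mate T Q M N L B i1 i2 X Y)
        (ext_left_mate T Q M N L B i1 i2 X Y))"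


section \<open>Projection maps\<close>

definition Rp1 ::
  "('g, 'h, 'c) twocat \<Rightarrow>
   ('k, 'g, 'h, 'c, 'o1, 'm1) mackey \<Rightarrow> ('k, 'g, 'h, 'c, 'o2, 'm2) mackey \<Rightarrow>
   ('k, 'g, 'h, 'c, 'o3, 'm3) mackey \<Rightarrow>
   ('g, 'h, 'o1, 'm1, 'o2, 'm2, 'o3, 'm3) pairing \<Rightarrow> 'h \<Rightarrow> 'o1 \<Rightarrow> 'o2 \<Rightarrow> 'm3" where
  "Rp1 T M N L B i X Y =
    (let H = src T i; G = trg T i; D = MC L G; Y' = FO (Ind N i) Y in
      FA (Ind L i) (parr B H (Idn (MC M H) (FO (Res M i) X)) (rcounit N i Y))
      \<cdot>\<^bsub>D\<^esub> FA (Ind L i) (pres B i X Y')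
      \<cdot>\<^bsub>D\<^esub> runit L i (pobj B G X Y'))"

definition Lp1 ::
  "('g, 'h, 'c) twocat \<Rightarrow>
   ('k, 'g, 'h, 'c, 'o1, 'm1) mackey \<Rightarrow> ('k, 'g, 'h, 'c, 'o2, 'm2) mackey \<Rightarrow>
   ('k, 'g, 'h, 'c, 'o3, 'm3) mackey \<Rightarrow>
   ('g, 'h, 'o1, 'm1, 'o2, 'm2, 'o3, 'm3) pairing \<Rightarrow> 'h \<Rightarrow> 'o1 \<Rightarrow> 'o2 \<Rightarrow> 'm3" where
  "Lp1 T M N L B i X Y =
    (let H = src T i; G = trg T i; D = MC L G; Y' = FO (Ind N i) Y in
      lcounit L i (pobj B G X Y')
      \<cdot>\<^bsub>D\<^esub> FA (Ind L i) (inv_arr (MC L H) (pres B i X Y'))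
      \<cdot>\<^bsub>D\<^esub> FA (Ind L i) (parr B H (Idn (MC M H) (FO (Res M i) X)) (lunit N i Y)))"

definition Rp2 ::
  "('g, 'h, 'c) twocat \<Rightarrow>
   ('k, 'g, 'h, 'c, 'o1, 'm1) mackey \<Rightarrow> ('k, 'g, 'h, 'c, 'o2, 'm2) mackey \<Rightarrow>
   ('k, 'g, 'h, 'c, 'o3, 'm3) mackey \<Rightarrow>
   ('g, 'h, 'o1, 'm1, 'o2, 'm2, 'o3, 'm3) pairing \<Rightarrow> 'h \<Rightarrow> 'o1 \<Rightarrow> 'o2 \<Rightarrow> 'm3" where
  "Rp2 T M N L B i Y X =
    (let H = src T i; G = trg T i; D = MC L G; Y' = FO (Ind M i) Y in
      FA (Ind L i) (parr B H (rcounit M i Y) (Idn (MC N H) (FO (Res N i) X)))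
      \<cdot>\<^bsub>D\<^esub> FA (Ind L i) (pres B i Y' X)
      \<cdot>\<^bsub>D\<^esub> runit L i (pobj B G Y' X))"

definition Lp2 ::
  "('g, 'h, 'c) twocat \<Rightarrow>
   ('k, 'g, 'h, 'c, 'o1, 'm1) mackey \<Rightarrow> ('k, 'g, 'h, 'c, 'o2, 'm2) mackey \<Rightarrow>
   ('k, 'g, 'h, 'c, 'o3, 'm3) mackey \<Rightarrow>
   ('g, 'h, 'o1, 'm1, 'o2, 'm2, 'o3, 'm3) pairing \<Rightarrow> 'h \<Rightarrow> 'o1 \<Rightarrow> 'o2 \<Rightarrow> 'm3" where
  "Lp2 T M N L B i Y X =
    (let H = src T i; G = trg T i; D = MC L G; Y' = FO (Ind M i) Y in
      lcounit L i (pobj B G Y' X)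
      \<cdot>\<^bsub>D\<^esub> FA (Ind L i) (inv_arr (MC L H) (pres B i Y' X))
      \<cdot>\<^bsub>D\<^esub> FA (Ind L i) (parr B H (lunit M i Y) (Idn (MC N H) (FO (Res N i) X))))"

end

theory Submission
  imports Defs
begin

text \<open>
  The projection formula is deduced from base change along one well-chosen Mackey square. For
  \<open>i: H \<rightarrow> G\<close> in \<open>J\<close>, the graph \<open>(i, 1): H \<rightarrow> G \<times> H\<close> and the diagonal \<open>\<Delta>: G \<rightarrow> G \<times> G\<close> fit into a square
  \<open>(1 \<times> i) (i, 1) \<cong> \<Delta> i\<close>, and this square is a pseudopullback: an isomorphism from
  \<open>(1 \<times> i) (g, h)\<close> to \<open>\<Delta> g'\<close> consists of \<open>g \<cong> g'\<close> and \<open>i h \<cong> g'\<close>, so that \<open>g\<close>, \<open>g'\<close> and both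
  isomorphisms amount to no more than \<open>h\<close>. Since \<open>1 \<times> i\<close> belongs to \<open>J\<close> by the Cartesian hypothesis, there is a chain of isomorphisms

    \<open>X \<odot> i\<^sub>* Y  \<cong>  \<Delta>\<^sup>* (X \<boxtimes> i\<^sub>* Y)  \<cong>  \<Delta>\<^sup>* (1 \<times> i)\<^sub>* (X \<boxtimes> Y)  \<cong>  i\<^sub>* (i, 1)\<^sup>* (X \<boxtimes> Y)  \<cong>  i\<^sub>* (i\<^sup>* X \<odot> Y)\<close>.

  The second step is the bimorphism property for the pair \<open>1\<close>, \<open>i\<close>, and the third is base change for
  the square. Both steps come with two mutually inverse maps, one built from right adjunctions and
  one from left adjunctions. What has to be shown is that the composite of the right mates is
  \<open>Rp\<^sup>1\<close> and the composite of the left mates is \<open>Lp\<^sup>1\<close>, up to the two outer isomorphisms, which are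
  the same in both cases.

  That comparison has two halves. The first is formal: composites of mates are mates of pasted
  squares (\<open>right_mate_transpose\<close>, \<open>left_mate_transpose\<close>), so it suffices to compare the transposed
  maps in \<open>L(H)\<close>. The second is one coherence identity (\<open>pairing_coherence\<close>), which says that the
  two ways of distributing restriction along \<open>(1 \<times> i) (i, 1) \<cong> \<Delta> i\<close> over the pairing agree; it uses
  the pseudonaturality of the pairing and the defining property of the 2-cell of the square. The
  same identity, read backwards, serves for the left mates. The second projection formula is the
  first one for the pairing with its two arguments exchanged.
\<close>

section \<open>Categories\<close>

lemma homs_iff: "f \<in> homs C a b \<longleftrightarrow> f \<in> Arr C \<and> Dom C f = a \<and> Cod C f = b"
  by (simp add: homs_def)

lemma cat_dom_ob: "category C \<Longrightarrow> f \<in> Arr C \<Longrightarrow> Dom C f \<in> Ob C"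
  and cat_cod_ob: "category C \<Longrightarrow> f \<in> Arr C \<Longrightarrow> Cod C f \<in> Ob C"
  and cat_id_arr: "category C \<Longrightarrow> a \<in> Ob C \<Longrightarrow> Idn C a \<in> Arr C"
  and cat_id_dom: "category C \<Longrightarrow> a \<in> Ob C \<Longrightarrow> Dom C (Idn C a) = a"
  and cat_id_cod: "category C \<Longrightarrow> a \<in> Ob C \<Longrightarrow> Cod C (Idn C a) = a"
  by (auto simp: category_def homs_def)

lemma cat_comp:
  assumes "category C" "g \<in> Arr C" "f \<in> Arr C" "Dom C g = Cod C f"
  shows cat_comp_arr: "g \<cdot>\<^bsub>C\<^esub> f \<in> Arr C"
    and cat_comp_dom: "Dom C (g \<cdot>\<^bsub>C\<^esub> f) = Dom C f"
    and cat_comp_cod: "Cod C (g \<cdot>\<^bsub>C\<^esub> f) = Cod C g"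
proof -
  have "g \<cdot>\<^bsub>C\<^esub> f \<in> homs C (Dom C f) (Cod C g)"
    using assms unfolding category_def homs_iff by blast
  then show "g \<cdot>\<^bsub>C\<^esub> f \<in> Arr C" "Dom C (g \<cdot>\<^bsub>C\<^esub> f) = Dom C f" "Cod C (g \<cdot>\<^bsub>C\<^esub> f) = Cod C g"
    by (simp_all add: homs_iff)
qed

lemma cat_id_right: "category C \<Longrightarrow> f \<in> Arr C \<Longrightarrow> Dom C f = a \<Longrightarrow> f \<cdot>\<^bsub>C\<^esub> Idn C a = f"
  and cat_id_left: "category C \<Longrightarrow> f \<in> Arr C \<Longrightarrow> Cod C f = b \<Longrightarrow> Idn C b \<cdot>\<^bsub>C\<^esub> f = f"
  unfolding category_def homs_iff by blast+

lemma cat_assoc: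
  assumes "category C" "h \<in> Arr C" "g \<in> Arr C" "f \<in> Arr C" "Dom C h = Cod C g" "Dom C g = Cod C f"
  shows "(h \<cdot>\<^bsub>C\<^esub> g) \<cdot>\<^bsub>C\<^esub> f = h \<cdot>\<^bsub>C\<^esub> (g \<cdot>\<^bsub>C\<^esub> f)"
  using assms unfolding category_def homs_iff by blast

text \<open>
  Typing of composites is left to the simplifier. For this purpose membership in a Hom set is split
  into membership in \<open>Arr\<close> and equations for \<open>Dom\<close> and \<open>Cod\<close>, which can be computed.
\<close>

lemmas cat_typing = cat_dom_ob cat_cod_ob cat_id_arr cat_id_dom cat_id_cod
  cat_comp_arr cat_comp_dom cat_comp_cod

lemmas cat_simps = cat_typing cat_id_right cat_id_left cat_assoc

text \<open>
  Composites are kept nested to the right, where an equation between binary composites no longer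
  occurs as a subterm; in this form it still rewrites.
\<close>

lemma cat_prefix:
  assumes "g \<cdot>\<^bsub>C\<^esub> f = e" "category C" "g \<in> Arr C" "f \<in> Arr C" "x \<in> Arr C"
    "Dom C g = Cod C f" "Dom C f = Cod C x"
  shows "g \<cdot>\<^bsub>C\<^esub> (f \<cdot>\<^bsub>C\<^esub> x) = e \<cdot>\<^bsub>C\<^esub> x"
  using cat_assoc[OF assms(2,3,4,5,6,7)] assms(1) by simp

lemma inv_arr_eq:
  assumes "category C" "mutually_inverse C a b f g"
  shows "inv_arr C f = g"
proof -
  have f: "f \<in> Arr C" "Dom C f = a" "Cod C f = b" and g: "g \<in> Arr C" "Dom C g = b" "Cod C g = a"
    and gf: "g \<cdot>\<^bsub>C\<^esub> f = Idn C a" and fg: "f \<cdot>\<^bsub>C\<^esub> g = Idn C b"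
    using assms(2) by (auto simp: mutually_inverse_def homs_iff)
  have "g' = g" if "mutually_inverse C a b f g'" for g'
  proof -
    have g': "g' \<in> Arr C" "Dom C g' = b" "Cod C g' = a" and g'f: "g' \<cdot>\<^bsub>C\<^esub> f = Idn C a"
      using that by (auto simp: mutually_inverse_def homs_iff)
    have "g' = (g' \<cdot>\<^bsub>C\<^esub> f) \<cdot>\<^bsub>C\<^esub> g"
      using assms(1) f g' g fg by (simp only: cat_assoc) (simp add: cat_simps)
    then show ?thesis using g'f assms(1) g by (simp add: cat_simps)
  qed
  then show ?thesis
    unfolding inv_arr_def f using assms(2) by blast
qed

lemma inv_arr_iso:
  assumes "category C" "f \<in> isos C a b"
  shows "mutually_inverse C a b f (inv_arr C f)"
  using assms inv_arr_eq unfolding isos_def by fastforce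

lemma mutually_inverse_arrD:
  assumes "mutually_inverse C a b f g"
  shows "f \<in> Arr C" "Dom C f = a" "Cod C f = b" "g \<in> Arr C" "Dom C g = b" "Cod C g = a"
    "g \<cdot>\<^bsub>C\<^esub> f = Idn C a" "f \<cdot>\<^bsub>C\<^esub> g = Idn C b"
  using assms by (auto simp: mutually_inverse_def homs_iff)

lemma mutually_inverseI:
  assumes "f \<in> Arr C" "Dom C f = a" "Cod C f = b" "g \<in> Arr C" "Dom C g = b" "Cod C g = a"
    "g \<cdot>\<^bsub>C\<^esub> f = Idn C a" "f \<cdot>\<^bsub>C\<^esub> g = Idn C b"
  shows "mutually_inverse C a b f g"
  using assms by (auto simp: mutually_inverse_def homs_iff)

lemma mutually_inverse_sym:
  "mutually_inverse C a b f g \<Longrightarrow> mutually_inverse C b a g f"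
  by (auto simp: mutually_inverse_def)

lemma mutually_inverse_comp:
  assumes "category C" "mutually_inverse C a b f f'" "mutually_inverse C b c g g'"
  shows "mutually_inverse C a c (g \<cdot>\<^bsub>C\<^esub> f) (f' \<cdot>\<^bsub>C\<^esub> g')"
proof -
  note f = mutually_inverse_arrD[OF assms(2)] and g = mutually_inverse_arrD[OF assms(3)]
  have "c \<in> Ob C" "a \<in> Ob C" "b \<in> Ob C"
    using assms(1) f g by (metis cat_dom_ob)+
  moreover have "g' \<cdot>\<^bsub>C\<^esub> (g \<cdot>\<^bsub>C\<^esub> f) = f" "f \<cdot>\<^bsub>C\<^esub> (f' \<cdot>\<^bsub>C\<^esub> g') = g'"
    using assms(1) f g by (simp_all add: cat_prefix cat_simps)
  ultimately show ?thesis
    using assms(1) f g by (intro mutually_inverseI) (simp_all add: cat_simps)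
qed

lemma mutually_inverse_functor:
  assumes "is_functor C D F" "category C" "mutually_inverse C a b f g"
  shows "mutually_inverse D (FO F a) (FO F b) (FA F f) (FA F g)"
proof -
  have "a \<in> Ob C" "b \<in> Ob C"
    using assms(2,3) by (metis mutually_inverse_arrD(2,1) cat_dom_ob,
        metis mutually_inverse_arrD(3,1) cat_cod_ob)
  then show ?thesis
    using assms unfolding is_functor_def mutually_inverse_def by metis
qed

lemma mutually_inverse_cancel_right:
  assumes "category C" "mutually_inverse C a b f g" "x \<cdot>\<^bsub>C\<^esub> f = y \<cdot>\<^bsub>C\<^esub> f"
    "x \<in> Arr C" "Dom C x = b" "y \<in> Arr C" "Dom C y = b"
  shows "x = y"
proof -
  note f = mutually_inverse_arrD[OF assms(2)]
  have "(x \<cdot>\<^bsub>C\<^esub> f) \<cdot>\<^bsub>C\<^esub> g = (y \<cdot>\<^bsub>C\<^esub> f) \<cdot>\<^bsub>C\<^esub> g" using assms(3) by simp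
  then show ?thesis using assms(1,4-) f by (simp add: cat_simps)
qed

lemma mutually_inverse_cancel_left:
  assumes "category C" "mutually_inverse C a b f g" "f \<cdot>\<^bsub>C\<^esub> x = f \<cdot>\<^bsub>C\<^esub> y"
    "x \<in> Arr C" "Cod C x = a" "y \<in> Arr C" "Cod C y = a"
  shows "x = y"
proof -
  note f = mutually_inverse_arrD[OF assms(2)]
  have "g \<cdot>\<^bsub>C\<^esub> (f \<cdot>\<^bsub>C\<^esub> x) = g \<cdot>\<^bsub>C\<^esub> (f \<cdot>\<^bsub>C\<^esub> y)" using assms(3) by simp
  then show ?thesis using assms(1,4-) f by (simp add: cat_prefix cat_simps)
qed

text \<open>
  An inverse pair is transported along isomorphisms \<open>s\<close> and \<open>t\<close>. Here \<open>\<phi>\<close> and \<open>\<psi>\<close> will be the composites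
  of the right and of the left mates, \<open>f\<close> and \<open>g\<close> the two projection maps.
\<close>

lemma mutually_inverse_transport:
  assumes C: "category C"
    and \<phi>: "mutually_inverse C a b \<phi> \<psi>"
    and s: "mutually_inverse C a c s s'"
    and t: "mutually_inverse C b d t t'"
    and f: "f \<in> homs C c d" "f \<cdot>\<^bsub>C\<^esub> s = t \<cdot>\<^bsub>C\<^esub> \<phi>"
    and g: "g \<in> homs C d c" "g \<cdot>\<^bsub>C\<^esub> t = s \<cdot>\<^bsub>C\<^esub> \<psi>"
  shows "mutually_inverse C c d f g"
proof -
  note \<phi>' = mutually_inverse_arrD[OF \<phi>] and s' = mutually_inverse_arrD[OF s]
    and t' = mutually_inverse_arrD[OF t]
  have f': "f \<in> Arr C" "Dom C f = c" "Cod C f = d" and g': "g \<in> Arr C" "Dom C g = d" "Cod C g = c"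
    using f g by (auto simp: homs_iff)
  have ob: "c \<in> Ob C" "d \<in> Ob C"
    using C f' by (metis cat_dom_ob, metis cat_cod_ob)
  have "(g \<cdot>\<^bsub>C\<^esub> f) \<cdot>\<^bsub>C\<^esub> s = g \<cdot>\<^bsub>C\<^esub> (t \<cdot>\<^bsub>C\<^esub> \<phi>)"
    using C f' g' s' by (simp add: cat_assoc f(2))
  also have "\<dots> = s"
    using C g' t' s' \<phi>' by (simp add: cat_prefix[OF g(2)] cat_simps)
  finally have "g \<cdot>\<^bsub>C\<^esub> f = Idn C c"
    using C s' f' g' ob by - (rule mutually_inverse_cancel_right[OF C s], simp_all add: cat_simps)
  moreover have "(f \<cdot>\<^bsub>C\<^esub> g) \<cdot>\<^bsub>C\<^esub> t = f \<cdot>\<^bsub>C\<^esub> (s \<cdot>\<^bsub>C\<^esub> \<psi>)"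
    using C f' g' t' by (simp add: cat_assoc g(2))
  then have "(f \<cdot>\<^bsub>C\<^esub> g) \<cdot>\<^bsub>C\<^esub> t = t"
    using C f' t' s' \<phi>' by (simp add: cat_prefix[OF f(2)] cat_simps)
  then have "f \<cdot>\<^bsub>C\<^esub> g = Idn C d"
    using C t' f' g' ob by - (rule mutually_inverse_cancel_right[OF C t], simp_all add: cat_simps)
  ultimately show ?thesis
    using f' g' by (intro mutually_inverseI)
qed


lemma functor_rules:
  assumes "is_functor C D F"
  shows "X \<in> Ob C \<Longrightarrow> FO F X \<in> Ob D"
    and "f \<in> Arr C \<Longrightarrow> FA F f \<in> Arr D"
    and "f \<in> Arr C \<Longrightarrow> Dom D (FA F f) = FO F (Dom C f)"
    and "f \<in> Arr C \<Longrightarrow> Cod D (FA F f) = FO F (Cod C f)"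
    and "X \<in> Ob C \<Longrightarrow> FA F (Idn C X) = Idn D (FO F X)"
    and "g \<in> Arr C \<Longrightarrow> f \<in> Arr C \<Longrightarrow> Dom C g = Cod C f \<Longrightarrow>
      FA F (g \<cdot>\<^bsub>C\<^esub> f) = FA F g \<cdot>\<^bsub>D\<^esub> FA F f"
  using assms unfolding is_functor_def homs_iff by blast+


section \<open>Strict (2,1)-categories\<close>

locale two_one =
  fixes T :: "('g, 'h, 'c) twocat"
  assumes two_one: "two_one_category T"
begin

abbreviation "U \<equiv> Under T"
abbreviation "V \<equiv> Vert T"

lemma two_cat: "two_category T"
  using two_one by (simp add: two_one_category_def)

lemma category_U [simp]: "category U"
  and category_V [simp]: "category V"
  and Ob_V [simp]: "Ob V = Arr U"
  using two_cat by (auto simp: two_category_def)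

lemma cod2_src [simp]: "\<alpha> \<in> Arr V \<Longrightarrow> src T (Cod V \<alpha>) = src T (Dom V \<alpha>)"
  and cod2_trg [simp]: "\<alpha> \<in> Arr V \<Longrightarrow> trg T (Cod V \<alpha>) = trg T (Dom V \<alpha>)"
  using two_cat unfolding two_category_def homs_iff by metis+

lemma dom2_arr [simp]: "\<alpha> \<in> Arr V \<Longrightarrow> Dom V \<alpha> \<in> Arr U"
  and cod2_arr [simp]: "\<alpha> \<in> Arr V \<Longrightarrow> Cod V \<alpha> \<in> Arr U"
  using cat_dom_ob[of V] cat_cod_ob[of V] by auto

lemma hcomp:
  assumes "\<beta> \<in> Arr V" "\<alpha> \<in> Arr V" "trg T (Dom V \<alpha>) = src T (Dom V \<beta>)"
  shows hcomp_arr [simp]: "\<beta> \<star>\<^bsub>T\<^esub> \<alpha> \<in> Arr V"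
    and hcomp_dom [simp]: "Dom V (\<beta> \<star>\<^bsub>T\<^esub> \<alpha>) = Dom V \<beta> \<bullet>\<^bsub>T\<^esub> Dom V \<alpha>"
    and hcomp_cod [simp]: "Cod V (\<beta> \<star>\<^bsub>T\<^esub> \<alpha>) = Cod V \<beta> \<bullet>\<^bsub>T\<^esub> Cod V \<alpha>"
proof -
  have ax: "\<forall>u u' v v' \<alpha> \<beta>. \<alpha> \<in> cells2 T u u' \<longrightarrow> \<beta> \<in> cells2 T v v' \<longrightarrow> trg T u = src T v \<longrightarrow>
        \<beta> \<star>\<^bsub>T\<^esub> \<alpha> \<in> cells2 T (v \<bullet>\<^bsub>T\<^esub> u) (v' \<bullet>\<^bsub>T\<^esub> u')"
    using two_cat unfolding two_category_def by (elim conjE) assumption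
  have "\<beta> \<star>\<^bsub>T\<^esub> \<alpha> \<in> cells2 T (Dom V \<beta> \<bullet>\<^bsub>T\<^esub> Dom V \<alpha>) (Cod V \<beta> \<bullet>\<^bsub>T\<^esub> Cod V \<alpha>)"
    using assms by (intro ax[rule_format]) (simp_all add: homs_iff)
  then show "\<beta> \<star>\<^bsub>T\<^esub> \<alpha> \<in> Arr V" "Dom V (\<beta> \<star>\<^bsub>T\<^esub> \<alpha>) = Dom V \<beta> \<bullet>\<^bsub>T\<^esub> Dom V \<alpha>"
    "Cod V (\<beta> \<star>\<^bsub>T\<^esub> \<alpha>) = Cod V \<beta> \<bullet>\<^bsub>T\<^esub> Cod V \<alpha>"
    by (auto simp: homs_iff)
qed

lemma id2_comp:
  "v \<in> Arr U \<Longrightarrow> u \<in> Arr U \<Longrightarrow> src T v = trg T u \<Longrightarrow> id2 T (v \<bullet>\<^bsub>T\<^esub> u) = id2 T v \<star>\<^bsub>T\<^esub> id2 T u"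
  using two_cat unfolding two_category_def homs_iff by metis

lemma interchange:
  assumes "\<beta>' \<in> Arr V" "\<beta> \<in> Arr V" "\<alpha>' \<in> Arr V" "\<alpha> \<in> Arr V"
    "Dom V \<beta>' = Cod V \<beta>" "Dom V \<alpha>' = Cod V \<alpha>" "trg T (Dom V \<alpha>) = src T (Dom V \<beta>)"
  shows "(\<beta>' \<diamondop>\<^bsub>T\<^esub> \<beta>) \<star>\<^bsub>T\<^esub> (\<alpha>' \<diamondop>\<^bsub>T\<^esub> \<alpha>) = (\<beta>' \<star>\<^bsub>T\<^esub> \<alpha>') \<diamondop>\<^bsub>T\<^esub> (\<beta> \<star>\<^bsub>T\<^esub> \<alpha>)"
proof -
  have ax: "\<forall>u u' u'' v v' v'' \<alpha> \<alpha>' \<beta> \<beta>'.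
        \<alpha> \<in> cells2 T u u' \<longrightarrow> \<alpha>' \<in> cells2 T u' u'' \<longrightarrow>
        \<beta> \<in> cells2 T v v' \<longrightarrow> \<beta>' \<in> cells2 T v' v'' \<longrightarrow> trg T u = src T v \<longrightarrow>
        (\<beta>' \<diamondop>\<^bsub>T\<^esub> \<beta>) \<star>\<^bsub>T\<^esub> (\<alpha>' \<diamondop>\<^bsub>T\<^esub> \<alpha>) = (\<beta>' \<star>\<^bsub>T\<^esub> \<alpha>') \<diamondop>\<^bsub>T\<^esub> (\<beta> \<star>\<^bsub>T\<^esub> \<alpha>)"
    using two_cat unfolding two_category_def by (elim conjE) assumption
  show ?thesis
    using assms by (intro ax[rule_format]) (simp_all add: homs_iff)
qed

lemma hcomp_assoc:
  assumes "\<gamma> \<in> Arr V" "\<beta> \<in> Arr V" "\<alpha> \<in> Arr V"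
    "trg T (Dom V \<alpha>) = src T (Dom V \<beta>)" "trg T (Dom V \<beta>) = src T (Dom V \<gamma>)"
  shows "(\<gamma> \<star>\<^bsub>T\<^esub> \<beta>) \<star>\<^bsub>T\<^esub> \<alpha> = \<gamma> \<star>\<^bsub>T\<^esub> (\<beta> \<star>\<^bsub>T\<^esub> \<alpha>)"
  using assms two_cat unfolding two_category_def homs_iff by blast

lemma whisker_id1 [simp]:
  "\<alpha> \<in> Arr V \<Longrightarrow> trg T (Dom V \<alpha>) = a \<Longrightarrow> id1 T a \<rhd>\<^bsub>T\<^esub> \<alpha> = \<alpha>"
  "\<alpha> \<in> Arr V \<Longrightarrow> src T (Dom V \<alpha>) = a \<Longrightarrow> \<alpha> \<lhd>\<^bsub>T\<^esub> id1 T a = \<alpha>"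
  using two_cat unfolding two_category_def homs_iff by blast+

lemmas typing [simp] = cat_typing[OF category_U] cat_typing[OF category_V, unfolded Ob_V]
  cat_id_right[OF category_U] cat_id_left[OF category_U] cat_assoc[OF category_U]
  cat_id_right[OF category_V] cat_id_left[OF category_V] cat_assoc[OF category_V]

text \<open>
  The direction of the three equations fixes a normal form \<open>w \<rhd> (\<alpha> \<lhd> u)\<close> of mixed whiskerings:
  on the left iterated whiskering by the factors of a composite, as the naturality squares below
  are whiskered factor by factor, and on the right a single whiskering.
\<close>

lemma whisker_assoc:
  "\<alpha> \<in> Arr V \<Longrightarrow> w \<in> Arr U \<Longrightarrow> v \<in> Arr U \<Longrightarrow> src T w = trg T v \<Longrightarrow> trg T (Dom V \<alpha>) = src T v \<Longrightarrow>
    (w \<bullet>\<^bsub>T\<^esub> v) \<rhd>\<^bsub>T\<^esub> \<alpha> = w \<rhd>\<^bsub>T\<^esub> (v \<rhd>\<^bsub>T\<^esub> \<alpha>)"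
  "\<alpha> \<in> Arr V \<Longrightarrow> w \<in> Arr U \<Longrightarrow> v \<in> Arr U \<Longrightarrow> src T w = trg T v \<Longrightarrow> src T (Dom V \<alpha>) = trg T w \<Longrightarrow>
    (\<alpha> \<lhd>\<^bsub>T\<^esub> w) \<lhd>\<^bsub>T\<^esub> v = \<alpha> \<lhd>\<^bsub>T\<^esub> (w \<bullet>\<^bsub>T\<^esub> v)"
  "\<alpha> \<in> Arr V \<Longrightarrow> w \<in> Arr U \<Longrightarrow> v \<in> Arr U \<Longrightarrow> trg T (Dom V \<alpha>) = src T w \<Longrightarrow> src T (Dom V \<alpha>) = trg T v \<Longrightarrow>
    (w \<rhd>\<^bsub>T\<^esub> \<alpha>) \<lhd>\<^bsub>T\<^esub> v = w \<rhd>\<^bsub>T\<^esub> (\<alpha> \<lhd>\<^bsub>T\<^esub> v)"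
  by (simp_all add: id2_comp hcomp_assoc)

lemma whisker_vcomp:
  "\<beta> \<in> Arr V \<Longrightarrow> \<alpha> \<in> Arr V \<Longrightarrow> Dom V \<beta> = Cod V \<alpha> \<Longrightarrow> v \<in> Arr U \<Longrightarrow> src T v = trg T (Dom V \<alpha>) \<Longrightarrow>
    v \<rhd>\<^bsub>T\<^esub> (\<beta> \<diamondop>\<^bsub>T\<^esub> \<alpha>) = (v \<rhd>\<^bsub>T\<^esub> \<beta>) \<diamondop>\<^bsub>T\<^esub> (v \<rhd>\<^bsub>T\<^esub> \<alpha>)"
  "\<beta> \<in> Arr V \<Longrightarrow> \<alpha> \<in> Arr V \<Longrightarrow> Dom V \<beta> = Cod V \<alpha> \<Longrightarrow> v \<in> Arr U \<Longrightarrow> trg T v = src T (Dom V \<alpha>) \<Longrightarrow>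
    (\<beta> \<diamondop>\<^bsub>T\<^esub> \<alpha>) \<lhd>\<^bsub>T\<^esub> v = (\<beta> \<lhd>\<^bsub>T\<^esub> v) \<diamondop>\<^bsub>T\<^esub> (\<alpha> \<lhd>\<^bsub>T\<^esub> v)"
  using interchange[of "id2 T v" "id2 T v" \<beta> \<alpha>] interchange[of \<beta> \<alpha> "id2 T v" "id2 T v"]
  by simp_all

lemma whisker_natural:
  assumes "\<beta> \<in> Arr V" "\<alpha> \<in> Arr V" "trg T (Dom V \<alpha>) = src T (Dom V \<beta>)"
    "Dom V \<beta> = v" "Cod V \<beta> = v'" "Dom V \<alpha> = u" "Cod V \<alpha> = u'"
  shows "(\<beta> \<lhd>\<^bsub>T\<^esub> u') \<diamondop>\<^bsub>T\<^esub> (v \<rhd>\<^bsub>T\<^esub> \<alpha>) = (v' \<rhd>\<^bsub>T\<^esub> \<alpha>) \<diamondop>\<^bsub>T\<^esub> (\<beta> \<lhd>\<^bsub>T\<^esub> u)"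
  using assms interchange[of \<beta> "id2 T v" "id2 T u'" \<alpha>] interchange[of "id2 T v'" \<beta> \<alpha> "id2 T u"]
  by auto

abbreviation inv2 :: "'c \<Rightarrow> 'c" where "inv2 \<equiv> inv_arr V"

lemma inv2_inverse:
  assumes "\<alpha> \<in> Arr V"
  shows "mutually_inverse V (Dom V \<alpha>) (Cod V \<alpha>) \<alpha> (inv2 \<alpha>)"
proof (rule inv_arr_iso)
  have "\<alpha> \<in> cells2 T (Dom V \<alpha>) (Cod V \<alpha>)" using assms by (simp add: homs_iff)
  then show "\<alpha> \<in> isos V (Dom V \<alpha>) (Cod V \<alpha>)"
    using two_one by (auto simp: two_one_category_def)
qed simp

lemma inv2 [simp]:
  assumes "\<alpha> \<in> Arr V"
  shows "inv2 \<alpha> \<in> Arr V" "Dom V (inv2 \<alpha>) = Cod V \<alpha>" "Cod V (inv2 \<alpha>) = Dom V \<alpha>"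
    "inv2 \<alpha> \<diamondop>\<^bsub>T\<^esub> \<alpha> = id2 T (Dom V \<alpha>)" "\<alpha> \<diamondop>\<^bsub>T\<^esub> inv2 \<alpha> = id2 T (Cod V \<alpha>)"
  using mutually_inverse_arrD[OF inv2_inverse[OF assms]] by auto

lemma inv2_prefix [simp]:
  assumes "\<alpha> \<in> Arr V" "x \<in> Arr V"
  shows "Cod V x = Dom V \<alpha> \<Longrightarrow> inv2 \<alpha> \<diamondop>\<^bsub>T\<^esub> (\<alpha> \<diamondop>\<^bsub>T\<^esub> x) = x"
    "Cod V x = Cod V \<alpha> \<Longrightarrow> \<alpha> \<diamondop>\<^bsub>T\<^esub> (inv2 \<alpha> \<diamondop>\<^bsub>T\<^esub> x) = x"
  using assms by (simp_all add: cat_prefix[OF inv2(4)] cat_prefix[OF inv2(5)])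

lemma cancel_left2:
  assumes "\<alpha> \<diamondop>\<^bsub>T\<^esub> x = \<alpha> \<diamondop>\<^bsub>T\<^esub> y" "\<alpha> \<in> Arr V" "x \<in> Arr V" "y \<in> Arr V" "Cod V x = Dom V \<alpha>" "Cod V y = Dom V \<alpha>"
  shows "x = y"
  using mutually_inverse_cancel_left[OF category_V inv2_inverse] assms by blast

lemma cancel_right2:
  assumes "x \<diamondop>\<^bsub>T\<^esub> \<alpha> = y \<diamondop>\<^bsub>T\<^esub> \<alpha>" "\<alpha> \<in> Arr V" "x \<in> Arr V" "y \<in> Arr V" "Dom V x = Cod V \<alpha>" "Dom V y = Cod V \<alpha>"
  shows "x = y"
  using mutually_inverse_cancel_right[OF category_V inv2_inverse] assms by blast

lemma cells2_isos: "cells2 T u v = isos V u v"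
  using two_one by (simp add: two_one_category_def)

end


section \<open>The graph square of a 1-cell\<close>

text \<open>
  The situation of interest is \<open>GG = G \<times> G\<close> and \<open>GH = G \<times> H\<close> with projections \<open>p1\<close>, \<open>p2\<close> and \<open>q1\<close>,
  \<open>q2\<close>, with \<open>k = 1 \<times> i\<close>, the diagonal \<open>dg\<close> and the graph \<open>gr = (i, 1)\<close>. As products are bicategorical,
  these 1-cells have prescribed components only up to the 2-cells \<open>r1\<close>, \<open>r2\<close> (for \<open>k\<close>), \<open>d1\<close>, \<open>d2\<close> (for
  \<open>dg\<close>) and \<open>s1\<close>, \<open>s2\<close> (for \<open>gr\<close>). The two coherence equations determine \<open>\<gamma>\<close>: modulo those 2-cells
  its components along \<open>p1\<close> and \<open>p2\<close> are identities of \<open>i\<close>.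
\<close>

locale graph_square = two_one T for T :: "('g, 'h, 'c) twocat" +
  fixes G H GG GH :: 'g
    and i p1 p2 q1 q2 k dg gr :: 'h
    and r1 r2 d1 d2 s1 s2 \<gamma> :: 'c
  assumes cell1: "i \<in> cells1 T H G"
    "p1 \<in> cells1 T GG G" "p2 \<in> cells1 T GG G" "q1 \<in> cells1 T GH G" "q2 \<in> cells1 T GH H"
    "k \<in> cells1 T GH GG" "dg \<in> cells1 T G GG" "gr \<in> cells1 T H GH"
    and cell2: "r1 \<in> cells2 T (p1 \<bullet>\<^bsub>T\<^esub> k) q1" "r2 \<in> cells2 T (p2 \<bullet>\<^bsub>T\<^esub> k) (i \<bullet>\<^bsub>T\<^esub> q2)"
    "d1 \<in> cells2 T (p1 \<bullet>\<^bsub>T\<^esub> dg) (id1 T G)" "d2 \<in> cells2 T (p2 \<bullet>\<^bsub>T\<^esub> dg) (id1 T G)"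
    "s1 \<in> cells2 T (q1 \<bullet>\<^bsub>T\<^esub> gr) i" "s2 \<in> cells2 T (q2 \<bullet>\<^bsub>T\<^esub> gr) (id1 T H)"
    "\<gamma> \<in> cells2 T (k \<bullet>\<^bsub>T\<^esub> gr) (dg \<bullet>\<^bsub>T\<^esub> i)"
    and coherence1: "(d1 \<lhd>\<^bsub>T\<^esub> i) \<diamondop>\<^bsub>T\<^esub> (p1 \<rhd>\<^bsub>T\<^esub> \<gamma>) = s1 \<diamondop>\<^bsub>T\<^esub> (r1 \<lhd>\<^bsub>T\<^esub> gr)"
    and coherence2: "(d2 \<lhd>\<^bsub>T\<^esub> i) \<diamondop>\<^bsub>T\<^esub> (p2 \<rhd>\<^bsub>T\<^esub> \<gamma>) = (i \<rhd>\<^bsub>T\<^esub> s2) \<diamondop>\<^bsub>T\<^esub> (r2 \<lhd>\<^bsub>T\<^esub> gr)"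
    and jointly_faithful_GG: "\<And>X w w' \<alpha> \<beta>. w \<in> cells1 T X GG \<Longrightarrow> w' \<in> cells1 T X GG \<Longrightarrow>
      \<alpha> \<in> cells2 T w w' \<Longrightarrow> \<beta> \<in> cells2 T w w' \<Longrightarrow>
      p1 \<rhd>\<^bsub>T\<^esub> \<alpha> = p1 \<rhd>\<^bsub>T\<^esub> \<beta> \<Longrightarrow> p2 \<rhd>\<^bsub>T\<^esub> \<alpha> = p2 \<rhd>\<^bsub>T\<^esub> \<beta> \<Longrightarrow> \<alpha> = \<beta>"
    and jointly_faithful_GH: "\<And>X w w' \<alpha> \<beta>. w \<in> cells1 T X GH \<Longrightarrow> w' \<in> cells1 T X GH \<Longrightarrow>
      \<alpha> \<in> cells2 T w w' \<Longrightarrow> \<beta> \<in> cells2 T w w' \<Longrightarrow>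
      q1 \<rhd>\<^bsub>T\<^esub> \<alpha> = q1 \<rhd>\<^bsub>T\<^esub> \<beta> \<Longrightarrow> q2 \<rhd>\<^bsub>T\<^esub> \<alpha> = q2 \<rhd>\<^bsub>T\<^esub> \<beta> \<Longrightarrow> \<alpha> = \<beta>"
    and jointly_full_GH: "\<And>X w w' \<alpha> \<beta>. w \<in> cells1 T X GH \<Longrightarrow> w' \<in> cells1 T X GH \<Longrightarrow>
      \<alpha> \<in> cells2 T (q1 \<bullet>\<^bsub>T\<^esub> w) (q1 \<bullet>\<^bsub>T\<^esub> w') \<Longrightarrow> \<beta> \<in> cells2 T (q2 \<bullet>\<^bsub>T\<^esub> w) (q2 \<bullet>\<^bsub>T\<^esub> w') \<Longrightarrow>
      \<exists>\<omega> \<in> cells2 T w w'. q1 \<rhd>\<^bsub>T\<^esub> \<omega> = \<alpha> \<and> q2 \<rhd>\<^bsub>T\<^esub> \<omega> = \<beta>"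
begin

lemmas cell1' [simp] = cell1[unfolded homs_iff, THEN conjunct1]
  cell1[unfolded homs_iff, THEN conjunct2, THEN conjunct1]
  cell1[unfolded homs_iff, THEN conjunct2, THEN conjunct2]

lemmas cell2' [simp] = cell2[unfolded homs_iff, THEN conjunct1]
  cell2[unfolded homs_iff, THEN conjunct2, THEN conjunct1]
  cell2[unfolded homs_iff, THEN conjunct2, THEN conjunct2]

lemma GH_Ob [simp]: "G \<in> Ob U" "H \<in> Ob U"
  using cat_cod_ob[OF category_U, of i] cat_dom_ob[OF category_U, of i] by simp_all

lemma natural:
  shows natural_\<gamma>: "\<alpha> \<in> Arr V \<Longrightarrow> trg T (Dom V \<alpha>) = H \<Longrightarrow> Dom V \<alpha> = w \<Longrightarrow> Cod V \<alpha> = w' \<Longrightarrow>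
      (\<gamma> \<lhd>\<^bsub>T\<^esub> w') \<diamondop>\<^bsub>T\<^esub> (k \<rhd>\<^bsub>T\<^esub> (gr \<rhd>\<^bsub>T\<^esub> \<alpha>)) = (dg \<rhd>\<^bsub>T\<^esub> (i \<rhd>\<^bsub>T\<^esub> \<alpha>)) \<diamondop>\<^bsub>T\<^esub> (\<gamma> \<lhd>\<^bsub>T\<^esub> w)"
    and natural_s1: "\<alpha> \<in> Arr V \<Longrightarrow> trg T (Dom V \<alpha>) = H \<Longrightarrow> Dom V \<alpha> = w \<Longrightarrow> Cod V \<alpha> = w' \<Longrightarrow>
      (s1 \<lhd>\<^bsub>T\<^esub> w') \<diamondop>\<^bsub>T\<^esub> (q1 \<rhd>\<^bsub>T\<^esub> (gr \<rhd>\<^bsub>T\<^esub> \<alpha>)) = (i \<rhd>\<^bsub>T\<^esub> \<alpha>) \<diamondop>\<^bsub>T\<^esub> (s1 \<lhd>\<^bsub>T\<^esub> w)"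
    and natural_s2: "\<alpha> \<in> Arr V \<Longrightarrow> trg T (Dom V \<alpha>) = H \<Longrightarrow> Dom V \<alpha> = w \<Longrightarrow> Cod V \<alpha> = w' \<Longrightarrow>
      (s2 \<lhd>\<^bsub>T\<^esub> w') \<diamondop>\<^bsub>T\<^esub> (q2 \<rhd>\<^bsub>T\<^esub> (gr \<rhd>\<^bsub>T\<^esub> \<alpha>)) = \<alpha> \<diamondop>\<^bsub>T\<^esub> (s2 \<lhd>\<^bsub>T\<^esub> w)"
    and natural_r1: "\<alpha> \<in> Arr V \<Longrightarrow> trg T (Dom V \<alpha>) = GH \<Longrightarrow> Dom V \<alpha> = w \<Longrightarrow> Cod V \<alpha> = w' \<Longrightarrow>
      (r1 \<lhd>\<^bsub>T\<^esub> w') \<diamondop>\<^bsub>T\<^esub> (p1 \<rhd>\<^bsub>T\<^esub> (k \<rhd>\<^bsub>T\<^esub> \<alpha>)) = (q1 \<rhd>\<^bsub>T\<^esub> \<alpha>) \<diamondop>\<^bsub>T\<^esub> (r1 \<lhd>\<^bsub>T\<^esub> w)"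
    and natural_r2: "\<alpha> \<in> Arr V \<Longrightarrow> trg T (Dom V \<alpha>) = GH \<Longrightarrow> Dom V \<alpha> = w \<Longrightarrow> Cod V \<alpha> = w' \<Longrightarrow>
      (r2 \<lhd>\<^bsub>T\<^esub> w') \<diamondop>\<^bsub>T\<^esub> (p2 \<rhd>\<^bsub>T\<^esub> (k \<rhd>\<^bsub>T\<^esub> \<alpha>)) = (i \<rhd>\<^bsub>T\<^esub> (q2 \<rhd>\<^bsub>T\<^esub> \<alpha>)) \<diamondop>\<^bsub>T\<^esub> (r2 \<lhd>\<^bsub>T\<^esub> w)"
    and natural_d1: "\<alpha> \<in> Arr V \<Longrightarrow> trg T (Dom V \<alpha>) = G \<Longrightarrow> Dom V \<alpha> = w \<Longrightarrow> Cod V \<alpha> = w' \<Longrightarrow>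
      (d1 \<lhd>\<^bsub>T\<^esub> w') \<diamondop>\<^bsub>T\<^esub> (p1 \<rhd>\<^bsub>T\<^esub> (dg \<rhd>\<^bsub>T\<^esub> \<alpha>)) = \<alpha> \<diamondop>\<^bsub>T\<^esub> (d1 \<lhd>\<^bsub>T\<^esub> w)"
    and natural_d2: "\<alpha> \<in> Arr V \<Longrightarrow> trg T (Dom V \<alpha>) = G \<Longrightarrow> Dom V \<alpha> = w \<Longrightarrow> Cod V \<alpha> = w' \<Longrightarrow>
      (d2 \<lhd>\<^bsub>T\<^esub> w') \<diamondop>\<^bsub>T\<^esub> (p2 \<rhd>\<^bsub>T\<^esub> (dg \<rhd>\<^bsub>T\<^esub> \<alpha>)) = \<alpha> \<diamondop>\<^bsub>T\<^esub> (d2 \<lhd>\<^bsub>T\<^esub> w)"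
  using whisker_natural[of \<gamma> \<alpha> "k \<bullet>\<^bsub>T\<^esub> gr" "dg \<bullet>\<^bsub>T\<^esub> i" w w'] whisker_natural[of s1 \<alpha> "q1 \<bullet>\<^bsub>T\<^esub> gr" i w w']
    whisker_natural[of s2 \<alpha> "q2 \<bullet>\<^bsub>T\<^esub> gr" "id1 T H" w w'] whisker_natural[of r1 \<alpha> "p1 \<bullet>\<^bsub>T\<^esub> k" q1 w w']
    whisker_natural[of r2 \<alpha> "p2 \<bullet>\<^bsub>T\<^esub> k" "i \<bullet>\<^bsub>T\<^esub> q2" w w']
    whisker_natural[of d1 \<alpha> "p1 \<bullet>\<^bsub>T\<^esub> dg" "id1 T G" w w'] whisker_natural[of d2 \<alpha> "p2 \<bullet>\<^bsub>T\<^esub> dg" "id1 T G" w w']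
  by (auto simp add: whisker_assoc)

lemma coherence_at:
  assumes "w \<in> cells1 T X H"
  shows "(d1 \<lhd>\<^bsub>T\<^esub> (i \<bullet>\<^bsub>T\<^esub> w)) \<diamondop>\<^bsub>T\<^esub> (p1 \<rhd>\<^bsub>T\<^esub> (\<gamma> \<lhd>\<^bsub>T\<^esub> w)) = (s1 \<lhd>\<^bsub>T\<^esub> w) \<diamondop>\<^bsub>T\<^esub> (r1 \<lhd>\<^bsub>T\<^esub> (gr \<bullet>\<^bsub>T\<^esub> w))"
    and "(d2 \<lhd>\<^bsub>T\<^esub> (i \<bullet>\<^bsub>T\<^esub> w)) \<diamondop>\<^bsub>T\<^esub> (p2 \<rhd>\<^bsub>T\<^esub> (\<gamma> \<lhd>\<^bsub>T\<^esub> w))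
      = (i \<rhd>\<^bsub>T\<^esub> (s2 \<lhd>\<^bsub>T\<^esub> w)) \<diamondop>\<^bsub>T\<^esub> (r2 \<lhd>\<^bsub>T\<^esub> (gr \<bullet>\<^bsub>T\<^esub> w))"
  using assms arg_cong[OF coherence1, of "\<lambda>\<xi>. \<xi> \<lhd>\<^bsub>T\<^esub> w"] arg_cong[OF coherence2, of "\<lambda>\<xi>. \<xi> \<lhd>\<^bsub>T\<^esub> w"]
  by (simp_all add: homs_iff whisker_vcomp whisker_assoc)

text \<open>Since \<open>q2 gr \<cong> 1\<close>, the functor \<open>gr \<bullet> _\<close> on Hom categories has a left inverse up to isomorphism.\<close>

lemma faithful:
  assumes w: "w \<in> cells1 T X H" "w' \<in> cells1 T X H"
    and \<alpha>: "\<alpha> \<in> cells2 T w w'" "\<alpha>' \<in> cells2 T w w'" and eq: "gr \<rhd>\<^bsub>T\<^esub> \<alpha> = gr \<rhd>\<^bsub>T\<^esub> \<alpha>'"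
  shows "\<alpha> = \<alpha>'"
proof -
  note ty = w[unfolded homs_iff] \<alpha>[unfolded homs_iff]
  have "\<alpha> \<diamondop>\<^bsub>T\<^esub> (s2 \<lhd>\<^bsub>T\<^esub> w) = \<alpha>' \<diamondop>\<^bsub>T\<^esub> (s2 \<lhd>\<^bsub>T\<^esub> w)"
    using natural_s2[of \<alpha> w w'] natural_s2[of \<alpha>' w w'] ty eq by simp
  then show ?thesis using ty by - (rule cancel_right2, auto)
qed

text \<open>
  The only candidate for \<open>\<alpha>\<close> is the transport of \<open>q2 \<rhd> \<theta>\<close> along \<open>s2\<close>. The compatibility of \<open>\<theta>\<close> and
  \<open>\<tau>\<close>, whiskered with \<open>p2\<close>, then gives \<open>i \<rhd> \<alpha> = \<tau>\<close>; whiskered with \<open>p1\<close> it gives \<open>gr \<rhd> \<alpha> = \<theta>\<close> on the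
  first component, whereas on the second component this holds by the choice of \<open>\<alpha>\<close>.
\<close>

lemma full:
  assumes w: "w \<in> cells1 T X H" and w': "w' \<in> cells1 T X H"
    and \<theta>: "\<theta> \<in> cells2 T (gr \<bullet>\<^bsub>T\<^esub> w) (gr \<bullet>\<^bsub>T\<^esub> w')" and \<tau>: "\<tau> \<in> cells2 T (i \<bullet>\<^bsub>T\<^esub> w) (i \<bullet>\<^bsub>T\<^esub> w')"
    and eq: "(\<gamma> \<lhd>\<^bsub>T\<^esub> w') \<diamondop>\<^bsub>T\<^esub> (k \<rhd>\<^bsub>T\<^esub> \<theta>) = (dg \<rhd>\<^bsub>T\<^esub> \<tau>) \<diamondop>\<^bsub>T\<^esub> (\<gamma> \<lhd>\<^bsub>T\<^esub> w)"
  shows "\<exists>\<alpha> \<in> cells2 T w w'. gr \<rhd>\<^bsub>T\<^esub> \<alpha> = \<theta> \<and> i \<rhd>\<^bsub>T\<^esub> \<alpha> = \<tau>"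
proof -
  note [simp] = w[unfolded homs_iff] w'[unfolded homs_iff] \<theta>[unfolded homs_iff] \<tau>[unfolded homs_iff]
  define \<alpha> where "\<alpha> = (s2 \<lhd>\<^bsub>T\<^esub> w') \<diamondop>\<^bsub>T\<^esub> (q2 \<rhd>\<^bsub>T\<^esub> \<theta>) \<diamondop>\<^bsub>T\<^esub> inv2 (s2 \<lhd>\<^bsub>T\<^esub> w)"
  have \<alpha> [simp]: "\<alpha> \<in> Arr V" "Dom V \<alpha> = w" "Cod V \<alpha> = w'"
    by (simp_all add: \<alpha>_def)
  have \<alpha>s2: "\<alpha> \<diamondop>\<^bsub>T\<^esub> (s2 \<lhd>\<^bsub>T\<^esub> w) = (s2 \<lhd>\<^bsub>T\<^esub> w') \<diamondop>\<^bsub>T\<^esub> (q2 \<rhd>\<^bsub>T\<^esub> \<theta>)"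
    by (simp add: \<alpha>_def)
  have eq_p: "(v \<rhd>\<^bsub>T\<^esub> (\<gamma> \<lhd>\<^bsub>T\<^esub> w')) \<diamondop>\<^bsub>T\<^esub> (v \<rhd>\<^bsub>T\<^esub> (k \<rhd>\<^bsub>T\<^esub> \<theta>)) = (v \<rhd>\<^bsub>T\<^esub> (dg \<rhd>\<^bsub>T\<^esub> \<tau>)) \<diamondop>\<^bsub>T\<^esub> (v \<rhd>\<^bsub>T\<^esub> (\<gamma> \<lhd>\<^bsub>T\<^esub> w))"
    if "v \<in> cells1 T GG G" for v
    using that arg_cong[OF eq, of "\<lambda>\<xi>. v \<rhd>\<^bsub>T\<^esub> \<xi>"] by (simp add: homs_iff whisker_vcomp)
  have "(i \<rhd>\<^bsub>T\<^esub> (\<alpha> \<diamondop>\<^bsub>T\<^esub> (s2 \<lhd>\<^bsub>T\<^esub> w))) \<diamondop>\<^bsub>T\<^esub> (r2 \<lhd>\<^bsub>T\<^esub> (gr \<bullet>\<^bsub>T\<^esub> w))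
      = (i \<rhd>\<^bsub>T\<^esub> (s2 \<lhd>\<^bsub>T\<^esub> w')) \<diamondop>\<^bsub>T\<^esub> (i \<rhd>\<^bsub>T\<^esub> (q2 \<rhd>\<^bsub>T\<^esub> \<theta>)) \<diamondop>\<^bsub>T\<^esub> (r2 \<lhd>\<^bsub>T\<^esub> (gr \<bullet>\<^bsub>T\<^esub> w))"
    by (simp add: \<alpha>s2 whisker_vcomp)
  also have "\<dots> = (i \<rhd>\<^bsub>T\<^esub> (s2 \<lhd>\<^bsub>T\<^esub> w')) \<diamondop>\<^bsub>T\<^esub> (r2 \<lhd>\<^bsub>T\<^esub> (gr \<bullet>\<^bsub>T\<^esub> w')) \<diamondop>\<^bsub>T\<^esub> (p2 \<rhd>\<^bsub>T\<^esub> (k \<rhd>\<^bsub>T\<^esub> \<theta>))"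
    by (subst natural_r2) simp_all
  also have "\<dots> = (d2 \<lhd>\<^bsub>T\<^esub> (i \<bullet>\<^bsub>T\<^esub> w')) \<diamondop>\<^bsub>T\<^esub> (p2 \<rhd>\<^bsub>T\<^esub> (\<gamma> \<lhd>\<^bsub>T\<^esub> w')) \<diamondop>\<^bsub>T\<^esub> (p2 \<rhd>\<^bsub>T\<^esub> (k \<rhd>\<^bsub>T\<^esub> \<theta>))"
    by (simp add: cat_prefix[OF coherence_at(2)[OF w', symmetric]])
  also have "\<dots> = (d2 \<lhd>\<^bsub>T\<^esub> (i \<bullet>\<^bsub>T\<^esub> w')) \<diamondop>\<^bsub>T\<^esub> (p2 \<rhd>\<^bsub>T\<^esub> (dg \<rhd>\<^bsub>T\<^esub> \<tau>)) \<diamondop>\<^bsub>T\<^esub> (p2 \<rhd>\<^bsub>T\<^esub> (\<gamma> \<lhd>\<^bsub>T\<^esub> w))"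
    by (simp add: eq_p cell1)
  also have "\<dots> = \<tau> \<diamondop>\<^bsub>T\<^esub> (d2 \<lhd>\<^bsub>T\<^esub> (i \<bullet>\<^bsub>T\<^esub> w)) \<diamondop>\<^bsub>T\<^esub> (p2 \<rhd>\<^bsub>T\<^esub> (\<gamma> \<lhd>\<^bsub>T\<^esub> w))"
    by (simp add: cat_prefix[OF natural_d2[of \<tau>]])
  also have "\<dots> = (\<tau> \<diamondop>\<^bsub>T\<^esub> (i \<rhd>\<^bsub>T\<^esub> (s2 \<lhd>\<^bsub>T\<^esub> w))) \<diamondop>\<^bsub>T\<^esub> (r2 \<lhd>\<^bsub>T\<^esub> (gr \<bullet>\<^bsub>T\<^esub> w))"
    by (simp add: coherence_at(2)[OF w])
  finally have "i \<rhd>\<^bsub>T\<^esub> (\<alpha> \<diamondop>\<^bsub>T\<^esub> (s2 \<lhd>\<^bsub>T\<^esub> w)) = \<tau> \<diamondop>\<^bsub>T\<^esub> (i \<rhd>\<^bsub>T\<^esub> (s2 \<lhd>\<^bsub>T\<^esub> w))"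
    by - (rule cancel_right2[where \<alpha> = "r2 \<lhd>\<^bsub>T\<^esub> (gr \<bullet>\<^bsub>T\<^esub> w)"], simp_all)
  then have i\<alpha>: "i \<rhd>\<^bsub>T\<^esub> \<alpha> = \<tau>"
    by - (rule cancel_right2[where \<alpha> = "i \<rhd>\<^bsub>T\<^esub> (s2 \<lhd>\<^bsub>T\<^esub> w)"], simp_all add: whisker_vcomp)
  have "((s1 \<lhd>\<^bsub>T\<^esub> w') \<diamondop>\<^bsub>T\<^esub> (q1 \<rhd>\<^bsub>T\<^esub> \<theta>)) \<diamondop>\<^bsub>T\<^esub> (r1 \<lhd>\<^bsub>T\<^esub> (gr \<bullet>\<^bsub>T\<^esub> w))
      = (s1 \<lhd>\<^bsub>T\<^esub> w') \<diamondop>\<^bsub>T\<^esub> (r1 \<lhd>\<^bsub>T\<^esub> (gr \<bullet>\<^bsub>T\<^esub> w')) \<diamondop>\<^bsub>T\<^esub> (p1 \<rhd>\<^bsub>T\<^esub> (k \<rhd>\<^bsub>T\<^esub> \<theta>))"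
    by (subst natural_r1) simp_all
  also have "\<dots> = (d1 \<lhd>\<^bsub>T\<^esub> (i \<bullet>\<^bsub>T\<^esub> w')) \<diamondop>\<^bsub>T\<^esub> (p1 \<rhd>\<^bsub>T\<^esub> (\<gamma> \<lhd>\<^bsub>T\<^esub> w')) \<diamondop>\<^bsub>T\<^esub> (p1 \<rhd>\<^bsub>T\<^esub> (k \<rhd>\<^bsub>T\<^esub> \<theta>))"
    by (simp add: cat_prefix[OF coherence_at(1)[OF w', symmetric]])
  also have "\<dots> = (d1 \<lhd>\<^bsub>T\<^esub> (i \<bullet>\<^bsub>T\<^esub> w')) \<diamondop>\<^bsub>T\<^esub> (p1 \<rhd>\<^bsub>T\<^esub> (dg \<rhd>\<^bsub>T\<^esub> \<tau>)) \<diamondop>\<^bsub>T\<^esub> (p1 \<rhd>\<^bsub>T\<^esub> (\<gamma> \<lhd>\<^bsub>T\<^esub> w))"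
    by (simp add: eq_p cell1)
  also have "\<dots> = \<tau> \<diamondop>\<^bsub>T\<^esub> (d1 \<lhd>\<^bsub>T\<^esub> (i \<bullet>\<^bsub>T\<^esub> w)) \<diamondop>\<^bsub>T\<^esub> (p1 \<rhd>\<^bsub>T\<^esub> (\<gamma> \<lhd>\<^bsub>T\<^esub> w))"
    by (simp add: cat_prefix[OF natural_d1[of \<tau>]])
  also have "\<dots> = ((i \<rhd>\<^bsub>T\<^esub> \<alpha>) \<diamondop>\<^bsub>T\<^esub> (s1 \<lhd>\<^bsub>T\<^esub> w)) \<diamondop>\<^bsub>T\<^esub> (r1 \<lhd>\<^bsub>T\<^esub> (gr \<bullet>\<^bsub>T\<^esub> w))"
    by (simp add: coherence_at(1)[OF w] i\<alpha>)
  finally have "(s1 \<lhd>\<^bsub>T\<^esub> w') \<diamondop>\<^bsub>T\<^esub> (q1 \<rhd>\<^bsub>T\<^esub> \<theta>) = (i \<rhd>\<^bsub>T\<^esub> \<alpha>) \<diamondop>\<^bsub>T\<^esub> (s1 \<lhd>\<^bsub>T\<^esub> w)"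
    by - (rule cancel_right2[where \<alpha> = "r1 \<lhd>\<^bsub>T\<^esub> (gr \<bullet>\<^bsub>T\<^esub> w)"], simp_all)
  then have 1: "q1 \<rhd>\<^bsub>T\<^esub> (gr \<rhd>\<^bsub>T\<^esub> \<alpha>) = q1 \<rhd>\<^bsub>T\<^esub> \<theta>"
    by - (rule cancel_left2[where \<alpha> = "s1 \<lhd>\<^bsub>T\<^esub> w'"], simp_all add: natural_s1[of \<alpha> w w'])
  have 2: "q2 \<rhd>\<^bsub>T\<^esub> (gr \<rhd>\<^bsub>T\<^esub> \<alpha>) = q2 \<rhd>\<^bsub>T\<^esub> \<theta>"
    by (rule cancel_left2[where \<alpha> = "s2 \<lhd>\<^bsub>T\<^esub> w'"]) (simp_all add: natural_s2[of \<alpha> w w'] \<alpha>s2)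
  have "gr \<rhd>\<^bsub>T\<^esub> \<alpha> = \<theta>"
    by (rule jointly_faithful_GH[OF _ _ _ \<theta> 1 2, of X]) (simp_all add: homs_iff)
  with i\<alpha> show ?thesis by (intro bexI[of _ \<alpha>]) (simp_all add: homs_iff)
qed

text \<open>
  An object \<open>(a, b, d)\<close> of the iso-comma category is reached from the second component of \<open>a\<close>. The
  2-cell \<open>d\<close> connects \<open>i\<close> applied to this component with \<open>b\<close>, through \<open>p2\<close>, and \<open>b\<close> with the first
  component of \<open>a\<close>, through \<open>p1\<close>; these are \<open>\<tau>\<close> and the first component \<open>\<theta>1\<close> of \<open>\<theta>\<close>.
\<close>

lemma essentially_surjective:
  assumes a: "a \<in> cells1 T X GH" and b: "b \<in> cells1 T X G"
    and d: "d \<in> cells2 T (k \<bullet>\<^bsub>T\<^esub> a) (dg \<bullet>\<^bsub>T\<^esub> b)"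
  obtains w \<theta> \<tau> where "w \<in> cells1 T X H"
    "\<theta> \<in> cells2 T (gr \<bullet>\<^bsub>T\<^esub> w) a" "\<tau> \<in> cells2 T (i \<bullet>\<^bsub>T\<^esub> w) b"
    "d \<diamondop>\<^bsub>T\<^esub> (k \<rhd>\<^bsub>T\<^esub> \<theta>) = (dg \<rhd>\<^bsub>T\<^esub> \<tau>) \<diamondop>\<^bsub>T\<^esub> (\<gamma> \<lhd>\<^bsub>T\<^esub> w)"
proof -
  note [simp] = a[unfolded homs_iff] b[unfolded homs_iff] d[unfolded homs_iff]
  define w where "w = q2 \<bullet>\<^bsub>T\<^esub> a"
  have w: "w \<in> cells1 T X H" by (simp add: w_def homs_iff)
  note [simp] = w[unfolded homs_iff]
  define \<tau> where "\<tau> = (d2 \<lhd>\<^bsub>T\<^esub> b) \<diamondop>\<^bsub>T\<^esub> (p2 \<rhd>\<^bsub>T\<^esub> d) \<diamondop>\<^bsub>T\<^esub> inv2 (r2 \<lhd>\<^bsub>T\<^esub> a)"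
  have \<tau> [simp]: "\<tau> \<in> Arr V" "Dom V \<tau> = i \<bullet>\<^bsub>T\<^esub> w" "Cod V \<tau> = b"
    by (simp_all add: \<tau>_def w_def)
  define \<theta>1 where "\<theta>1 = (r1 \<lhd>\<^bsub>T\<^esub> a) \<diamondop>\<^bsub>T\<^esub> inv2 ((d1 \<lhd>\<^bsub>T\<^esub> b) \<diamondop>\<^bsub>T\<^esub> (p1 \<rhd>\<^bsub>T\<^esub> d)) \<diamondop>\<^bsub>T\<^esub> \<tau> \<diamondop>\<^bsub>T\<^esub> (s1 \<lhd>\<^bsub>T\<^esub> w)"
  have \<theta>1 [simp]: "\<theta>1 \<in> Arr V" "Dom V \<theta>1 = q1 \<bullet>\<^bsub>T\<^esub> gr \<bullet>\<^bsub>T\<^esub> w" "Cod V \<theta>1 = q1 \<bullet>\<^bsub>T\<^esub> a"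
    by (simp_all add: \<theta>1_def)
  have "s2 \<lhd>\<^bsub>T\<^esub> w \<in> cells2 T (q2 \<bullet>\<^bsub>T\<^esub> gr \<bullet>\<^bsub>T\<^esub> w) (q2 \<bullet>\<^bsub>T\<^esub> a)"
    by (simp add: homs_iff) (simp add: w_def)
  then obtain \<theta> where \<theta>: "\<theta> \<in> cells2 T (gr \<bullet>\<^bsub>T\<^esub> w) a"
    and q1\<theta>: "q1 \<rhd>\<^bsub>T\<^esub> \<theta> = \<theta>1" and q2\<theta>: "q2 \<rhd>\<^bsub>T\<^esub> \<theta> = s2 \<lhd>\<^bsub>T\<^esub> w"
    using jointly_full_GH[of "gr \<bullet>\<^bsub>T\<^esub> w" X a \<theta>1 "s2 \<lhd>\<^bsub>T\<^esub> w"] a by (auto simp: homs_iff)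
  note [simp] = \<theta>[unfolded homs_iff]
  have 1: "p1 \<rhd>\<^bsub>T\<^esub> (d \<diamondop>\<^bsub>T\<^esub> (k \<rhd>\<^bsub>T\<^esub> \<theta>)) = p1 \<rhd>\<^bsub>T\<^esub> ((dg \<rhd>\<^bsub>T\<^esub> \<tau>) \<diamondop>\<^bsub>T\<^esub> (\<gamma> \<lhd>\<^bsub>T\<^esub> w))"
  proof (rule cancel_left2[where \<alpha> = "d1 \<lhd>\<^bsub>T\<^esub> b"])
    let ?e = "(d1 \<lhd>\<^bsub>T\<^esub> b) \<diamondop>\<^bsub>T\<^esub> (p1 \<rhd>\<^bsub>T\<^esub> d)"
    have "?e \<diamondop>\<^bsub>T\<^esub> (p1 \<rhd>\<^bsub>T\<^esub> (k \<rhd>\<^bsub>T\<^esub> \<theta>))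
        = ?e \<diamondop>\<^bsub>T\<^esub> inv2 (r1 \<lhd>\<^bsub>T\<^esub> a) \<diamondop>\<^bsub>T\<^esub> (r1 \<lhd>\<^bsub>T\<^esub> a) \<diamondop>\<^bsub>T\<^esub> (p1 \<rhd>\<^bsub>T\<^esub> (k \<rhd>\<^bsub>T\<^esub> \<theta>))"
      by simp
    also have "\<dots> = ?e \<diamondop>\<^bsub>T\<^esub> inv2 ?e \<diamondop>\<^bsub>T\<^esub> \<tau> \<diamondop>\<^bsub>T\<^esub> (s1 \<lhd>\<^bsub>T\<^esub> w) \<diamondop>\<^bsub>T\<^esub> (r1 \<lhd>\<^bsub>T\<^esub> (gr \<bullet>\<^bsub>T\<^esub> w))"
      by (subst natural_r1[of \<theta> "gr \<bullet>\<^bsub>T\<^esub> w" a]) (simp_all add: q1\<theta> \<theta>1_def)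
    also have "\<dots> = \<tau> \<diamondop>\<^bsub>T\<^esub> (s1 \<lhd>\<^bsub>T\<^esub> w) \<diamondop>\<^bsub>T\<^esub> (r1 \<lhd>\<^bsub>T\<^esub> (gr \<bullet>\<^bsub>T\<^esub> w))"
      by (rule inv2_prefix(2)) simp_all
    also have "\<dots> = \<tau> \<diamondop>\<^bsub>T\<^esub> (d1 \<lhd>\<^bsub>T\<^esub> (i \<bullet>\<^bsub>T\<^esub> w)) \<diamondop>\<^bsub>T\<^esub> (p1 \<rhd>\<^bsub>T\<^esub> (\<gamma> \<lhd>\<^bsub>T\<^esub> w))"
      by (simp add: coherence_at(1)[OF w])
    also have "\<dots> = (d1 \<lhd>\<^bsub>T\<^esub> b) \<diamondop>\<^bsub>T\<^esub> (p1 \<rhd>\<^bsub>T\<^esub> (dg \<rhd>\<^bsub>T\<^esub> \<tau>)) \<diamondop>\<^bsub>T\<^esub> (p1 \<rhd>\<^bsub>T\<^esub> (\<gamma> \<lhd>\<^bsub>T\<^esub> w))"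
      by (simp add: cat_prefix[OF natural_d1[of \<tau>]])
    finally show "(d1 \<lhd>\<^bsub>T\<^esub> b) \<diamondop>\<^bsub>T\<^esub> (p1 \<rhd>\<^bsub>T\<^esub> (d \<diamondop>\<^bsub>T\<^esub> (k \<rhd>\<^bsub>T\<^esub> \<theta>)))
        = (d1 \<lhd>\<^bsub>T\<^esub> b) \<diamondop>\<^bsub>T\<^esub> (p1 \<rhd>\<^bsub>T\<^esub> ((dg \<rhd>\<^bsub>T\<^esub> \<tau>) \<diamondop>\<^bsub>T\<^esub> (\<gamma> \<lhd>\<^bsub>T\<^esub> w)))"
      by (simp add: whisker_vcomp)
  qed simp_all
  have 2: "p2 \<rhd>\<^bsub>T\<^esub> (d \<diamondop>\<^bsub>T\<^esub> (k \<rhd>\<^bsub>T\<^esub> \<theta>)) = p2 \<rhd>\<^bsub>T\<^esub> ((dg \<rhd>\<^bsub>T\<^esub> \<tau>) \<diamondop>\<^bsub>T\<^esub> (\<gamma> \<lhd>\<^bsub>T\<^esub> w))"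
  proof (rule cancel_left2[where \<alpha> = "d2 \<lhd>\<^bsub>T\<^esub> b"])
    have "(d2 \<lhd>\<^bsub>T\<^esub> b) \<diamondop>\<^bsub>T\<^esub> (p2 \<rhd>\<^bsub>T\<^esub> d) \<diamondop>\<^bsub>T\<^esub> (p2 \<rhd>\<^bsub>T\<^esub> (k \<rhd>\<^bsub>T\<^esub> \<theta>))
        = \<tau> \<diamondop>\<^bsub>T\<^esub> (r2 \<lhd>\<^bsub>T\<^esub> a) \<diamondop>\<^bsub>T\<^esub> (p2 \<rhd>\<^bsub>T\<^esub> (k \<rhd>\<^bsub>T\<^esub> \<theta>))"
      by (simp add: \<tau>_def w_def)
    also have "\<dots> = \<tau> \<diamondop>\<^bsub>T\<^esub> (i \<rhd>\<^bsub>T\<^esub> (s2 \<lhd>\<^bsub>T\<^esub> w)) \<diamondop>\<^bsub>T\<^esub> (r2 \<lhd>\<^bsub>T\<^esub> (gr \<bullet>\<^bsub>T\<^esub> w))"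
      by (subst natural_r2[of \<theta> "gr \<bullet>\<^bsub>T\<^esub> w" a]) (simp_all add: q2\<theta>)
    also have "\<dots> = \<tau> \<diamondop>\<^bsub>T\<^esub> (d2 \<lhd>\<^bsub>T\<^esub> (i \<bullet>\<^bsub>T\<^esub> w)) \<diamondop>\<^bsub>T\<^esub> (p2 \<rhd>\<^bsub>T\<^esub> (\<gamma> \<lhd>\<^bsub>T\<^esub> w))"
      by (simp add: coherence_at(2)[OF w])
    also have "\<dots> = (d2 \<lhd>\<^bsub>T\<^esub> b) \<diamondop>\<^bsub>T\<^esub> (p2 \<rhd>\<^bsub>T\<^esub> (dg \<rhd>\<^bsub>T\<^esub> \<tau>)) \<diamondop>\<^bsub>T\<^esub> (p2 \<rhd>\<^bsub>T\<^esub> (\<gamma> \<lhd>\<^bsub>T\<^esub> w))"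
      by (simp add: cat_prefix[OF natural_d2[of \<tau>]])
    finally show "(d2 \<lhd>\<^bsub>T\<^esub> b) \<diamondop>\<^bsub>T\<^esub> (p2 \<rhd>\<^bsub>T\<^esub> (d \<diamondop>\<^bsub>T\<^esub> (k \<rhd>\<^bsub>T\<^esub> \<theta>)))
        = (d2 \<lhd>\<^bsub>T\<^esub> b) \<diamondop>\<^bsub>T\<^esub> (p2 \<rhd>\<^bsub>T\<^esub> ((dg \<rhd>\<^bsub>T\<^esub> \<tau>) \<diamondop>\<^bsub>T\<^esub> (\<gamma> \<lhd>\<^bsub>T\<^esub> w)))"
      by (simp add: whisker_vcomp)
  qed simp_all
  have "d \<diamondop>\<^bsub>T\<^esub> (k \<rhd>\<^bsub>T\<^esub> \<theta>) = (dg \<rhd>\<^bsub>T\<^esub> \<tau>) \<diamondop>\<^bsub>T\<^esub> (\<gamma> \<lhd>\<^bsub>T\<^esub> w)"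
    by (rule jointly_faithful_GG[OF _ _ _ _ 1 2, of "k \<bullet>\<^bsub>T\<^esub> gr \<bullet>\<^bsub>T\<^esub> w" X "dg \<bullet>\<^bsub>T\<^esub> b"]) (simp_all add: homs_iff)
  with w \<theta> show thesis by (intro that[of w \<theta> \<tau>]) (simp_all add: homs_iff)
qed


text \<open>Essential surjectivity asks for isomorphisms, but in a (2,1)-category all arrows of the iso-comma
  category are invertible.\<close>

lemma isocomma_arrow_iso:
  assumes ob: "(a, b, \<delta>) \<in> Ob (isocomma T X k dg)" "(a', b', \<delta>') \<in> Ob (isocomma T X k dg)"
    and \<theta>: "\<theta> \<in> cells2 T a a'" and \<tau>: "\<tau> \<in> cells2 T b b'"
    and eq: "\<delta>' \<diamondop>\<^bsub>T\<^esub> (k \<rhd>\<^bsub>T\<^esub> \<theta>) = (dg \<rhd>\<^bsub>T\<^esub> \<tau>) \<diamondop>\<^bsub>T\<^esub> \<delta>"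
  shows "isos (isocomma T X k dg) (a, b, \<delta>) (a', b', \<delta>') \<noteq> {}"
proof -
  have [simp]: "a \<in> Arr U" "src T a = X" "trg T a = GH" "b \<in> Arr U" "src T b = X" "trg T b = G"
    "\<delta> \<in> Arr V" "Dom V \<delta> = k \<bullet>\<^bsub>T\<^esub> a" "Cod V \<delta> = dg \<bullet>\<^bsub>T\<^esub> b"
    "a' \<in> Arr U" "src T a' = X" "trg T a' = GH" "b' \<in> Arr U" "src T b' = X" "trg T b' = G"
    "\<delta>' \<in> Arr V" "Dom V \<delta>' = k \<bullet>\<^bsub>T\<^esub> a'" "Cod V \<delta>' = dg \<bullet>\<^bsub>T\<^esub> b'"
    using ob by (auto simp: isocomma_def Let_def cells2_isos[symmetric] homs_iff)
  note [simp] = \<theta>[unfolded homs_iff] \<tau>[unfolded homs_iff]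
  have "\<delta> \<diamondop>\<^bsub>T\<^esub> (k \<rhd>\<^bsub>T\<^esub> inv2 \<theta>) = (dg \<rhd>\<^bsub>T\<^esub> (inv2 \<tau> \<diamondop>\<^bsub>T\<^esub> \<tau>)) \<diamondop>\<^bsub>T\<^esub> \<delta> \<diamondop>\<^bsub>T\<^esub> (k \<rhd>\<^bsub>T\<^esub> inv2 \<theta>)"
    by (simp add: id2_comp[symmetric])
  also have "\<dots> = (dg \<rhd>\<^bsub>T\<^esub> inv2 \<tau>) \<diamondop>\<^bsub>T\<^esub> ((dg \<rhd>\<^bsub>T\<^esub> \<tau>) \<diamondop>\<^bsub>T\<^esub> \<delta>) \<diamondop>\<^bsub>T\<^esub> (k \<rhd>\<^bsub>T\<^esub> inv2 \<theta>)"
    by (simp add: whisker_vcomp del: inv2(4))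
  also have "\<dots> = (dg \<rhd>\<^bsub>T\<^esub> inv2 \<tau>) \<diamondop>\<^bsub>T\<^esub> \<delta>' \<diamondop>\<^bsub>T\<^esub> (k \<rhd>\<^bsub>T\<^esub> (\<theta> \<diamondop>\<^bsub>T\<^esub> inv2 \<theta>))"
    by (simp add: whisker_vcomp eq[symmetric] del: inv2(5))
  also have "\<dots> = (dg \<rhd>\<^bsub>T\<^esub> inv2 \<tau>) \<diamondop>\<^bsub>T\<^esub> \<delta>'"
    by (simp add: id2_comp[symmetric])
  finally have inv: "\<delta> \<diamondop>\<^bsub>T\<^esub> (k \<rhd>\<^bsub>T\<^esub> inv2 \<theta>) = (dg \<rhd>\<^bsub>T\<^esub> inv2 \<tau>) \<diamondop>\<^bsub>T\<^esub> \<delta>'" .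
  have "mutually_inverse (isocomma T X k dg) (a, b, \<delta>) (a', b', \<delta>')
      ((a, b, \<delta>), (a', b', \<delta>'), \<theta>, \<tau>) ((a', b', \<delta>'), (a, b, \<delta>), inv2 \<theta>, inv2 \<tau>)"
    using eq inv
    by (intro mutually_inverseI)
      (simp_all add: isocomma_def Let_def cells2_isos[symmetric] homs_iff)
  then show ?thesis unfolding isos_def by blast
qed

lemma pseudopullback: "pseudopullback T k dg gr i \<gamma>"
proof -
  let ?F = "\<lambda>w. (gr \<bullet>\<^bsub>T\<^esub> w, i \<bullet>\<^bsub>T\<^esub> w, \<gamma> \<lhd>\<^bsub>T\<^esub> w)"
  let ?Fa = "\<lambda>\<alpha>. let w = Dom V \<alpha>; w' = Cod V \<alpha> in (?F w, ?F w', gr \<rhd>\<^bsub>T\<^esub> \<alpha>, i \<rhd>\<^bsub>T\<^esub> \<alpha>)"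
  have "cat_equivalence (hom_cat T X H) (isocomma T X k dg) \<lparr>FO = ?F, FA = ?Fa\<rparr>" for X
  proof -
    let ?I = "isocomma T X k dg"
    have hom: "homs (hom_cat T X H) w w' = {\<alpha> \<in> cells2 T w w'. w \<in> cells1 T X H \<and> w' \<in> cells1 T X H}" for w w'
      by (auto simp: homs_iff hom_cat_def)
    have homI: "homs ?I (?F w) (?F w') = {(?F w, ?F w', \<theta>, \<tau>) | \<theta> \<tau>.
        \<theta> \<in> cells2 T (gr \<bullet>\<^bsub>T\<^esub> w) (gr \<bullet>\<^bsub>T\<^esub> w') \<and> \<tau> \<in> cells2 T (i \<bullet>\<^bsub>T\<^esub> w) (i \<bullet>\<^bsub>T\<^esub> w') \<and>
        (\<gamma> \<lhd>\<^bsub>T\<^esub> w') \<diamondop>\<^bsub>T\<^esub> (k \<rhd>\<^bsub>T\<^esub> \<theta>) = (dg \<rhd>\<^bsub>T\<^esub> \<tau>) \<diamondop>\<^bsub>T\<^esub> (\<gamma> \<lhd>\<^bsub>T\<^esub> w)}"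
      if "w \<in> cells1 T X H" "w' \<in> cells1 T X H" for w w'
      using that by (auto simp: isocomma_def Let_def cells2_isos[symmetric] homs_iff)
    have ob: "?F w \<in> Ob ?I" if "w \<in> cells1 T X H" for w
      using that by (auto simp: isocomma_def Let_def cells2_isos[symmetric] homs_iff)
    have ar: "?Fa \<alpha> \<in> homs ?I (?F w) (?F w')" if "\<alpha> \<in> homs (hom_cat T X H) w w'" for \<alpha> w w'
      using that unfolding hom by (simp add: homI) (simp add: homs_iff natural_\<gamma>)
    have "is_functor (hom_cat T X H) ?I \<lparr>FO = ?F, FA = ?Fa\<rparr>"
      unfolding is_functor_def
    proof (intro conjI allI ballI impI)
      fix w assume "w \<in> Ob (hom_cat T X H)"
      then have "w \<in> cells1 T X H" by (simp add: hom_cat_def)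
      then show "FO \<lparr>FO = ?F, FA = ?Fa\<rparr> w \<in> Ob ?I"
        and "FA \<lparr>FO = ?F, FA = ?Fa\<rparr> (Idn (hom_cat T X H) w) = Idn ?I (FO \<lparr>FO = ?F, FA = ?Fa\<rparr> w)"
        using ob[of w] by (simp_all add: homs_iff hom_cat_def isocomma_def Let_def id2_comp)
    next
      fix w w' \<alpha> assume "\<alpha> \<in> homs (hom_cat T X H) w w'"
      then show "FA \<lparr>FO = ?F, FA = ?Fa\<rparr> \<alpha> \<in> homs ?I (FO \<lparr>FO = ?F, FA = ?Fa\<rparr> w) (FO \<lparr>FO = ?F, FA = ?Fa\<rparr> w')"
        using ar by simp
    next
      fix w w' w'' \<alpha> \<beta>
      assume "\<alpha> \<in> homs (hom_cat T X H) w w'" "\<beta> \<in> homs (hom_cat T X H) w' w''"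
      then show "FA \<lparr>FO = ?F, FA = ?Fa\<rparr> (\<beta> \<cdot>\<^bsub>hom_cat T X H\<^esub> \<alpha>)
          = FA \<lparr>FO = ?F, FA = ?Fa\<rparr> \<beta> \<cdot>\<^bsub>?I\<^esub> FA \<lparr>FO = ?F, FA = ?Fa\<rparr> \<alpha>"
        unfolding hom by (auto simp: homs_iff hom_cat_def isocomma_def Let_def whisker_vcomp)
    qed
    moreover have "bij_betw ?Fa (homs (hom_cat T X H) w w') (homs ?I (?F w) (?F w'))"
      if w: "w \<in> cells1 T X H" "w' \<in> cells1 T X H" for w w'
    proof (rule bij_betw_imageI)
      show "inj_on ?Fa (homs (hom_cat T X H) w w')"
        unfolding inj_on_def hom using faithful[OF w] by (auto simp: Let_def)
      have "\<exists>\<alpha> \<in> homs (hom_cat T X H) w w'. ?Fa \<alpha> = z" if z: "z \<in> homs ?I (?F w) (?F w')" for z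
      proof -
        obtain \<theta> \<tau> where z: "z = (?F w, ?F w', \<theta>, \<tau>)" and \<theta>: "\<theta> \<in> cells2 T (gr \<bullet>\<^bsub>T\<^esub> w) (gr \<bullet>\<^bsub>T\<^esub> w')"
          and \<tau>: "\<tau> \<in> cells2 T (i \<bullet>\<^bsub>T\<^esub> w) (i \<bullet>\<^bsub>T\<^esub> w')"
          and e: "(\<gamma> \<lhd>\<^bsub>T\<^esub> w') \<diamondop>\<^bsub>T\<^esub> (k \<rhd>\<^bsub>T\<^esub> \<theta>) = (dg \<rhd>\<^bsub>T\<^esub> \<tau>) \<diamondop>\<^bsub>T\<^esub> (\<gamma> \<lhd>\<^bsub>T\<^esub> w)"
          using z unfolding homI[OF w] by auto
        obtain \<alpha> where "\<alpha> \<in> cells2 T w w'" "gr \<rhd>\<^bsub>T\<^esub> \<alpha> = \<theta>" "i \<rhd>\<^bsub>T\<^esub> \<alpha> = \<tau>"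
          using full[OF w \<theta> \<tau> e] by blast
        then show ?thesis using w unfolding z hom
          by (intro bexI[of _ \<alpha>]) (auto simp: homs_iff Let_def)
      qed
      then show "?Fa ` homs (hom_cat T X H) w w' = homs ?I (?F w) (?F w')"
        using ar by blast
    qed
    moreover have "\<exists>w \<in> cells1 T X H. isos ?I (?F w) z \<noteq> {}" if z: "z \<in> Ob ?I" for z
    proof -
      obtain a b d where z': "z = (a, b, d)" "a \<in> cells1 T X GH" "b \<in> cells1 T X G"
        "d \<in> cells2 T (k \<bullet>\<^bsub>T\<^esub> a) (dg \<bullet>\<^bsub>T\<^esub> b)"
        using z by (auto simp: isocomma_def Let_def cells2_isos)
      obtain w \<theta> \<tau> where w: "w \<in> cells1 T X H"
        "\<theta> \<in> cells2 T (gr \<bullet>\<^bsub>T\<^esub> w) a" "\<tau> \<in> cells2 T (i \<bullet>\<^bsub>T\<^esub> w) b"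
        "d \<diamondop>\<^bsub>T\<^esub> (k \<rhd>\<^bsub>T\<^esub> \<theta>) = (dg \<rhd>\<^bsub>T\<^esub> \<tau>) \<diamondop>\<^bsub>T\<^esub> (\<gamma> \<lhd>\<^bsub>T\<^esub> w)"
        using essentially_surjective[OF z'(2-4)] by metis
      then show ?thesis
        using isocomma_arrow_iso[OF ob[OF w(1)] z[unfolded z'(1)] w(2-4)] unfolding z'(1) by blast
    qed
    ultimately show ?thesis
      unfolding cat_equivalence_def by (auto simp: hom_cat_def)
  qed
  then show ?thesis
    unfolding pseudopullback_def cells2_isos[symmetric]
    by (intro exI[of _ H] exI[of _ GH] exI[of _ G] exI[of _ GG]) (simp add: cell1 cell2)
qed

end


section \<open>Binary products\<close>

text \<open>
  The universal property of the chosen products in terms of 1-cells and 2-cells. In contrast to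
  the formulation by families indexed by numbers, it is visibly symmetric in the two factors, which
  allows the second projection formula to be derived from the first.
\<close>

definition binary_products :: "('g, 'h, 'c) twocat \<Rightarrow> ('g, 'h, 'c) prods \<Rightarrow> bool" where
  "binary_products T Q \<longleftrightarrow>
    (\<forall>G1 \<in> Ob (Under T). \<forall>G2 \<in> Ob (Under T).
      prd Q G1 G2 \<in> Ob (Under T) \<and>
      pr1 Q G1 G2 \<in> cells1 T (prd Q G1 G2) G1 \<and> pr2 Q G1 G2 \<in> cells1 T (prd Q G1 G2) G2 \<and>
      (\<forall>X a b. a \<in> cells1 T X G1 \<longrightarrow> b \<in> cells1 T X G2 \<longrightarrow>
        (\<exists>w \<alpha> \<beta>. w \<in> cells1 T X (prd Q G1 G2) \<and>
          \<alpha> \<in> cells2 T (pr1 Q G1 G2 \<bullet>\<^bsub>T\<^esub> w) a \<and> \<beta> \<in> cells2 T (pr2 Q G1 G2 \<bullet>\<^bsub>T\<^esub> w) b)) \<and>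
      (\<forall>X w w' \<alpha> \<beta>. w \<in> cells1 T X (prd Q G1 G2) \<longrightarrow> w' \<in> cells1 T X (prd Q G1 G2) \<longrightarrow>
        \<alpha> \<in> cells2 T (pr1 Q G1 G2 \<bullet>\<^bsub>T\<^esub> w) (pr1 Q G1 G2 \<bullet>\<^bsub>T\<^esub> w') \<longrightarrow>
        \<beta> \<in> cells2 T (pr2 Q G1 G2 \<bullet>\<^bsub>T\<^esub> w) (pr2 Q G1 G2 \<bullet>\<^bsub>T\<^esub> w') \<longrightarrow>
        (\<exists>!\<omega>. \<omega> \<in> cells2 T w w' \<and> pr1 Q G1 G2 \<rhd>\<^bsub>T\<^esub> \<omega> = \<alpha> \<and> pr2 Q G1 G2 \<rhd>\<^bsub>T\<^esub> \<omega> = \<beta>))) \<and>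
    (\<forall>H1 G1 H2 G2 u1 u2. u1 \<in> cells1 T H1 G1 \<longrightarrow> u2 \<in> cells1 T H2 G2 \<longrightarrow>
      prd1 Q u1 u2 \<in> cells1 T (prd Q H1 H2) (prd Q G1 G2) \<and>
      psq1 Q u1 u2 \<in> cells2 T (pr1 Q G1 G2 \<bullet>\<^bsub>T\<^esub> prd1 Q u1 u2) (u1 \<bullet>\<^bsub>T\<^esub> pr1 Q H1 H2) \<and>
      psq2 Q u1 u2 \<in> cells2 T (pr2 Q G1 G2 \<bullet>\<^bsub>T\<^esub> prd1 Q u1 u2) (u2 \<bullet>\<^bsub>T\<^esub> pr2 Q H1 H2))"

lemma two_family_simps [simp]: "two_family x y 0 = x" "two_family x y (Suc 0) = y"
  by (simp_all add: two_family_def)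

lemma less_2_cases_all: "(\<forall>l<2::nat. P l) \<longleftrightarrow> P 0 \<and> P (Suc 0)"
  by (auto simp: less_2_cases_iff)

lemma bij_betw_ex1:
  assumes "bij_betw f A B" "b \<in> B"
  shows "\<exists>!a. a \<in> A \<and> f a = b"
  using assms by (auto simp: bij_betw_def inj_on_def)

lemma (in two_one) is_product_binary:
  assumes prod: "is_product T 2 (two_family G1 G2) P (two_family p1 p2)"
  shows "P \<in> Ob U" "p1 \<in> cells1 T P G1" "p2 \<in> cells1 T P G2"
    and "\<And>X a b. a \<in> cells1 T X G1 \<Longrightarrow> b \<in> cells1 T X G2 \<Longrightarrow>
        \<exists>w \<alpha> \<beta>. w \<in> cells1 T X P \<and> \<alpha> \<in> cells2 T (p1 \<bullet>\<^bsub>T\<^esub> w) a \<and> \<beta> \<in> cells2 T (p2 \<bullet>\<^bsub>T\<^esub> w) b"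
    and "\<And>X w w' \<alpha> \<beta>. w \<in> cells1 T X P \<Longrightarrow> w' \<in> cells1 T X P \<Longrightarrow>
        \<alpha> \<in> cells2 T (p1 \<bullet>\<^bsub>T\<^esub> w) (p1 \<bullet>\<^bsub>T\<^esub> w') \<Longrightarrow> \<beta> \<in> cells2 T (p2 \<bullet>\<^bsub>T\<^esub> w) (p2 \<bullet>\<^bsub>T\<^esub> w') \<Longrightarrow>
        \<exists>!\<omega>. \<omega> \<in> cells2 T w w' \<and> p1 \<rhd>\<^bsub>T\<^esub> \<omega> = \<alpha> \<and> p2 \<rhd>\<^bsub>T\<^esub> \<omega> = \<beta>"
proof -
  show P: "P \<in> Ob U" and p: "p1 \<in> cells1 T P G1" "p2 \<in> cells1 T P G2"
    using prod unfolding is_product_def less_2_cases_all by simp_all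
  let ?F = "\<lambda>X. family_cat 2 (\<lambda>l. hom_cat T X (two_family G1 G2 l))"
  let ?P = "\<lparr>FO = (\<lambda>f. \<lambda>l\<in>{..<2}. two_family p1 p2 l \<bullet>\<^bsub>T\<^esub> f), FA = (\<lambda>\<alpha>. \<lambda>l\<in>{..<2}. two_family p1 p2 l \<rhd>\<^bsub>T\<^esub> \<alpha>)\<rparr>"
  have eqv: "cat_equivalence (hom_cat T X P) (?F X) ?P" if "X \<in> Ob U" for X
    using prod that unfolding is_product_def by blast
  have lt2: "x < 2 \<longleftrightarrow> x = 0 \<or> x = Suc 0" for x :: nat by auto
  have X: "X \<in> Ob U" if "u \<in> cells1 T X Y" for X Y u
    using that by (auto simp: homs_iff)
  {
    fix X a b assume a: "a \<in> cells1 T X G1" and b: "b \<in> cells1 T X G2"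
    let ?d = "\<lambda>l\<in>{..<2}. two_family a b l"
    have "?d \<in> Ob (?F X)"
      using a b by (auto simp: family_cat_def hom_cat_def lt2)
    then have "\<exists>w \<in> Ob (hom_cat T X P). isos (?F X) (FO ?P w) ?d \<noteq> {}"
      using eqv[OF X[OF a]] unfolding cat_equivalence_def by blast
    then obtain w where w: "w \<in> cells1 T X P" and "isos (?F X) (FO ?P w) ?d \<noteq> {}"
      unfolding hom_cat_def by force
    then obtain f where "f \<in> homs (?F X) (FO ?P w) ?d"
      by (auto simp: isos_def mutually_inverse_def)
    then have f: "f \<in> Arr (?F X)" "Dom (?F X) f = FO ?P w" "Cod (?F X) f = ?d"
      by (simp_all add: homs_iff)
    have "f 0 \<in> cells2 T (p1 \<bullet>\<^bsub>T\<^esub> w) a"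
      using f(1) fun_cong[OF f(2), of 0] fun_cong[OF f(3), of 0]
      by (auto simp: family_cat_def hom_cat_def homs_iff PiE_iff lt2)
    moreover have "f (Suc 0) \<in> cells2 T (p2 \<bullet>\<^bsub>T\<^esub> w) b"
      using f(1) fun_cong[OF f(2), of "Suc 0"] fun_cong[OF f(3), of "Suc 0"]
      by (auto simp: family_cat_def hom_cat_def homs_iff PiE_iff lt2)
    ultimately show "\<exists>w \<alpha> \<beta>. w \<in> cells1 T X P \<and> \<alpha> \<in> cells2 T (p1 \<bullet>\<^bsub>T\<^esub> w) a \<and> \<beta> \<in> cells2 T (p2 \<bullet>\<^bsub>T\<^esub> w) b"
      using w by blast
  next
    fix X w w' \<alpha> \<beta>
    assume w: "w \<in> cells1 T X P" "w' \<in> cells1 T X P"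
      and \<alpha>: "\<alpha> \<in> cells2 T (p1 \<bullet>\<^bsub>T\<^esub> w) (p1 \<bullet>\<^bsub>T\<^esub> w')" and \<beta>: "\<beta> \<in> cells2 T (p2 \<bullet>\<^bsub>T\<^esub> w) (p2 \<bullet>\<^bsub>T\<^esub> w')"
    let ?f = "\<lambda>l\<in>{..<2}. two_family \<alpha> \<beta> l"
    have hom: "homs (hom_cat T X P) w w' = cells2 T w w'"
      using w by (auto simp: homs_iff hom_cat_def)
    have bij: "bij_betw (FA ?P) (cells2 T w w') (homs (?F X) (FO ?P w) (FO ?P w'))"
      using eqv[OF X[OF w(1)]] w unfolding cat_equivalence_def hom[symmetric]
      by (auto simp: hom_cat_def)
    have f: "?f \<in> homs (?F X) (FO ?P w) (FO ?P w')"
      using \<alpha> \<beta> w p by (auto simp: family_cat_def hom_cat_def homs_iff PiE_iff lt2 intro!: restrict_ext)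
    have eq: "FA ?P \<omega> = ?f \<longleftrightarrow> p1 \<rhd>\<^bsub>T\<^esub> \<omega> = \<alpha> \<and> p2 \<rhd>\<^bsub>T\<^esub> \<omega> = \<beta>" for \<omega>
    proof
      assume "FA ?P \<omega> = ?f"
      from fun_cong[OF this, of 0] fun_cong[OF this, of "Suc 0"]
      show "p1 \<rhd>\<^bsub>T\<^esub> \<omega> = \<alpha> \<and> p2 \<rhd>\<^bsub>T\<^esub> \<omega> = \<beta>" by simp
    next
      assume "p1 \<rhd>\<^bsub>T\<^esub> \<omega> = \<alpha> \<and> p2 \<rhd>\<^bsub>T\<^esub> \<omega> = \<beta>"
      then show "FA ?P \<omega> = ?f" by (auto simp: lt2 intro!: restrict_ext)
    qed
    have "\<exists>!\<omega>. \<omega> \<in> cells2 T w w' \<and> FA ?P \<omega> = ?f"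
      by (rule bij_betw_ex1[OF bij f])
    then show "\<exists>!\<omega>. \<omega> \<in> cells2 T w w' \<and> p1 \<rhd>\<^bsub>T\<^esub> \<omega> = \<alpha> \<and> p2 \<rhd>\<^bsub>T\<^esub> \<omega> = \<beta>"
      unfolding eq .
  }
qed

lemma (in two_one) product_choice_binary_products:
  assumes "product_choice T Q"
  shows "binary_products T Q"
proof -
  have prod: "is_product T 2 (two_family G1 G2) (prd Q G1 G2) (two_family (pr1 Q G1 G2) (pr2 Q G1 G2))"
    if "G1 \<in> Ob U" "G2 \<in> Ob U" for G1 G2
    using assms that unfolding product_choice_def by blast
  show ?thesis
    unfolding binary_products_def
  proof (intro conjI ballI allI impI, goal_cases)
    case (1 G1 G2) then show ?case using is_product_binary(1)[OF prod] by blast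
  next
    case (2 G1 G2) then show ?case using is_product_binary(2)[OF prod] by blast
  next
    case (3 G1 G2) then show ?case using is_product_binary(3)[OF prod] by blast
  next
    case (4 G1 G2) then show ?case using is_product_binary(4)[OF prod] by blast
  next
    case (5 G1 G2) then show ?case using is_product_binary(5)[OF prod] by blast
  qed (use assms in \<open>auto simp: product_choice_def cells2_isos\<close>)
qed

definition swap_prods :: "('g, 'h, 'c) prods \<Rightarrow> ('g, 'h, 'c) prods" where
  "swap_prods Q =
    \<lparr>prd = (\<lambda>G1 G2. prd Q G2 G1), pr1 = (\<lambda>G1 G2. pr2 Q G2 G1), pr2 = (\<lambda>G1 G2. pr1 Q G2 G1),
     prd1 = (\<lambda>u1 u2. prd1 Q u2 u1), psq1 = (\<lambda>u1 u2. psq2 Q u2 u1), psq2 = (\<lambda>u1 u2. psq1 Q u2 u1)\<rparr>"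

lemma binary_productsD:
  assumes "binary_products T Q"
  shows "G1 \<in> Ob (Under T) \<Longrightarrow> G2 \<in> Ob (Under T) \<Longrightarrow> prd Q G1 G2 \<in> Ob (Under T)"
    and "G1 \<in> Ob (Under T) \<Longrightarrow> G2 \<in> Ob (Under T) \<Longrightarrow> pr1 Q G1 G2 \<in> cells1 T (prd Q G1 G2) G1"
    and "G1 \<in> Ob (Under T) \<Longrightarrow> G2 \<in> Ob (Under T) \<Longrightarrow> pr2 Q G1 G2 \<in> cells1 T (prd Q G1 G2) G2"
    and "G1 \<in> Ob (Under T) \<Longrightarrow> G2 \<in> Ob (Under T) \<Longrightarrow> a \<in> cells1 T X G1 \<Longrightarrow> b \<in> cells1 T X G2 \<Longrightarrow>
      \<exists>w \<alpha> \<beta>. w \<in> cells1 T X (prd Q G1 G2) \<and>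
        \<alpha> \<in> cells2 T (pr1 Q G1 G2 \<bullet>\<^bsub>T\<^esub> w) a \<and> \<beta> \<in> cells2 T (pr2 Q G1 G2 \<bullet>\<^bsub>T\<^esub> w) b"
    and "G1 \<in> Ob (Under T) \<Longrightarrow> G2 \<in> Ob (Under T) \<Longrightarrow>
      w \<in> cells1 T X (prd Q G1 G2) \<Longrightarrow> w' \<in> cells1 T X (prd Q G1 G2) \<Longrightarrow>
      \<alpha> \<in> cells2 T (pr1 Q G1 G2 \<bullet>\<^bsub>T\<^esub> w) (pr1 Q G1 G2 \<bullet>\<^bsub>T\<^esub> w') \<Longrightarrow>
      \<beta> \<in> cells2 T (pr2 Q G1 G2 \<bullet>\<^bsub>T\<^esub> w) (pr2 Q G1 G2 \<bullet>\<^bsub>T\<^esub> w') \<Longrightarrow>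
      \<exists>!\<omega>. \<omega> \<in> cells2 T w w' \<and> pr1 Q G1 G2 \<rhd>\<^bsub>T\<^esub> \<omega> = \<alpha> \<and> pr2 Q G1 G2 \<rhd>\<^bsub>T\<^esub> \<omega> = \<beta>"
    and "u1 \<in> cells1 T H1 G1 \<Longrightarrow> u2 \<in> cells1 T H2 G2 \<Longrightarrow>
      prd1 Q u1 u2 \<in> cells1 T (prd Q H1 H2) (prd Q G1 G2)"
    and "u1 \<in> cells1 T H1 G1 \<Longrightarrow> u2 \<in> cells1 T H2 G2 \<Longrightarrow>
      psq1 Q u1 u2 \<in> cells2 T (pr1 Q G1 G2 \<bullet>\<^bsub>T\<^esub> prd1 Q u1 u2) (u1 \<bullet>\<^bsub>T\<^esub> pr1 Q H1 H2)"
    and "u1 \<in> cells1 T H1 G1 \<Longrightarrow> u2 \<in> cells1 T H2 G2 \<Longrightarrow>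
      psq2 Q u1 u2 \<in> cells2 T (pr2 Q G1 G2 \<bullet>\<^bsub>T\<^esub> prd1 Q u1 u2) (u2 \<bullet>\<^bsub>T\<^esub> pr2 Q H1 H2)"
  by (rule assms[unfolded binary_products_def, THEN conjunct1, rule_format, THEN conjunct1]
    assms[unfolded binary_products_def, THEN conjunct1, rule_format, THEN conjunct2, THEN conjunct1]
    assms[unfolded binary_products_def, THEN conjunct1, rule_format, THEN conjunct2,
      THEN conjunct2, THEN conjunct1]
    assms[unfolded binary_products_def, THEN conjunct1, rule_format, THEN conjunct2,
      THEN conjunct2, THEN conjunct2, THEN conjunct1, rule_format]
    assms[unfolded binary_products_def, THEN conjunct1, rule_format, THEN conjunct2,
      THEN conjunct2, THEN conjunct2, THEN conjunct2, rule_format]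
    assms[unfolded binary_products_def, THEN conjunct2, rule_format, THEN conjunct1]
    assms[unfolded binary_products_def, THEN conjunct2, rule_format, THEN conjunct2, THEN conjunct1]
    assms[unfolded binary_products_def, THEN conjunct2, rule_format, THEN conjunct2, THEN conjunct2];
  assumption)+

lemma binary_products_swap:
  assumes Q: "binary_products T Q"
  shows "binary_products T (swap_prods Q)"
  unfolding binary_products_def swap_prods_def prods.simps
proof (intro conjI ballI allI impI, goal_cases)
  case (4 G1 G2 X a b)
  then show ?case using binary_productsD(4)[OF Q, of G2 G1 b X a] by blast
next
  case (5 G1 G2 X w w' \<alpha> \<beta>)
  then show ?case using binary_productsD(5)[OF Q, of G2 G1 w X w' \<beta> \<alpha>] by (simp add: conj_commute)
qed (rule binary_productsD[OF Q]; assumption)+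

text \<open>The diagonal and the graph exist by essential surjectivity of the comparison functors into
  products, and \<open>\<gamma>\<close> by their fullness, with the components that the coherence equations require.\<close>

lemma (in two_one) graph_square_exists:
  assumes Q: "binary_products T Q" and i: "i \<in> cells1 T H G"
  obtains dg gr d1 d2 s1 s2 \<gamma> where
    "graph_square T G H (prd Q G G) (prd Q G H) i (pr1 Q G G) (pr2 Q G G) (pr1 Q G H) (pr2 Q G H)
      (prd1 Q (id1 T G) i) dg gr (psq1 Q (id1 T G) i) (psq2 Q (id1 T G) i) d1 d2 s1 s2 \<gamma>"
proof -
  have ob: "G \<in> Ob U" "H \<in> Ob U" using i by (auto simp: homs_iff)
  have id: "id1 T G \<in> cells1 T G G" "id1 T H \<in> cells1 T H H" using ob by (simp_all add: homs_iff)
  note prj = binary_productsD(2)[OF Q ob(1) ob(1)] binary_productsD(3)[OF Q ob(1) ob(1)]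
    binary_productsD(2)[OF Q ob] binary_productsD(3)[OF Q ob]
  have k: "prd1 Q (id1 T G) i \<in> cells1 T (prd Q G H) (prd Q G G)"
    "psq1 Q (id1 T G) i \<in> cells2 T (pr1 Q G G \<bullet>\<^bsub>T\<^esub> prd1 Q (id1 T G) i) (pr1 Q G H)"
    "psq2 Q (id1 T G) i \<in> cells2 T (pr2 Q G G \<bullet>\<^bsub>T\<^esub> prd1 Q (id1 T G) i) (i \<bullet>\<^bsub>T\<^esub> pr2 Q G H)"
    using binary_productsD(6-8)[OF Q id(1) i] prj ob by (simp_all add: homs_iff)
  obtain dg d1 d2 where dg: "dg \<in> cells1 T G (prd Q G G)"
    "d1 \<in> cells2 T (pr1 Q G G \<bullet>\<^bsub>T\<^esub> dg) (id1 T G)" "d2 \<in> cells2 T (pr2 Q G G \<bullet>\<^bsub>T\<^esub> dg) (id1 T G)"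
    using binary_productsD(4)[OF Q ob(1) ob(1) id(1) id(1)] by blast
  obtain gr s1 s2 where gr: "gr \<in> cells1 T H (prd Q G H)"
    "s1 \<in> cells2 T (pr1 Q G H \<bullet>\<^bsub>T\<^esub> gr) i" "s2 \<in> cells2 T (pr2 Q G H \<bullet>\<^bsub>T\<^esub> gr) (id1 T H)"
    using binary_productsD(4)[OF Q ob i id(2)] by blast
  note ty = i[unfolded homs_iff] prj[unfolded homs_iff] k[unfolded homs_iff]
    dg[unfolded homs_iff] gr[unfolded homs_iff] ob
  let ?k = "prd1 Q (id1 T G) i"
  let ?g1 = "inv2 (d1 \<lhd>\<^bsub>T\<^esub> i) \<diamondop>\<^bsub>T\<^esub> s1 \<diamondop>\<^bsub>T\<^esub> (psq1 Q (id1 T G) i \<lhd>\<^bsub>T\<^esub> gr)"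
  let ?g2 = "inv2 (d2 \<lhd>\<^bsub>T\<^esub> i) \<diamondop>\<^bsub>T\<^esub> (i \<rhd>\<^bsub>T\<^esub> s2) \<diamondop>\<^bsub>T\<^esub> (psq2 Q (id1 T G) i \<lhd>\<^bsub>T\<^esub> gr)"
  obtain \<gamma> where \<gamma>: "\<gamma> \<in> cells2 T (?k \<bullet>\<^bsub>T\<^esub> gr) (dg \<bullet>\<^bsub>T\<^esub> i)"
    and \<gamma>1: "pr1 Q G G \<rhd>\<^bsub>T\<^esub> \<gamma> = ?g1" and \<gamma>2: "pr2 Q G G \<rhd>\<^bsub>T\<^esub> \<gamma> = ?g2"
    using binary_productsD(5)[OF Q ob(1) ob(1), of "?k \<bullet>\<^bsub>T\<^esub> gr" H "dg \<bullet>\<^bsub>T\<^esub> i" ?g1 ?g2] ty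
    by (auto simp: homs_iff)
  have coh: "(d1 \<lhd>\<^bsub>T\<^esub> i) \<diamondop>\<^bsub>T\<^esub> (pr1 Q G G \<rhd>\<^bsub>T\<^esub> \<gamma>) = s1 \<diamondop>\<^bsub>T\<^esub> (psq1 Q (id1 T G) i \<lhd>\<^bsub>T\<^esub> gr)"
    "(d2 \<lhd>\<^bsub>T\<^esub> i) \<diamondop>\<^bsub>T\<^esub> (pr2 Q G G \<rhd>\<^bsub>T\<^esub> \<gamma>) = (i \<rhd>\<^bsub>T\<^esub> s2) \<diamondop>\<^bsub>T\<^esub> (psq2 Q (id1 T G) i \<lhd>\<^bsub>T\<^esub> gr)"
    unfolding \<gamma>1 \<gamma>2 using ty by simp_all
  have whisker: "pr1 Q G K \<rhd>\<^bsub>T\<^esub> \<alpha> \<in> cells2 T (pr1 Q G K \<bullet>\<^bsub>T\<^esub> w) (pr1 Q G K \<bullet>\<^bsub>T\<^esub> w')"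
    "pr2 Q G K \<rhd>\<^bsub>T\<^esub> \<alpha> \<in> cells2 T (pr2 Q G K \<bullet>\<^bsub>T\<^esub> w) (pr2 Q G K \<bullet>\<^bsub>T\<^esub> w')"
    if "K \<in> Ob U" "w \<in> cells1 T X (prd Q G K)" "\<alpha> \<in> cells2 T w w'" for X K w w' \<alpha>
    using that(2,3) binary_productsD(2,3)[OF Q ob(1) that(1)] by (auto simp: homs_iff)
  have faithful: "\<alpha> = \<beta>"
    if "K \<in> Ob U" "w \<in> cells1 T X (prd Q G K)" "w' \<in> cells1 T X (prd Q G K)"
      "\<alpha> \<in> cells2 T w w'" "\<beta> \<in> cells2 T w w'"
      "pr1 Q G K \<rhd>\<^bsub>T\<^esub> \<alpha> = pr1 Q G K \<rhd>\<^bsub>T\<^esub> \<beta>" "pr2 Q G K \<rhd>\<^bsub>T\<^esub> \<alpha> = pr2 Q G K \<rhd>\<^bsub>T\<^esub> \<beta>" for X K w w' \<alpha> \<beta>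
    using binary_productsD(5)[OF Q ob(1) that(1-3) whisker[OF that(1,2,4)]] that(4-) by metis
  have full: "\<exists>\<omega> \<in> cells2 T w w'. pr1 Q G K \<rhd>\<^bsub>T\<^esub> \<omega> = \<alpha> \<and> pr2 Q G K \<rhd>\<^bsub>T\<^esub> \<omega> = \<beta>"
    if "K \<in> Ob U" "w \<in> cells1 T X (prd Q G K)" "w' \<in> cells1 T X (prd Q G K)"
      "\<alpha> \<in> cells2 T (pr1 Q G K \<bullet>\<^bsub>T\<^esub> w) (pr1 Q G K \<bullet>\<^bsub>T\<^esub> w')"
      "\<beta> \<in> cells2 T (pr2 Q G K \<bullet>\<^bsub>T\<^esub> w) (pr2 Q G K \<bullet>\<^bsub>T\<^esub> w')" for X K w w' \<alpha> \<beta>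
    using binary_productsD(5)[OF Q ob(1) that] by blast
  have "graph_square T G H (prd Q G G) (prd Q G H) i (pr1 Q G G) (pr2 Q G G) (pr1 Q G H) (pr2 Q G H)
      ?k dg gr (psq1 Q (id1 T G) i) (psq2 Q (id1 T G) i) d1 d2 s1 s2 \<gamma>"
    by unfold_locales
      (fact i prj k dg gr \<gamma> coh faithful[OF ob(1)] faithful[OF ob(2)] full[OF ob(2)])+
  then show thesis by (rule that)
qed


section \<open>Mackey 2-functors\<close>

locale mackey = two_one T for T :: "('g, 'h, 'c) twocat" +
  fixes R :: "('k, 'r) ring_scheme" and ic :: bool and J :: "'h set"
    and M :: "('k, 'g, 'h, 'c, 'o, 'm) mackey"
  assumes mackey: "mackey_2functor R ic T J M" and J_arr: "J \<subseteq> Arr (Under T)"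
begin

lemma J_Arr [simp]: "j \<in> J \<Longrightarrow> j \<in> Arr U"
  using J_arr by blast

lemma two_functor: "two_functor R ic T M"
  using mackey by (simp add: mackey_2functor_def)

lemma category_MC [simp]: "G \<in> Ob U \<Longrightarrow> category (MC M G)"
proof -
  have "\<forall>G \<in> Ob (Under T). target_object R ic (MC M G)"
    using two_functor unfolding two_functor_def by (elim conjE) assumption
  then show "G \<in> Ob U \<Longrightarrow> category (MC M G)"
    by (simp add: target_object_def additive_category_def linear_category_def)
qed

lemma res_functor:
  assumes "u \<in> Arr U"
  shows "is_functor (MC M (trg T u)) (MC M (src T u)) (Res M u)"
proof -
  have "\<forall>H G u. u \<in> cells1 T H G \<longrightarrow> linear_functor R (MC M G) (MC M H) (Res M u)"
    using two_functor unfolding two_functor_def by (elim conjE) assumption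
  then show ?thesis using assms by (auto simp: linear_functor_def homs_iff)
qed

lemma res [simp]:
  assumes "u \<in> Arr U"
  shows "X \<in> Ob (MC M (trg T u)) \<Longrightarrow> src T u = H \<Longrightarrow> FO (Res M u) X \<in> Ob (MC M H)"
    and "f \<in> Arr (MC M (trg T u)) \<Longrightarrow> src T u = H \<Longrightarrow> FA (Res M u) f \<in> Arr (MC M H)"
    and "f \<in> Arr (MC M (trg T u)) \<Longrightarrow> src T u = H \<Longrightarrow>
      Dom (MC M H) (FA (Res M u) f) = FO (Res M u) (Dom (MC M (trg T u)) f)"
    and "f \<in> Arr (MC M (trg T u)) \<Longrightarrow> src T u = H \<Longrightarrow>
      Cod (MC M H) (FA (Res M u) f) = FO (Res M u) (Cod (MC M (trg T u)) f)"
    and "X \<in> Ob (MC M G) \<Longrightarrow> trg T u = G \<Longrightarrow>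
      FA (Res M u) (Idn (MC M G) X) = Idn (MC M (src T u)) (FO (Res M u) X)"
    and "g \<in> Arr (MC M G) \<Longrightarrow> f \<in> Arr (MC M G) \<Longrightarrow> Dom (MC M G) g = Cod (MC M G) f \<Longrightarrow> trg T u = G \<Longrightarrow>
      FA (Res M u) (g \<cdot>\<^bsub>MC M G\<^esub> f) = FA (Res M u) g \<cdot>\<^bsub>MC M (src T u)\<^esub> FA (Res M u) f"
  using functor_rules[OF res_functor[OF assms]] by auto

lemma res_id1 [simp]:
  shows "G \<in> Ob U \<Longrightarrow> X \<in> Ob (MC M G) \<Longrightarrow> FO (Res M (id1 T G)) X = X"
    and "G \<in> Ob U \<Longrightarrow> f \<in> Arr (MC M G) \<Longrightarrow> FA (Res M (id1 T G)) f = f"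
proof -
  have ax: "\<forall>G \<in> Ob (Under T). (\<forall>X \<in> Ob (MC M G). FO (Res M (id1 T G)) X = X) \<and>
        (\<forall>f \<in> Arr (MC M G). FA (Res M (id1 T G)) f = f)"
    using two_functor unfolding two_functor_def by (elim conjE) assumption
  show "G \<in> Ob U \<Longrightarrow> X \<in> Ob (MC M G) \<Longrightarrow> FO (Res M (id1 T G)) X = X"
    and "G \<in> Ob U \<Longrightarrow> f \<in> Arr (MC M G) \<Longrightarrow> FA (Res M (id1 T G)) f = f"
    using ax by blast+
qed

lemma res_comp1 [simp]:
  assumes "u \<in> Arr U" "v \<in> Arr U" "src T u = trg T v"
  shows "X \<in> Ob (MC M (trg T u)) \<Longrightarrow> FO (Res M (u \<bullet>\<^bsub>T\<^esub> v)) X = FO (Res M v) (FO (Res M u) X)"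
    and "f \<in> Arr (MC M (trg T u)) \<Longrightarrow> FA (Res M (u \<bullet>\<^bsub>T\<^esub> v)) f = FA (Res M v) (FA (Res M u) f)"
proof -
  have ax: "\<forall>K H G v u. v \<in> cells1 T K H \<longrightarrow> u \<in> cells1 T H G \<longrightarrow>
        (\<forall>X \<in> Ob (MC M G). FO (Res M (u \<bullet>\<^bsub>T\<^esub> v)) X = FO (Res M v) (FO (Res M u) X)) \<and>
        (\<forall>f \<in> Arr (MC M G). FA (Res M (u \<bullet>\<^bsub>T\<^esub> v)) f = FA (Res M v) (FA (Res M u) f))"
    using two_functor unfolding two_functor_def by (elim conjE) assumption
  show "X \<in> Ob (MC M (trg T u)) \<Longrightarrow> FO (Res M (u \<bullet>\<^bsub>T\<^esub> v)) X = FO (Res M v) (FO (Res M u) X)"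
    and "f \<in> Arr (MC M (trg T u)) \<Longrightarrow> FA (Res M (u \<bullet>\<^bsub>T\<^esub> v)) f = FA (Res M v) (FA (Res M u) f)"
    using ax assms by (simp_all add: homs_iff)
qed

lemma res2_nat_trans:
  "\<forall>u u' \<alpha>. \<alpha> \<in> cells2 T u u' \<longrightarrow>
    nat_trans (MC M (trg T u)) (MC M (src T u)) (Res M u) (Res M u') (Res2 M \<alpha>)"
  using two_functor unfolding two_functor_def by (elim conjE) assumption

lemma res2 [simp]:
  assumes "\<alpha> \<in> Arr V" "X \<in> Ob (MC M (trg T (Dom V \<alpha>)))" "src T (Dom V \<alpha>) = H"
  shows "Res2 M \<alpha> X \<in> Arr (MC M H)"
    and "Dom (MC M H) (Res2 M \<alpha> X) = FO (Res M (Dom V \<alpha>)) X"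
    and "Cod (MC M H) (Res2 M \<alpha> X) = FO (Res M (Cod V \<alpha>)) X"
  using res2_nat_trans assms by (auto simp: nat_trans_def homs_iff)

lemma res2_natural:
  assumes "\<alpha> \<in> Arr V" "f \<in> Arr (MC M (trg T (Dom V \<alpha>)))" "src T (Dom V \<alpha>) = H"
    "Dom (MC M (trg T (Dom V \<alpha>))) f = X" "Cod (MC M (trg T (Dom V \<alpha>))) f = X'"
    "Dom V \<alpha> = u" "Cod V \<alpha> = u'"
  shows "Res2 M \<alpha> X' \<cdot>\<^bsub>MC M H\<^esub> FA (Res M u) f = FA (Res M u') f \<cdot>\<^bsub>MC M H\<^esub> Res2 M \<alpha> X"
  using res2_nat_trans assms by (auto simp: nat_trans_def homs_iff)

lemma res2_id2 [simp]:
  assumes "u \<in> Arr U" "X \<in> Ob (MC M (trg T u))"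
  shows "Res2 M (id2 T u) X = Idn (MC M (src T u)) (FO (Res M u) X)"
proof -
  have ax: "\<forall>H G u. u \<in> cells1 T H G \<longrightarrow>
        (\<forall>X \<in> Ob (MC M G). Res2 M (id2 T u) X = Idn (MC M H) (FO (Res M u) X))"
    using two_functor unfolding two_functor_def by (elim conjE) assumption
  show ?thesis using ax assms by (simp add: homs_iff)
qed

lemma res2_vcomp:
  assumes "\<alpha> \<in> Arr V" "\<beta> \<in> Arr V" "Dom V \<beta> = Cod V \<alpha>" "X \<in> Ob (MC M (trg T (Dom V \<alpha>)))"
  shows "Res2 M (\<beta> \<diamondop>\<^bsub>T\<^esub> \<alpha>) X = Res2 M \<beta> X \<cdot>\<^bsub>MC M (src T (Dom V \<alpha>))\<^esub> Res2 M \<alpha> X"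
proof -
  have ax: "\<forall>u u' u'' \<alpha> \<beta>. \<alpha> \<in> cells2 T u u' \<longrightarrow> \<beta> \<in> cells2 T u' u'' \<longrightarrow>
        (\<forall>X \<in> Ob (MC M (trg T u)).
          Res2 M (\<beta> \<diamondop>\<^bsub>T\<^esub> \<alpha>) X = Res2 M \<beta> X \<cdot>\<^bsub>MC M (src T u)\<^esub> Res2 M \<alpha> X)"
    using two_functor unfolding two_functor_def by (elim conjE) assumption
  show ?thesis using ax assms by (simp add: homs_iff)
qed

lemma res2_hcomp:
  assumes "\<alpha> \<in> Arr V" "\<beta> \<in> Arr V" "trg T (Dom V \<beta>) = src T (Dom V \<alpha>)"
    "X \<in> Ob (MC M (trg T (Dom V \<alpha>)))"
  shows "Res2 M (\<alpha> \<star>\<^bsub>T\<^esub> \<beta>) X = Res2 M \<beta> (FO (Res M (Cod V \<alpha>)) X)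
    \<cdot>\<^bsub>MC M (src T (Dom V \<beta>))\<^esub> FA (Res M (Dom V \<beta>)) (Res2 M \<alpha> X)"
proof -
  have ax: "\<forall>u u' v v' \<alpha> \<beta>. \<alpha> \<in> cells2 T u u' \<longrightarrow> \<beta> \<in> cells2 T v v' \<longrightarrow> trg T v = src T u \<longrightarrow>
        (\<forall>X \<in> Ob (MC M (trg T u)).
          Res2 M (\<alpha> \<star>\<^bsub>T\<^esub> \<beta>) X
            = Res2 M \<beta> (FO (Res M u') X) \<cdot>\<^bsub>MC M (src T v)\<^esub> FA (Res M v) (Res2 M \<alpha> X))"
    using two_functor unfolding two_functor_def by (elim conjE) assumption
  show ?thesis using ax assms by (simp add: homs_iff)
qed

lemma res2_whisker:
  shows "\<beta> \<in> Arr V \<Longrightarrow> w \<in> Arr U \<Longrightarrow> src T w = trg T (Dom V \<beta>) \<Longrightarrow> X \<in> Ob (MC M (trg T w)) \<Longrightarrow>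
      Res2 M (w \<rhd>\<^bsub>T\<^esub> \<beta>) X = Res2 M \<beta> (FO (Res M w) X)"
    and "\<alpha> \<in> Arr V \<Longrightarrow> v \<in> Arr U \<Longrightarrow> trg T v = src T (Dom V \<alpha>) \<Longrightarrow> X \<in> Ob (MC M (trg T (Dom V \<alpha>))) \<Longrightarrow>
      Res2 M (\<alpha> \<lhd>\<^bsub>T\<^esub> v) X = FA (Res M v) (Res2 M \<alpha> X)"
  by (simp_all add: res2_hcomp cat_simps)

lemma res2_inverse:
  assumes "\<alpha> \<in> Arr V" "X \<in> Ob (MC M (trg T (Dom V \<alpha>)))" "src T (Dom V \<alpha>) = H"
  shows "mutually_inverse (MC M H) (FO (Res M (Dom V \<alpha>)) X) (FO (Res M (Cod V \<alpha>)) X)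
    (Res2 M \<alpha> X) (Res2 M (inv2 \<alpha>) X)"
  using assms res2_vcomp[of \<alpha> "inv2 \<alpha>" X] res2_vcomp[of "inv2 \<alpha>" \<alpha> X]
  by (intro mutually_inverseI) auto

lemma adjunctions:
  assumes "j \<in> J"
  shows "adjunction (MC M (src T j)) (MC M (trg T j)) (Ind M j) (Res M j) (lunit M j) (lcounit M j)"
    and "adjunction (MC M (trg T j)) (MC M (src T j)) (Res M j) (Ind M j) (runit M j) (rcounit M j)"
    and "Y \<in> Ob (MC M (src T j)) \<Longrightarrow> rcounit M j Y \<cdot>\<^bsub>MC M (src T j)\<^esub> lunit M j Y = Idn (MC M (src T j)) Y"
proof -
  have ax: "\<forall>H G i. i \<in> J \<longrightarrow> i \<in> cells1 T H G \<longrightarrow>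
        linear_functor R (MC M H) (MC M G) (Ind M i) \<and>
        adjunction (MC M H) (MC M G) (Ind M i) (Res M i) (lunit M i) (lcounit M i) \<and>
        adjunction (MC M G) (MC M H) (Res M i) (Ind M i) (runit M i) (rcounit M i) \<and>
        (\<forall>Y \<in> Ob (MC M H). rcounit M i Y \<cdot>\<^bsub>MC M H\<^esub> lunit M i Y = Idn (MC M H) Y)"
    using mackey unfolding mackey_2functor_def by (elim conjE) assumption
  show "adjunction (MC M (src T j)) (MC M (trg T j)) (Ind M j) (Res M j) (lunit M j) (lcounit M j)"
    and "adjunction (MC M (trg T j)) (MC M (src T j)) (Res M j) (Ind M j) (runit M j) (rcounit M j)"
    and "Y \<in> Ob (MC M (src T j)) \<Longrightarrow> rcounit M j Y \<cdot>\<^bsub>MC M (src T j)\<^esub> lunit M j Y = Idn (MC M (src T j)) Y"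
    using ax assms by (auto simp: homs_iff)
qed

lemma ind_functor: "j \<in> J \<Longrightarrow> is_functor (MC M (src T j)) (MC M (trg T j)) (Ind M j)"
  using adjunctions by (auto simp: adjunction_def)

lemma ind [simp]:
  assumes "j \<in> J"
  shows "X \<in> Ob (MC M (src T j)) \<Longrightarrow> trg T j = H \<Longrightarrow> FO (Ind M j) X \<in> Ob (MC M H)"
    and "f \<in> Arr (MC M (src T j)) \<Longrightarrow> trg T j = H \<Longrightarrow> FA (Ind M j) f \<in> Arr (MC M H)"
    and "f \<in> Arr (MC M (src T j)) \<Longrightarrow> trg T j = H \<Longrightarrow>
      Dom (MC M H) (FA (Ind M j) f) = FO (Ind M j) (Dom (MC M (src T j)) f)"
    and "f \<in> Arr (MC M (src T j)) \<Longrightarrow> trg T j = H \<Longrightarrow>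
      Cod (MC M H) (FA (Ind M j) f) = FO (Ind M j) (Cod (MC M (src T j)) f)"
    and "X \<in> Ob (MC M G) \<Longrightarrow> src T j = G \<Longrightarrow>
      FA (Ind M j) (Idn (MC M G) X) = Idn (MC M (trg T j)) (FO (Ind M j) X)"
    and "g \<in> Arr (MC M G) \<Longrightarrow> f \<in> Arr (MC M G) \<Longrightarrow> Dom (MC M G) g = Cod (MC M G) f \<Longrightarrow> src T j = G \<Longrightarrow>
      FA (Ind M j) (g \<cdot>\<^bsub>MC M G\<^esub> f) = FA (Ind M j) g \<cdot>\<^bsub>MC M (trg T j)\<^esub> FA (Ind M j) f"
  using functor_rules[OF ind_functor[OF assms]] by auto

lemma units [simp]:
  assumes "j \<in> J"
  shows "Y \<in> Ob (MC M (src T j)) \<Longrightarrow> src T j = H \<Longrightarrow> lunit M j Y \<in> Arr (MC M H)"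
    and "Y \<in> Ob (MC M (src T j)) \<Longrightarrow> src T j = H \<Longrightarrow> Dom (MC M H) (lunit M j Y) = Y"
    and "Y \<in> Ob (MC M (src T j)) \<Longrightarrow> src T j = H \<Longrightarrow>
      Cod (MC M H) (lunit M j Y) = FO (Res M j) (FO (Ind M j) Y)"
    and "Y \<in> Ob (MC M (src T j)) \<Longrightarrow> src T j = H \<Longrightarrow> rcounit M j Y \<in> Arr (MC M H)"
    and "Y \<in> Ob (MC M (src T j)) \<Longrightarrow> src T j = H \<Longrightarrow>
      Dom (MC M H) (rcounit M j Y) = FO (Res M j) (FO (Ind M j) Y)"
    and "Y \<in> Ob (MC M (src T j)) \<Longrightarrow> src T j = H \<Longrightarrow> Cod (MC M H) (rcounit M j Y) = Y"
    and "X \<in> Ob (MC M (trg T j)) \<Longrightarrow> trg T j = G \<Longrightarrow> runit M j X \<in> Arr (MC M G)"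
    and "X \<in> Ob (MC M (trg T j)) \<Longrightarrow> trg T j = G \<Longrightarrow> Dom (MC M G) (runit M j X) = X"
    and "X \<in> Ob (MC M (trg T j)) \<Longrightarrow> trg T j = G \<Longrightarrow>
      Cod (MC M G) (runit M j X) = FO (Ind M j) (FO (Res M j) X)"
    and "X \<in> Ob (MC M (trg T j)) \<Longrightarrow> trg T j = G \<Longrightarrow> lcounit M j X \<in> Arr (MC M G)"
    and "X \<in> Ob (MC M (trg T j)) \<Longrightarrow> trg T j = G \<Longrightarrow>
      Dom (MC M G) (lcounit M j X) = FO (Ind M j) (FO (Res M j) X)"
    and "X \<in> Ob (MC M (trg T j)) \<Longrightarrow> trg T j = G \<Longrightarrow> Cod (MC M G) (lcounit M j X) = X"
  using adjunctions(1,2)[OF assms]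
  by (auto simp: adjunction_def nat_trans_def homs_iff id_ftr_def comp_ftr_def)

lemma units_natural:
  assumes "j \<in> J"
  shows "f \<in> homs (MC M (src T j)) Y Y' \<Longrightarrow> src T j = H \<Longrightarrow>
      lunit M j Y' \<cdot>\<^bsub>MC M H\<^esub> f = FA (Res M j) (FA (Ind M j) f) \<cdot>\<^bsub>MC M H\<^esub> lunit M j Y"
    and "f \<in> homs (MC M (src T j)) Y Y' \<Longrightarrow> src T j = H \<Longrightarrow>
      rcounit M j Y' \<cdot>\<^bsub>MC M H\<^esub> FA (Res M j) (FA (Ind M j) f) = f \<cdot>\<^bsub>MC M H\<^esub> rcounit M j Y"
    and "g \<in> homs (MC M (trg T j)) X X' \<Longrightarrow> trg T j = G \<Longrightarrow>
      runit M j X' \<cdot>\<^bsub>MC M G\<^esub> g = FA (Ind M j) (FA (Res M j) g) \<cdot>\<^bsub>MC M G\<^esub> runit M j X"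
    and "g \<in> homs (MC M (trg T j)) X X' \<Longrightarrow> trg T j = G \<Longrightarrow>
      lcounit M j X' \<cdot>\<^bsub>MC M G\<^esub> FA (Ind M j) (FA (Res M j) g) = g \<cdot>\<^bsub>MC M G\<^esub> lcounit M j X"
  using adjunctions(1,2)[OF assms]
  by (simp_all add: adjunction_def nat_trans_def id_ftr_def comp_ftr_def)

lemma triangles:
  assumes "j \<in> J"
  shows "X \<in> Ob (MC M (trg T j)) \<Longrightarrow> src T j = H \<Longrightarrow>
      rcounit M j (FO (Res M j) X) \<cdot>\<^bsub>MC M H\<^esub> FA (Res M j) (runit M j X) = Idn (MC M H) (FO (Res M j) X)"
    and "X \<in> Ob (MC M (trg T j)) \<Longrightarrow> src T j = H \<Longrightarrow>
      FA (Res M j) (lcounit M j X) \<cdot>\<^bsub>MC M H\<^esub> lunit M j (FO (Res M j) X) = Idn (MC M H) (FO (Res M j) X)"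
  using adjunctions(1,2)[OF assms] by (auto simp: adjunction_def)

text \<open>
  Mates paste. The map \<open>k\<^sub>* f \<circ> \<eta>: A \<rightarrow> k\<^sub>* Z\<close> is the transpose of \<open>f: k\<^sup>* A \<rightarrow> Z\<close>; its restriction
  along \<open>u\<close> followed by base change is again a transpose, namely of \<open>p\<^sup>* f\<close> precomposed with the
  inverse of the 2-cell of the square. The right mate of a bimorphism is of the form \<open>k\<^sub>* f \<circ> \<eta>\<close>.
\<close>

lemma right_mate_transpose:
  assumes J: "k \<in> J" "q \<in> J"
    and sq: "k \<in> cells1 T S P" "u \<in> cells1 T K P" "p \<in> cells1 T D S" "q \<in> cells1 T D K"
      "\<gamma> \<in> cells2 T (k \<bullet>\<^bsub>T\<^esub> p) (u \<bullet>\<^bsub>T\<^esub> q)"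
    and ob: "A \<in> Ob (MC M P)" "Z \<in> Ob (MC M S)" and f: "f \<in> homs (MC M S) (FO (Res M k) A) Z"
  shows "right_mate T M k u p q \<gamma> Z \<cdot>\<^bsub>MC M K\<^esub> FA (Res M u) (FA (Ind M k) f \<cdot>\<^bsub>MC M P\<^esub> runit M k A)
    = FA (Ind M q) (FA (Res M p) f \<cdot>\<^bsub>MC M D\<^esub> Res2 M (inv2 \<gamma>) A) \<cdot>\<^bsub>MC M K\<^esub> runit M q (FO (Res M u) A)"
proof -
  note [simp] = J sq[unfolded homs_iff] ob f[unfolded homs_iff]
  have [simp]: "S \<in> Ob U" "P \<in> Ob U" "K \<in> Ob U" "D \<in> Ob U"
    using sq unfolding homs_iff by (metis cat_dom_ob cat_cod_ob category_U)+
  define e where "e = FA (Ind M k) f \<cdot>\<^bsub>MC M P\<^esub> runit M k A"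
  have e [simp]: "e \<in> Arr (MC M P)" "Dom (MC M P) e = A" "Cod (MC M P) e = FO (Ind M k) Z"
    by (simp_all add: e_def cat_simps)
  have 1: "runit M q (FO (Res M u) (FO (Ind M k) Z)) \<cdot>\<^bsub>MC M K\<^esub> FA (Res M u) e
      = FA (Ind M q) (FA (Res M q) (FA (Res M u) e)) \<cdot>\<^bsub>MC M K\<^esub> runit M q (FO (Res M u) A)"
    by (rule units_natural(3)) (simp_all add: homs_iff)
  have 2: "Res2 M (inv2 \<gamma>) (FO (Ind M k) Z) \<cdot>\<^bsub>MC M D\<^esub> FA (Res M q) (FA (Res M u) e)
      = FA (Res M p) (FA (Res M k) e) \<cdot>\<^bsub>MC M D\<^esub> Res2 M (inv2 \<gamma>) A"
    using res2_natural[of "inv2 \<gamma>" e D A "FO (Ind M k) Z" "u \<bullet>\<^bsub>T\<^esub> q" "k \<bullet>\<^bsub>T\<^esub> p"] by simp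
  have "rcounit M k Z \<cdot>\<^bsub>MC M S\<^esub> FA (Res M k) e
      = (rcounit M k Z \<cdot>\<^bsub>MC M S\<^esub> FA (Res M k) (FA (Ind M k) f)) \<cdot>\<^bsub>MC M S\<^esub> FA (Res M k) (runit M k A)"
    by (simp add: e_def cat_simps)
  also have "\<dots> = f"
    by (subst units_natural(2)[of k f "FO (Res M k) A" Z]) (simp_all add: homs_iff cat_simps triangles)
  finally have 3: "rcounit M k Z \<cdot>\<^bsub>MC M S\<^esub> FA (Res M k) e = f" .
  have res_3: "FA (Res M p) (rcounit M k Z) \<cdot>\<^bsub>MC M D\<^esub> FA (Res M p) (FA (Res M k) e) = FA (Res M p) f"
    using arg_cong[OF 3, of "FA (Res M p)"] by simp
  have "right_mate T M k u p q \<gamma> Z \<cdot>\<^bsub>MC M K\<^esub> FA (Res M u) e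
      = FA (Ind M q) (FA (Res M p) (rcounit M k Z) \<cdot>\<^bsub>MC M D\<^esub> Res2 M (inv2 \<gamma>) (FO (Ind M k) Z)
          \<cdot>\<^bsub>MC M D\<^esub> FA (Res M q) (FA (Res M u) e)) \<cdot>\<^bsub>MC M K\<^esub> runit M q (FO (Res M u) A)"
    by (simp add: right_mate_def Let_def cat_simps 1)
  also have "\<dots> = FA (Ind M q) (FA (Res M p) f \<cdot>\<^bsub>MC M D\<^esub> Res2 M (inv2 \<gamma>) A) \<cdot>\<^bsub>MC M K\<^esub> runit M q (FO (Res M u) A)"
    by (simp only: 2) (simp add: cat_prefix[OF res_3])
  finally show ?thesis by (simp add: e_def)
qed

text \<open>The same for left adjoints, with all arrows reversed.\<close>

lemma left_mate_transpose:
  assumes J: "k \<in> J" "q \<in> J"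
    and sq: "k \<in> cells1 T S P" "u \<in> cells1 T K P" "p \<in> cells1 T D S" "q \<in> cells1 T D K"
      "\<gamma> \<in> cells2 T (k \<bullet>\<^bsub>T\<^esub> p) (u \<bullet>\<^bsub>T\<^esub> q)"
    and ob: "A \<in> Ob (MC M P)" "Z \<in> Ob (MC M S)" and f: "f \<in> homs (MC M S) Z (FO (Res M k) A)"
  shows "FA (Res M u) (lcounit M k A \<cdot>\<^bsub>MC M P\<^esub> FA (Ind M k) f) \<cdot>\<^bsub>MC M K\<^esub> left_mate T M k u p q \<gamma> Z
    = lcounit M q (FO (Res M u) A) \<cdot>\<^bsub>MC M K\<^esub> FA (Ind M q) (Res2 M \<gamma> A \<cdot>\<^bsub>MC M D\<^esub> FA (Res M p) f)"
proof -
  note [simp] = J sq[unfolded homs_iff] ob f[unfolded homs_iff]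
  have [simp]: "S \<in> Ob U" "P \<in> Ob U" "K \<in> Ob U" "D \<in> Ob U"
    using sq unfolding homs_iff by (metis cat_dom_ob cat_cod_ob category_U)+
  define e where "e = lcounit M k A \<cdot>\<^bsub>MC M P\<^esub> FA (Ind M k) f"
  have e [simp]: "e \<in> Arr (MC M P)" "Cod (MC M P) e = A" "Dom (MC M P) e = FO (Ind M k) Z"
    by (simp_all add: e_def cat_simps)
  have 1: "FA (Res M u) e \<cdot>\<^bsub>MC M K\<^esub> lcounit M q (FO (Res M u) (FO (Ind M k) Z))
      = lcounit M q (FO (Res M u) A) \<cdot>\<^bsub>MC M K\<^esub> FA (Ind M q) (FA (Res M q) (FA (Res M u) e))"
    by (rule units_natural(4)[symmetric]) (simp_all add: homs_iff)
  have 2: "FA (Res M q) (FA (Res M u) e) \<cdot>\<^bsub>MC M D\<^esub> Res2 M \<gamma> (FO (Ind M k) Z)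
      = Res2 M \<gamma> A \<cdot>\<^bsub>MC M D\<^esub> FA (Res M p) (FA (Res M k) e)"
    using res2_natural[of "\<gamma>" e D "FO (Ind M k) Z" A "k \<bullet>\<^bsub>T\<^esub> p" "u \<bullet>\<^bsub>T\<^esub> q"] by simp
  have "FA (Res M k) e \<cdot>\<^bsub>MC M S\<^esub> lunit M k Z
      = FA (Res M k) (lcounit M k A) \<cdot>\<^bsub>MC M S\<^esub> FA (Res M k) (FA (Ind M k) f) \<cdot>\<^bsub>MC M S\<^esub> lunit M k Z"
    by (simp add: e_def cat_simps)
  also have "\<dots> = FA (Res M k) (lcounit M k A) \<cdot>\<^bsub>MC M S\<^esub> lunit M k (FO (Res M k) A) \<cdot>\<^bsub>MC M S\<^esub> f"
    by (subst units_natural(1)[of k f Z "FO (Res M k) A"]) (simp_all add: homs_iff)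
  also have "\<dots> = f"
    by (subst cat_prefix[OF triangles(2)]) (simp_all add: cat_simps)
  finally have 3: "FA (Res M k) e \<cdot>\<^bsub>MC M S\<^esub> lunit M k Z = f" .
  have res_3: "FA (Res M p) (FA (Res M k) e) \<cdot>\<^bsub>MC M D\<^esub> FA (Res M p) (lunit M k Z) = FA (Res M p) f"
    using arg_cong[OF 3, of "FA (Res M p)"] by simp
  have "FA (Res M u) e \<cdot>\<^bsub>MC M K\<^esub> left_mate T M k u p q \<gamma> Z
      = lcounit M q (FO (Res M u) A) \<cdot>\<^bsub>MC M K\<^esub> FA (Ind M q) ((FA (Res M q) (FA (Res M u) e)
          \<cdot>\<^bsub>MC M D\<^esub> Res2 M \<gamma> (FO (Ind M k) Z)) \<cdot>\<^bsub>MC M D\<^esub> FA (Res M p) (lunit M k Z))"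
    by (simp add: left_mate_def Let_def cat_simps cat_prefix[OF 1])
  also have "\<dots> = lcounit M q (FO (Res M u) A) \<cdot>\<^bsub>MC M K\<^esub> FA (Ind M q) (Res2 M \<gamma> A \<cdot>\<^bsub>MC M D\<^esub> FA (Res M p) f)"
    by (simp only: 2) (simp add: cat_assoc res_3)
  finally show ?thesis by (simp add: e_def)
qed

text \<open>
  The bimorphism property involves \<open>1\<^sub>* X\<close> instead of \<open>X\<close>. To remove \<open>1\<^sub>*\<close>, the right mate uses the
  counit \<open>1\<^sub>* X \<rightarrow> X\<close> of the right adjunction and the left mate the unit \<open>X \<rightarrow> 1\<^sub>! X\<close> of the left one.
  Rectification of the unit constraints makes them inverse to each other: as \<open>1\<^sup>*\<close> is the identity,
  the triangle identities identify them with the inverses of \<open>runit\<close> and \<open>lcounit\<close>.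
\<close>

lemma identity_counit_unit:
  assumes "G \<in> Ob U" "id1 T G \<in> J" "X \<in> Ob (MC M G)"
  shows "mutually_inverse (MC M G) (FO (Ind M (id1 T G)) X) X (rcounit M (id1 T G) X) (lunit M (id1 T G) X)"
proof -
  note [simp] = assms
  have ax: "\<forall>G \<in> Ob (Under T). \<forall>X \<in> Ob (MC M G).
        mutually_inverse (MC M G) (FO (Ind M (id1 T G)) X) X
          (lcounit M (id1 T G) X) (runit M (id1 T G) X)"
    using mackey unfolding mackey_2functor_def by (elim conjE) assumption
  then have ax': "mutually_inverse (MC M G) (FO (Ind M (id1 T G)) X) X (lcounit M (id1 T G) X) (runit M (id1 T G) X)"
    by simp
  note ax'' = mutually_inverse_arrD[OF ax']
  have "runit M (id1 T G) X = lunit M (id1 T G) X"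
    by (rule mutually_inverse_cancel_left[OF _ ax']) (use ax'' triangles(2)[of "id1 T G" X G] in simp_all)
  moreover have "rcounit M (id1 T G) X = lcounit M (id1 T G) X"
    by (rule mutually_inverse_cancel_right[OF _ mutually_inverse_sym[OF ax']])
      (use ax'' triangles(1)[of "id1 T G" X G] in simp_all)
  ultimately show ?thesis using ax' by simp
qed

end


section \<open>Pairings\<close>

locale mackey_pairing = two_one T +
    M: mackey T R ic J M + N: mackey T R ic J N + L: mackey T R ic J L
  for T :: "('g, 'h, 'c) twocat" and R :: "('k, 'r) ring_scheme" and ic :: bool and J :: "'h set"
    and M :: "('k, 'g, 'h, 'c, 'o1, 'm1) mackey" and N :: "('k, 'g, 'h, 'c, 'o2, 'm2) mackey"
    and L :: "('k, 'g, 'h, 'c, 'o3, 'm3) mackey" +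
  fixes B :: "('g, 'h, 'o1, 'm1, 'o2, 'm2, 'o3, 'm3) pairing"
  assumes pairing: "is_pairing R T M N L B"
begin

lemma pairing_functor:
  assumes "G \<in> Ob U"
  shows "is_functor (prod_cat (MC M G) (MC N G)) (MC L G)
    \<lparr>FO = (\<lambda>(X, Y). pobj B G X Y), FA = (\<lambda>(f, g). parr B G f g)\<rparr>"
proof -
  have "\<forall>G \<in> Ob U. bilinear_functor R (MC M G) (MC N G) (MC L G) (pobj B G) (parr B G)"
    using pairing unfolding is_pairing_def by (elim conjE) assumption
  then show ?thesis using assms by (simp add: bilinear_functor_def)
qed

lemma pobj [simp]:
  "G \<in> Ob U \<Longrightarrow> X \<in> Ob (MC M G) \<Longrightarrow> Y \<in> Ob (MC N G) \<Longrightarrow> pobj B G X Y \<in> Ob (MC L G)"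
  using pairing_functor by (force simp: is_functor_def prod_cat_def)

lemma parr [simp]:
  assumes "G \<in> Ob U" "f \<in> Arr (MC M G)" "g \<in> Arr (MC N G)"
  shows "parr B G f g \<in> Arr (MC L G)"
    and "Dom (MC L G) (parr B G f g) = pobj B G (Dom (MC M G) f) (Dom (MC N G) g)"
    and "Cod (MC L G) (parr B G f g) = pobj B G (Cod (MC M G) f) (Cod (MC N G) g)"
proof -
  note F = functor_rules(2-4)[OF pairing_functor[OF assms(1)], of "(f, g)"]
  show "parr B G f g \<in> Arr (MC L G)"
    "Dom (MC L G) (parr B G f g) = pobj B G (Dom (MC M G) f) (Dom (MC N G) g)"
    "Cod (MC L G) (parr B G f g) = pobj B G (Cod (MC M G) f) (Cod (MC N G) g)"
    using F assms by (auto simp: prod_cat_def)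
qed

lemma parr_id [simp]:
  assumes "G \<in> Ob U" "X \<in> Ob (MC M G)" "Y \<in> Ob (MC N G)"
  shows "parr B G (Idn (MC M G) X) (Idn (MC N G) Y) = Idn (MC L G) (pobj B G X Y)"
  using functor_rules(5)[OF pairing_functor[OF assms(1)], of "(X, Y)"] assms
  by (simp add: prod_cat_def)

lemma parr_comp:
  assumes "G \<in> Ob U" "f \<in> Arr (MC M G)" "g \<in> Arr (MC N G)" "f' \<in> Arr (MC M G)" "g' \<in> Arr (MC N G)"
    "Dom (MC M G) f' = Cod (MC M G) f" "Dom (MC N G) g' = Cod (MC N G) g"
  shows "parr B G f' g' \<cdot>\<^bsub>MC L G\<^esub> parr B G f g = parr B G (f' \<cdot>\<^bsub>MC M G\<^esub> f) (g' \<cdot>\<^bsub>MC N G\<^esub> g)"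
  using functor_rules(6)[OF pairing_functor[OF assms(1)], of "(f', g')" "(f, g)"] assms
  by (simp add: prod_cat_def)

lemma parr_inverse:
  assumes "G \<in> Ob U" "mutually_inverse (MC M G) X X' f f'" "mutually_inverse (MC N G) Y Y' g g'"
  shows "mutually_inverse (MC L G) (pobj B G X Y) (pobj B G X' Y') (parr B G f g) (parr B G f' g')"
proof -
  note f = mutually_inverse_arrD[OF assms(2)] and g = mutually_inverse_arrD[OF assms(3)]
  have "X \<in> Ob (MC M G)" "X' \<in> Ob (MC M G)" "Y \<in> Ob (MC N G)" "Y' \<in> Ob (MC N G)"
    using f g assms(1) M.category_MC N.category_MC by (metis cat_dom_ob)+
  then show ?thesis
    using assms(1) f g by (intro mutually_inverseI) (simp_all add: parr_comp)
qed

lemma pres_iso_natural: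
  "\<forall>H G u. u \<in> cells1 T H G \<longrightarrow>
      (\<forall>X \<in> Ob (MC M G). \<forall>Y \<in> Ob (MC N G).
        pres B u X Y \<in> isos (MC L H) (FO (Res L u) (pobj B G X Y))
          (pobj B H (FO (Res M u) X) (FO (Res N u) Y))) \<and>
      (\<forall>X X' Y Y' f g. f \<in> homs (MC M G) X X' \<longrightarrow> g \<in> homs (MC N G) Y Y' \<longrightarrow>
        pres B u X' Y' \<cdot>\<^bsub>MC L H\<^esub> FA (Res L u) (parr B G f g)
          = parr B H (FA (Res M u) f) (FA (Res N u) g) \<cdot>\<^bsub>MC L H\<^esub> pres B u X Y)"
  using pairing unfolding is_pairing_def by (elim conjE) assumption

lemma pres_inverse:
  assumes "u \<in> Arr U" "X \<in> Ob (MC M (trg T u))" "Y \<in> Ob (MC N (trg T u))"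
  shows "mutually_inverse (MC L (src T u)) (FO (Res L u) (pobj B (trg T u) X Y))
    (pobj B (src T u) (FO (Res M u) X) (FO (Res N u) Y))
    (pres B u X Y) (inv_arr (MC L (src T u)) (pres B u X Y))"
  by (rule inv_arr_iso) (use pres_iso_natural assms in \<open>simp_all add: homs_iff\<close>)

lemma pres [simp]:
  assumes "u \<in> Arr U" "X \<in> Ob (MC M (trg T u))" "Y \<in> Ob (MC N (trg T u))" "src T u = H"
  shows "pres B u X Y \<in> Arr (MC L H)"
    and "Dom (MC L H) (pres B u X Y) = FO (Res L u) (pobj B (trg T u) X Y)"
    and "Cod (MC L H) (pres B u X Y) = pobj B H (FO (Res M u) X) (FO (Res N u) Y)"
  using mutually_inverse_arrD[OF pres_inverse[OF assms(1-3)]] assms(4) by auto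

lemma pres_natural:
  assumes "u \<in> Arr U" "src T u = H" "trg T u = G"
    "f \<in> Arr (MC M G)" "Dom (MC M G) f = X" "Cod (MC M G) f = X'"
    "g \<in> Arr (MC N G)" "Dom (MC N G) g = Y" "Cod (MC N G) g = Y'"
  shows "pres B u X' Y' \<cdot>\<^bsub>MC L H\<^esub> FA (Res L u) (parr B G f g)
    = parr B H (FA (Res M u) f) (FA (Res N u) g) \<cdot>\<^bsub>MC L H\<^esub> pres B u X Y"
  by (rule pres_iso_natural[rule_format, THEN conjunct2, rule_format])
    (use assms in \<open>simp_all add: homs_iff\<close>)

lemma pres_comp1:
  assumes "u \<in> Arr U" "v \<in> Arr U" "src T u = trg T v"
    "X \<in> Ob (MC M (trg T u))" "Y \<in> Ob (MC N (trg T u))"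
  shows "pres B (u \<bullet>\<^bsub>T\<^esub> v) X Y
    = pres B v (FO (Res M u) X) (FO (Res N u) Y) \<cdot>\<^bsub>MC L (src T v)\<^esub> FA (Res L v) (pres B u X Y)"
proof -
  have ax: "\<forall>K H G v u. v \<in> cells1 T K H \<longrightarrow> u \<in> cells1 T H G \<longrightarrow>
        (\<forall>X \<in> Ob (MC M G). \<forall>Y \<in> Ob (MC N G).
          pres B (u \<bullet>\<^bsub>T\<^esub> v) X Y
            = pres B v (FO (Res M u) X) (FO (Res N u) Y) \<cdot>\<^bsub>MC L K\<^esub> FA (Res L v) (pres B u X Y))"
    using pairing unfolding is_pairing_def by (elim conjE) assumption
  then show ?thesis using assms by (simp add: homs_iff)
qed

lemma pres_res2:
  assumes "\<alpha> \<in> Arr V" "Dom V \<alpha> = u" "Cod V \<alpha> = v" "src T u = H" "trg T u = G"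
    "X \<in> Ob (MC M G)" "Y \<in> Ob (MC N G)"
  shows "pres B v X Y \<cdot>\<^bsub>MC L H\<^esub> Res2 L \<alpha> (pobj B G X Y)
    = parr B H (Res2 M \<alpha> X) (Res2 N \<alpha> Y) \<cdot>\<^bsub>MC L H\<^esub> pres B u X Y"
proof -
  have ax: "\<forall>u v \<alpha>. \<alpha> \<in> cells2 T u v \<longrightarrow>
        (\<forall>X \<in> Ob (MC M (trg T u)). \<forall>Y \<in> Ob (MC N (trg T u)).
          pres B v X Y \<cdot>\<^bsub>MC L (src T u)\<^esub> Res2 L \<alpha> (pobj B (trg T u) X Y)
            = parr B (src T u) (Res2 M \<alpha> X) (Res2 N \<alpha> Y) \<cdot>\<^bsub>MC L (src T u)\<^esub> pres B u X Y)"
    using pairing unfolding is_pairing_def by (elim conjE) assumption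
  show ?thesis using ax[rule_format, of \<alpha> u v X Y] assms by (auto simp: homs_iff)
qed

end


section \<open>The graph square and the pairing\<close>

locale graph_pairing =
  graph_square T G H GG GH i p1 p2 q1 q2 k dg gr r1 r2 d1 d2 s1 s2 \<gamma> + mackey_pairing T R ic J M N L B
  for T :: "('g, 'h, 'c) twocat" and R :: "('k, 'r) ring_scheme" and ic :: bool and J :: "'h set"
    and M :: "('k, 'g, 'h, 'c, 'o1, 'm1) mackey" and N :: "('k, 'g, 'h, 'c, 'o2, 'm2) mackey"
    and L :: "('k, 'g, 'h, 'c, 'o3, 'm3) mackey"
    and B :: "('g, 'h, 'o1, 'm1, 'o2, 'm2, 'o3, 'm3) pairing"
    and G H GG GH :: 'g and i p1 p2 q1 q2 k dg gr :: 'h and r1 r2 d1 d2 s1 s2 \<gamma> :: 'c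
begin

lemma GG_Ob [simp]: "GG \<in> Ob U" "GH \<in> Ob U"
  using cat_dom_ob[OF category_U, of p1] cat_dom_ob[OF category_U, of q1] by simp_all

text \<open>The isomorphism \<open>\<Delta>\<^sup>* (X \<boxtimes> Y) \<cong> X \<odot> Y\<close>.\<close>

definition diag_iso :: "'o1 \<Rightarrow> 'o2 \<Rightarrow> 'm3" where
  "diag_iso X Y = parr B G (Res2 M d1 X) (Res2 N d2 Y)
    \<cdot>\<^bsub>MC L G\<^esub> pres B dg (FO (Res M p1) X) (FO (Res N p2) Y)"

text \<open>The isomorphism \<open>(i, 1)\<^sup>* (X \<boxtimes> Y) \<cong> i\<^sup>* X \<odot> Y\<close>.\<close>

definition graph_iso :: "'o1 \<Rightarrow> 'o2 \<Rightarrow> 'm3" where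
  "graph_iso X Y = parr B H (Res2 M s1 X) (Res2 N s2 Y)
    \<cdot>\<^bsub>MC L H\<^esub> pres B gr (FO (Res M q1) X) (FO (Res N q2) Y)"

text \<open>The isomorphism \<open>(1 \<times> i)\<^sup>* (X \<boxtimes> Y) \<cong> X \<boxtimes> i\<^sup>* Y\<close>, which is \<open>ext_res\<close> for the pair \<open>1\<close>, \<open>i\<close>.\<close>

definition ext_iso :: "'o1 \<Rightarrow> 'o2 \<Rightarrow> 'm3" where
  "ext_iso X Y = parr B GH (Res2 M r1 X) (Res2 N r2 Y)
    \<cdot>\<^bsub>MC L GH\<^esub> pres B k (FO (Res M p1) X) (FO (Res N p2) Y)"


lemma diag_iso_inverse:
  assumes "X \<in> Ob (MC M G)" "Y \<in> Ob (MC N G)"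
  shows "mutually_inverse (MC L G) (FO (Res L dg) (pobj B GG (FO (Res M p1) X) (FO (Res N p2) Y)))
    (pobj B G X Y) (diag_iso X Y) (inv_arr (MC L G) (diag_iso X Y))"
proof -
  have "diag_iso X Y \<in> isos (MC L G) (FO (Res L dg) (pobj B GG (FO (Res M p1) X) (FO (Res N p2) Y))) (pobj B G X Y)"
    unfolding isos_def diag_iso_def
    using assms mutually_inverse_comp[OF L.category_MC[of G]
        pres_inverse[of dg "FO (Res M p1) X" "FO (Res N p2) Y", simplified]
        parr_inverse[OF _ M.res2_inverse[of d1 X G] N.res2_inverse[of d2 Y G], simplified]]
    by auto
  then show ?thesis by (rule inv_arr_iso[rotated]) simp
qed

lemma graph_iso_inverse:
  assumes "X \<in> Ob (MC M G)" "Y \<in> Ob (MC N H)"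
  shows "mutually_inverse (MC L H) (FO (Res L gr) (pobj B GH (FO (Res M q1) X) (FO (Res N q2) Y)))
    (pobj B H (FO (Res M i) X) Y) (graph_iso X Y) (inv_arr (MC L H) (graph_iso X Y))"
proof -
  have "graph_iso X Y \<in> isos (MC L H) (FO (Res L gr) (pobj B GH (FO (Res M q1) X) (FO (Res N q2) Y)))
      (pobj B H (FO (Res M i) X) Y)"
    unfolding isos_def graph_iso_def
    using assms mutually_inverse_comp[OF L.category_MC[of H]
        pres_inverse[of gr "FO (Res M q1) X" "FO (Res N q2) Y", simplified]
        parr_inverse[OF _ M.res2_inverse[of s1 X H] N.res2_inverse[of s2 Y H], simplified]]
    by auto
  then show ?thesis by (rule inv_arr_iso[rotated]) simp
qed

lemma ext_iso_inverse:
  assumes "X \<in> Ob (MC M G)" "Y \<in> Ob (MC N G)"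
  shows "mutually_inverse (MC L GH) (FO (Res L k) (pobj B GG (FO (Res M p1) X) (FO (Res N p2) Y)))
    (pobj B GH (FO (Res M q1) X) (FO (Res N q2) (FO (Res N i) Y)))
    (ext_iso X Y) (inv_arr (MC L GH) (ext_iso X Y))"
proof -
  have "ext_iso X Y \<in> isos (MC L GH) (FO (Res L k) (pobj B GG (FO (Res M p1) X) (FO (Res N p2) Y)))
      (pobj B GH (FO (Res M q1) X) (FO (Res N q2) (FO (Res N i) Y)))"
    unfolding isos_def ext_iso_def
    using assms mutually_inverse_comp[OF L.category_MC[of GH]
        pres_inverse[of k "FO (Res M p1) X" "FO (Res N p2) Y", simplified]
        parr_inverse[OF _ M.res2_inverse[of r1 X GH] N.res2_inverse[of r2 Y GH], simplified]]
    by auto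
  then show ?thesis by (rule inv_arr_iso[rotated]) simp
qed

lemmas iso_typing [simp] =
  diag_iso_inverse[THEN mutually_inverse_arrD(1)] diag_iso_inverse[THEN mutually_inverse_arrD(2)]
  diag_iso_inverse[THEN mutually_inverse_arrD(3)] diag_iso_inverse[THEN mutually_inverse_arrD(4)]
  diag_iso_inverse[THEN mutually_inverse_arrD(5)] diag_iso_inverse[THEN mutually_inverse_arrD(6)]
  graph_iso_inverse[THEN mutually_inverse_arrD(1)] graph_iso_inverse[THEN mutually_inverse_arrD(2)]
  graph_iso_inverse[THEN mutually_inverse_arrD(3)] graph_iso_inverse[THEN mutually_inverse_arrD(4)]
  graph_iso_inverse[THEN mutually_inverse_arrD(5)] graph_iso_inverse[THEN mutually_inverse_arrD(6)]
  ext_iso_inverse[THEN mutually_inverse_arrD(1)] ext_iso_inverse[THEN mutually_inverse_arrD(2)]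
  ext_iso_inverse[THEN mutually_inverse_arrD(3)] ext_iso_inverse[THEN mutually_inverse_arrD(4)]
  ext_iso_inverse[THEN mutually_inverse_arrD(5)] ext_iso_inverse[THEN mutually_inverse_arrD(6)]

lemma graph_iso_natural:
  assumes "f \<in> homs (MC M G) X X'" "g \<in> homs (MC N H) Y Y'"
  shows "graph_iso X' Y' \<cdot>\<^bsub>MC L H\<^esub> FA (Res L gr) (parr B GH (FA (Res M q1) f) (FA (Res N q2) g))
    = parr B H (FA (Res M i) f) g \<cdot>\<^bsub>MC L H\<^esub> graph_iso X Y"
proof -
  have [simp]: "X \<in> Ob (MC M G)" "X' \<in> Ob (MC M G)" "Y \<in> Ob (MC N H)" "Y' \<in> Ob (MC N H)"
    using assms M.category_MC N.category_MC GH_Ob by (auto simp: homs_iff cat_typing)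
  note [simp] = assms[unfolded homs_iff]
  have 1: "pres B gr (FO (Res M q1) X') (FO (Res N q2) Y')
        \<cdot>\<^bsub>MC L H\<^esub> FA (Res L gr) (parr B GH (FA (Res M q1) f) (FA (Res N q2) g))
      = parr B H (FA (Res M gr) (FA (Res M q1) f)) (FA (Res N gr) (FA (Res N q2) g))
        \<cdot>\<^bsub>MC L H\<^esub> pres B gr (FO (Res M q1) X) (FO (Res N q2) Y)"
    by (rule pres_natural) simp_all
  have 2: "Res2 M s1 X' \<cdot>\<^bsub>MC M H\<^esub> FA (Res M gr) (FA (Res M q1) f) = FA (Res M i) f \<cdot>\<^bsub>MC M H\<^esub> Res2 M s1 X"
    using M.res2_natural[of s1 f H X X' "q1 \<bullet>\<^bsub>T\<^esub> gr" i] by simp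
  have 3: "Res2 N s2 Y' \<cdot>\<^bsub>MC N H\<^esub> FA (Res N gr) (FA (Res N q2) g) = g \<cdot>\<^bsub>MC N H\<^esub> Res2 N s2 Y"
    using N.res2_natural[of s2 g H Y Y' "q2 \<bullet>\<^bsub>T\<^esub> gr" "id1 T H"] by simp
  show ?thesis
    by (simp add: graph_iso_def cat_assoc 1 cat_prefix[OF parr_comp] 2 3)
qed

text \<open>
  Both sides restrict \<open>X \<boxtimes> Y\<close> to \<open>H\<close>, the left one through \<open>G \<times> H\<close> and the right one through \<open>G\<close>. By
  pseudonaturality of the pairing each side is the restriction isomorphism along \<open>k gr\<close> followed by
  a pair of maps in \<open>M(H)\<close> and \<open>N(H)\<close>; equality of these pairs is the image under \<open>M\<close> and \<open>N\<close> of the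
  two coherence equations for \<open>\<gamma>\<close>.
\<close>

lemma pairing_coherence:
  assumes [simp]: "X \<in> Ob (MC M G)" "Y \<in> Ob (MC N G)"
  defines "A \<equiv> pobj B GG (FO (Res M p1) X) (FO (Res N p2) Y)"
  shows "graph_iso X (FO (Res N i) Y) \<cdot>\<^bsub>MC L H\<^esub> FA (Res L gr) (ext_iso X Y)
    = pres B i X Y \<cdot>\<^bsub>MC L H\<^esub> FA (Res L i) (diag_iso X Y) \<cdot>\<^bsub>MC L H\<^esub> Res2 L \<gamma> A"
proof -
  let ?X = "FO (Res M p1) X" and ?Y = "FO (Res N p2) Y"
  have nat_gr: "pres B gr (FO (Res M q1) X) (FO (Res N q2) (FO (Res N i) Y))
        \<cdot>\<^bsub>MC L H\<^esub> FA (Res L gr) (parr B GH (Res2 M r1 X) (Res2 N r2 Y))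
      = parr B H (FA (Res M gr) (Res2 M r1 X)) (FA (Res N gr) (Res2 N r2 Y))
        \<cdot>\<^bsub>MC L H\<^esub> pres B gr (FO (Res M k) ?X) (FO (Res N k) ?Y)"
    by (rule pres_natural) simp_all
  have comp_kgr: "pres B gr (FO (Res M k) ?X) (FO (Res N k) ?Y) \<cdot>\<^bsub>MC L H\<^esub> FA (Res L gr) (pres B k ?X ?Y)
      = pres B (k \<bullet>\<^bsub>T\<^esub> gr) ?X ?Y"
    using pres_comp1[of k gr ?X ?Y] by simp
  have nat_i: "pres B i X Y \<cdot>\<^bsub>MC L H\<^esub> FA (Res L i) (parr B G (Res2 M d1 X) (Res2 N d2 Y))
      = parr B H (FA (Res M i) (Res2 M d1 X)) (FA (Res N i) (Res2 N d2 Y))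
        \<cdot>\<^bsub>MC L H\<^esub> pres B i (FO (Res M dg) ?X) (FO (Res N dg) ?Y)"
    by (rule pres_natural) simp_all
  have comp_dgi: "pres B i (FO (Res M dg) ?X) (FO (Res N dg) ?Y) \<cdot>\<^bsub>MC L H\<^esub> FA (Res L i) (pres B dg ?X ?Y)
      = pres B (dg \<bullet>\<^bsub>T\<^esub> i) ?X ?Y"
    using pres_comp1[of dg i ?X ?Y] by simp
  have res2: "pres B (dg \<bullet>\<^bsub>T\<^esub> i) ?X ?Y \<cdot>\<^bsub>MC L H\<^esub> Res2 L \<gamma> A
      = parr B H (Res2 M \<gamma> ?X) (Res2 N \<gamma> ?Y) \<cdot>\<^bsub>MC L H\<^esub> pres B (k \<bullet>\<^bsub>T\<^esub> gr) ?X ?Y"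
    unfolding A_def by (rule pres_res2) simp_all
  have cohM: "Res2 M s1 X \<cdot>\<^bsub>MC M H\<^esub> FA (Res M gr) (Res2 M r1 X)
      = FA (Res M i) (Res2 M d1 X) \<cdot>\<^bsub>MC M H\<^esub> Res2 M \<gamma> ?X"
    using arg_cong[OF coherence1, of "\<lambda>\<alpha>. Res2 M \<alpha> X"] by (simp add: M.res2_vcomp M.res2_whisker)
  have cohN: "Res2 N s2 (FO (Res N i) Y) \<cdot>\<^bsub>MC N H\<^esub> FA (Res N gr) (Res2 N r2 Y)
      = FA (Res N i) (Res2 N d2 Y) \<cdot>\<^bsub>MC N H\<^esub> Res2 N \<gamma> ?Y"
    using arg_cong[OF coherence2, of "\<lambda>\<alpha>. Res2 N \<alpha> Y"] by (simp add: N.res2_vcomp N.res2_whisker)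
  have "graph_iso X (FO (Res N i) Y) \<cdot>\<^bsub>MC L H\<^esub> FA (Res L gr) (ext_iso X Y)
      = parr B H (Res2 M s1 X) (Res2 N s2 (FO (Res N i) Y))
        \<cdot>\<^bsub>MC L H\<^esub> parr B H (FA (Res M gr) (Res2 M r1 X)) (FA (Res N gr) (Res2 N r2 Y))
        \<cdot>\<^bsub>MC L H\<^esub> pres B (k \<bullet>\<^bsub>T\<^esub> gr) ?X ?Y"
    by (simp add: graph_iso_def ext_iso_def cat_simps cat_prefix[OF nat_gr] comp_kgr)
  also have "\<dots> = parr B H (FA (Res M i) (Res2 M d1 X)) (FA (Res N i) (Res2 N d2 Y))
        \<cdot>\<^bsub>MC L H\<^esub> parr B H (Res2 M \<gamma> ?X) (Res2 N \<gamma> ?Y) \<cdot>\<^bsub>MC L H\<^esub> pres B (k \<bullet>\<^bsub>T\<^esub> gr) ?X ?Y"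
    by (simp add: cat_prefix[OF parr_comp] cohM cohN)
  also have "\<dots> = pres B i X Y \<cdot>\<^bsub>MC L H\<^esub> FA (Res L i) (diag_iso X Y) \<cdot>\<^bsub>MC L H\<^esub> Res2 L \<gamma> A"
    unfolding res2[symmetric] A_def
    by (simp add: diag_iso_def cat_simps cat_prefix[OF nat_i] cat_prefix[OF comp_dgi])
  finally show ?thesis .
qed

end


section \<open>The projection formula\<close>

context graph_pairing
begin

text \<open>
  The assumption \<open>bimorphism\<close> is the bimorphism property for the pair \<open>1\<close>, \<open>i\<close>. Let \<open>\<phi>\<close> be the composite
  of its right mate, restricted along the diagonal, with base change for the graph square, and let
  \<open>\<psi>\<close> be the corresponding composite of left mates, its inverse. The isomorphisms \<open>s\<close> on the side of
  \<open>X \<odot> i\<^sub>* Y\<close> and \<open>i\<^sub>* b\<close> on the side of \<open>i\<^sub>* (i\<^sup>* X \<odot> Y)\<close> turn \<open>\<phi>\<close> into \<open>Rp\<^sup>1\<close> and \<open>\<psi>\<close> into \<open>Lp\<^sup>1\<close>. All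
  maps concerned are transposes of maps in \<open>L(H)\<close>, and these are compared in the facts \<open>right\<close> and
  \<open>left\<close>.
\<close>

lemma projection_maps_inverse:
  fixes X Y
  defines "Xi \<equiv> FO (Ind M (id1 T G)) X" and "Yi \<equiv> FO (Ind N i) Y"
  defines "A \<equiv> pobj B GG (FO (Res M p1) Xi) (FO (Res N p2) Yi)"
    and "Z \<equiv> pobj B GH (FO (Res M q1) X) (FO (Res N q2) Y)"
    and "\<rho> \<equiv> parr B GH (FA (Res M q1) (rcounit M (id1 T G) X)) (FA (Res N q2) (rcounit N i Y))"
    and "\<kappa> \<equiv> parr B GH (FA (Res M q1) (lunit M (id1 T G) X)) (FA (Res N q2) (lunit N i Y))"
  assumes J: "i \<in> J" "k \<in> J" "id1 T G \<in> J"
    and X: "X \<in> Ob (MC M G)" and Y: "Y \<in> Ob (MC N H)"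
    and bimorphism: "mutually_inverse (MC L GG) A (FO (Ind L k) Z)
      (FA (Ind L k) \<rho> \<cdot>\<^bsub>MC L GG\<^esub> FA (Ind L k) (ext_iso Xi Yi) \<cdot>\<^bsub>MC L GG\<^esub> runit L k A)
      (lcounit L k A \<cdot>\<^bsub>MC L GG\<^esub> FA (Ind L k) (inv_arr (MC L GH) (ext_iso Xi Yi)) \<cdot>\<^bsub>MC L GG\<^esub> FA (Ind L k) \<kappa>)"
      (is "mutually_inverse _ _ _ ?erm ?elm")
  shows "mutually_inverse (MC L G) (pobj B G X Yi) (FO (Ind L i) (pobj B H (FO (Res M i) X) Y))
    (Rp1 T M N L B i X Y) (Lp1 T M N L B i X Y)"
proof -
  note [simp] = J X Y
  have Xi [simp]: "Xi \<in> Ob (MC M G)" and Yi [simp]: "Yi \<in> Ob (MC N G)"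
    by (simp_all add: Xi_def Yi_def)
  have A [simp]: "A \<in> Ob (MC L GG)" and Z [simp]: "Z \<in> Ob (MC L GH)"
    by (simp_all add: A_def Z_def)
  let ?rc = "rcounit M (id1 T G) X" and ?lu = "lunit M (id1 T G) X"
  have rc_lu: "mutually_inverse (MC M G) Xi X ?rc ?lu"
    unfolding Xi_def by (rule M.identity_counit_unit) simp_all
  note rc [simp] = mutually_inverse_arrD(1-6)[OF rc_lu]
  let ?ri = "rcounit N i Y" and ?li = "lunit N i Y"
  have ri [simp]: "?ri \<in> Arr (MC N H)" "Dom (MC N H) ?ri = FO (Res N i) Yi" "Cod (MC N H) ?ri = Y"
    and li [simp]: "?li \<in> Arr (MC N H)" "Dom (MC N H) ?li = Y" "Cod (MC N H) ?li = FO (Res N i) Yi"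
    by (simp_all add: Yi_def)
  \<comment> \<open>the isomorphisms are made opaque, so that the simplifier sees no more of them than their types\<close>
  define E where "E = ext_iso Xi Yi"
  define E' where "E' = inv_arr (MC L GH) E"
  have E_inv: "mutually_inverse (MC L GH) (FO (Res L k) A)
      (pobj B GH (FO (Res M q1) Xi) (FO (Res N q2) (FO (Res N i) Yi))) E E'"
    unfolding E'_def E_def A_def by (rule ext_iso_inverse) simp_all
  note E [simp] = mutually_inverse_arrD[OF E_inv]
  have \<rho> [simp]: "\<rho> \<in> Arr (MC L GH)" "Cod (MC L GH) \<rho> = Z"
      "Dom (MC L GH) \<rho> = pobj B GH (FO (Res M q1) Xi) (FO (Res N q2) (FO (Res N i) Yi))"
    and \<kappa> [simp]: "\<kappa> \<in> Arr (MC L GH)" "Dom (MC L GH) \<kappa> = Z"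
      "Cod (MC L GH) \<kappa> = pobj B GH (FO (Res M q1) Xi) (FO (Res N q2) (FO (Res N i) Yi))"
    by (simp_all add: \<rho>_def \<kappa>_def Z_def)
  define a where "a = diag_iso Xi Yi"
  have a [simp]: "a \<in> Arr (MC L G)" "Dom (MC L G) a = FO (Res L dg) A" "Cod (MC L G) a = pobj B G Xi Yi"
    by (simp_all add: a_def A_def)
  define b where "b = graph_iso X Y"
  have b [simp]: "b \<in> Arr (MC L H)" "Dom (MC L H) b = FO (Res L gr) Z" "Cod (MC L H) b = pobj B H (FO (Res M i) X) Y"
    by (simp_all add: b_def Z_def)
  define c where "c = graph_iso Xi (FO (Res N i) Yi)"
  have c [simp]: "c \<in> Arr (MC L H)" "Cod (MC L H) c = pobj B H (FO (Res M i) Xi) (FO (Res N i) Yi)"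
    "Dom (MC L H) c = FO (Res L gr) (pobj B GH (FO (Res M q1) Xi) (FO (Res N q2) (FO (Res N i) Yi)))"
    by (simp_all add: c_def)
  define s where "s = parr B G ?rc (Idn (MC N G) Yi) \<cdot>\<^bsub>MC L G\<^esub> a"
  have s [simp]: "s \<in> Arr (MC L G)" "Dom (MC L G) s = FO (Res L dg) A" "Cod (MC L G) s = pobj B G X Yi"
    by (simp_all add: s_def cat_simps)
  have Res2 [simp]: "Res2 L \<gamma> A \<in> Arr (MC L H)" "Res2 L (inv2 \<gamma>) A \<in> Arr (MC L H)"
    "Dom (MC L H) (Res2 L \<gamma> A) = FO (Res L gr) (FO (Res L k) A)"
    "Cod (MC L H) (Res2 L \<gamma> A) = FO (Res L i) (FO (Res L dg) A)"
    "Cod (MC L H) (Res2 L (inv2 \<gamma>) A) = FO (Res L gr) (FO (Res L k) A)"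
    "Dom (MC L H) (Res2 L (inv2 \<gamma>) A) = FO (Res L i) (FO (Res L dg) A)"
    and \<gamma>_inv: "Res2 L \<gamma> A \<cdot>\<^bsub>MC L H\<^esub> Res2 L (inv2 \<gamma>) A = Idn (MC L H) (FO (Res L i) (FO (Res L dg) A))"
    using L.res2_inverse[of \<gamma> A H] by (simp_all add: mutually_inverse_def)

  have coherence: "c \<cdot>\<^bsub>MC L H\<^esub> FA (Res L gr) E = pres B i Xi Yi \<cdot>\<^bsub>MC L H\<^esub> FA (Res L i) a \<cdot>\<^bsub>MC L H\<^esub> Res2 L \<gamma> A"
    unfolding c_def E_def a_def A_def by (rule pairing_coherence) simp_all
  have b_\<rho>: "b \<cdot>\<^bsub>MC L H\<^esub> FA (Res L gr) \<rho> = parr B H (FA (Res M i) ?rc) ?ri \<cdot>\<^bsub>MC L H\<^esub> c"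
    unfolding b_def \<rho>_def c_def by (rule graph_iso_natural) (simp_all add: homs_iff)
  have c_\<kappa>: "c \<cdot>\<^bsub>MC L H\<^esub> FA (Res L gr) \<kappa> = parr B H (FA (Res M i) ?lu) ?li \<cdot>\<^bsub>MC L H\<^esub> b"
    unfolding b_def \<kappa>_def c_def by (rule graph_iso_natural) (simp_all add: homs_iff)
  have pres_rc: "pres B i X Yi \<cdot>\<^bsub>MC L H\<^esub> FA (Res L i) (parr B G ?rc (Idn (MC N G) Yi))
      = parr B H (FA (Res M i) ?rc) (Idn (MC N H) (FO (Res N i) Yi)) \<cdot>\<^bsub>MC L H\<^esub> pres B i Xi Yi"
    using pres_natural[of i H G ?rc Xi X "Idn (MC N G) Yi" Yi Yi] by (simp add: cat_typing)
  have pres_s: "pres B i X Yi \<cdot>\<^bsub>MC L H\<^esub> FA (Res L i) s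
      = parr B H (FA (Res M i) ?rc) (Idn (MC N H) (FO (Res N i) Yi)) \<cdot>\<^bsub>MC L H\<^esub> pres B i Xi Yi \<cdot>\<^bsub>MC L H\<^esub> FA (Res L i) a"
    by (simp add: s_def cat_simps cat_prefix[OF pres_rc])

  let ?lm = "left_mate T L k dg gr i \<gamma> Z" and ?rm = "right_mate T L k dg gr i \<gamma> Z"
  have mates: "mutually_inverse (MC L G) (FO (Ind L i) (FO (Res L gr) Z)) (FO (Res L dg) (FO (Ind L k) Z)) ?lm ?rm"
  proof -
    have "\<forall>i u p q \<gamma>. pseudopullback T i u p q \<gamma> \<longrightarrow> i \<in> J \<longrightarrow> q \<in> J \<longrightarrow>
        (\<forall>Y \<in> Ob (MC L (src T i)).
          mutually_inverse (MC L (src T u))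
            (FO (Ind L q) (FO (Res L p) Y)) (FO (Res L u) (FO (Ind L i) Y))
            (left_mate T L i u p q \<gamma> Y) (right_mate T L i u p q \<gamma> Y))"
      using L.mackey unfolding mackey_2functor_def by (elim conjE) assumption
    from this[rule_format, OF pseudopullback] show ?thesis by simp
  qed
  have \<phi>: "mutually_inverse (MC L G) (FO (Res L dg) A) (FO (Ind L i) (FO (Res L gr) Z))
      (?rm \<cdot>\<^bsub>MC L G\<^esub> FA (Res L dg) ?erm) (FA (Res L dg) ?elm \<cdot>\<^bsub>MC L G\<^esub> ?lm)"
    using mutually_inverse_comp[OF _ mutually_inverse_functor[OF L.res_functor[of dg, simplified] _ bimorphism]
        mutually_inverse_sym[OF mates]] by simp
  have rm: "?rm \<cdot>\<^bsub>MC L G\<^esub> FA (Res L dg) ?erm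
      = FA (Ind L i) (FA (Res L gr) (\<rho> \<cdot>\<^bsub>MC L GH\<^esub> E) \<cdot>\<^bsub>MC L H\<^esub> Res2 L (inv2 \<gamma>) A) \<cdot>\<^bsub>MC L G\<^esub> runit L i (FO (Res L dg) A)"
    using L.right_mate_transpose[OF J(2,1) cell1(6,7,8,1) cell2(7) A Z, of "\<rho> \<cdot>\<^bsub>MC L GH\<^esub> E"]
    unfolding E_def[symmetric] by (simp add: homs_iff cat_simps)
  have lm: "FA (Res L dg) ?elm \<cdot>\<^bsub>MC L G\<^esub> ?lm
      = lcounit L i (FO (Res L dg) A) \<cdot>\<^bsub>MC L G\<^esub> FA (Ind L i) (Res2 L \<gamma> A \<cdot>\<^bsub>MC L H\<^esub> FA (Res L gr) (E' \<cdot>\<^bsub>MC L GH\<^esub> \<kappa>))"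
    using L.left_mate_transpose[OF J(2,1) cell1(6,7,8,1) cell2(7) A Z, of "E' \<cdot>\<^bsub>MC L GH\<^esub> \<kappa>"]
    unfolding E_def[symmetric] E'_def[symmetric] by (simp add: homs_iff cat_simps)

  \<comment> \<open>the maps in \<open>L(H)\<close> of which \<open>Rp\<^sup>1\<close> and \<open>Lp\<^sup>1\<close> are the transposes\<close>
  define g where "g = parr B H (Idn (MC M H) (FO (Res M i) X)) ?ri \<cdot>\<^bsub>MC L H\<^esub> pres B i X Yi"
  have g [simp]: "g \<in> Arr (MC L H)" "Dom (MC L H) g = FO (Res L i) (pobj B G X Yi)"
    "Cod (MC L H) g = pobj B H (FO (Res M i) X) Y"
    by (simp_all add: g_def cat_simps)
  have Rp1: "Rp1 T M N L B i X Y = FA (Ind L i) g \<cdot>\<^bsub>MC L G\<^esub> runit L i (pobj B G X Yi)"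
    unfolding Yi_def g_def Rp1_def by (simp add: Let_def cat_simps flip: Yi_def)
  define p where "p = inv_arr (MC L H) (pres B i X Yi)"
  have "mutually_inverse (MC L H) (FO (Res L i) (pobj B G X Yi)) (pobj B H (FO (Res M i) X) (FO (Res N i) Yi))
      (pres B i X Yi) p"
    unfolding p_def using pres_inverse[of i X Yi] by simp
  note p [simp] = mutually_inverse_arrD(4-8)[OF this]
  define g' where "g' = p \<cdot>\<^bsub>MC L H\<^esub> parr B H (Idn (MC M H) (FO (Res M i) X)) ?li"
  have g' [simp]: "g' \<in> Arr (MC L H)" "Cod (MC L H) g' = FO (Res L i) (pobj B G X Yi)"
    "Dom (MC L H) g' = pobj B H (FO (Res M i) X) Y"
    by (simp_all add: g'_def cat_simps)
  have Lp1: "Lp1 T M N L B i X Y = lcounit L i (pobj B G X Yi) \<cdot>\<^bsub>MC L G\<^esub> FA (Ind L i) g'"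
    unfolding Yi_def g'_def Lp1_def by (simp add: Let_def cat_simps flip: Yi_def p_def)

  have right: "g \<cdot>\<^bsub>MC L H\<^esub> FA (Res L i) s = b \<cdot>\<^bsub>MC L H\<^esub> FA (Res L gr) (\<rho> \<cdot>\<^bsub>MC L GH\<^esub> E) \<cdot>\<^bsub>MC L H\<^esub> Res2 L (inv2 \<gamma>) A"
  proof -
    have "b \<cdot>\<^bsub>MC L H\<^esub> FA (Res L gr) (\<rho> \<cdot>\<^bsub>MC L GH\<^esub> E) \<cdot>\<^bsub>MC L H\<^esub> Res2 L (inv2 \<gamma>) A
        = parr B H (FA (Res M i) ?rc) ?ri \<cdot>\<^bsub>MC L H\<^esub> pres B i Xi Yi \<cdot>\<^bsub>MC L H\<^esub> FA (Res L i) a"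
      by (simp add: cat_simps cat_prefix[OF b_\<rho>] cat_prefix[OF coherence] \<gamma>_inv)
    also have "\<dots> = g \<cdot>\<^bsub>MC L H\<^esub> FA (Res L i) s"
      by (simp add: g_def cat_simps pres_s cat_prefix[OF parr_comp])
    finally show ?thesis ..
  qed
  have left: "FA (Res L i) s \<cdot>\<^bsub>MC L H\<^esub> Res2 L \<gamma> A \<cdot>\<^bsub>MC L H\<^esub> FA (Res L gr) (E' \<cdot>\<^bsub>MC L GH\<^esub> \<kappa>) = g' \<cdot>\<^bsub>MC L H\<^esub> b"
  proof -
    have E_E': "FA (Res L gr) E \<cdot>\<^bsub>MC L H\<^esub> FA (Res L gr) E'
        = Idn (MC L H) (FO (Res L gr) (pobj B GH (FO (Res M q1) Xi) (FO (Res N q2) (FO (Res N i) Yi))))"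
      using L.res(6)[of gr E GH E'] by simp
    have "pres B i X Yi \<cdot>\<^bsub>MC L H\<^esub> FA (Res L i) s \<cdot>\<^bsub>MC L H\<^esub> Res2 L \<gamma> A \<cdot>\<^bsub>MC L H\<^esub> FA (Res L gr) (E' \<cdot>\<^bsub>MC L GH\<^esub> \<kappa>)
        = parr B H (FA (Res M i) ?rc) (Idn (MC N H) (FO (Res N i) Yi))
          \<cdot>\<^bsub>MC L H\<^esub> (pres B i Xi Yi \<cdot>\<^bsub>MC L H\<^esub> FA (Res L i) a \<cdot>\<^bsub>MC L H\<^esub> Res2 L \<gamma> A)
          \<cdot>\<^bsub>MC L H\<^esub> FA (Res L gr) E' \<cdot>\<^bsub>MC L H\<^esub> FA (Res L gr) \<kappa>"
      by (simp add: cat_simps cat_prefix[OF pres_s])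
    also have "\<dots> = parr B H (FA (Res M i) ?rc) (Idn (MC N H) (FO (Res N i) Yi)) \<cdot>\<^bsub>MC L H\<^esub> c \<cdot>\<^bsub>MC L H\<^esub> FA (Res L gr) \<kappa>"
      unfolding coherence[symmetric] by (simp add: cat_simps cat_prefix[OF E_E'])
    also have "\<dots> = parr B H (Idn (MC M H) (FO (Res M i) X)) ?li \<cdot>\<^bsub>MC L H\<^esub> b"
      using arg_cong[OF mutually_inverse_arrD(8)[OF rc_lu], of "FA (Res M i)"]
      by (simp add: c_\<kappa> cat_prefix[OF parr_comp] cat_simps)
    finally have e: "pres B i X Yi \<cdot>\<^bsub>MC L H\<^esub> FA (Res L i) s \<cdot>\<^bsub>MC L H\<^esub> Res2 L \<gamma> A \<cdot>\<^bsub>MC L H\<^esub> FA (Res L gr) (E' \<cdot>\<^bsub>MC L GH\<^esub> \<kappa>)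
        = parr B H (Idn (MC M H) (FO (Res M i) X)) ?li \<cdot>\<^bsub>MC L H\<^esub> b" .
    \<comment> \<open>cancel the isomorphism \<open>pres B i X Yi\<close>\<close>
    show ?thesis
      using arg_cong[OF e, of "\<lambda>x. p \<cdot>\<^bsub>MC L H\<^esub> x"] by (simp add: g'_def cat_simps cat_prefix[OF p(4)])
  qed

  show ?thesis
  proof (rule mutually_inverse_transport[OF _ \<phi>])
    show "mutually_inverse (MC L G) (FO (Res L dg) A) (pobj B G X Yi) s
        (inv_arr (MC L G) a \<cdot>\<^bsub>MC L G\<^esub> parr B G ?lu (Idn (MC N G) Yi))"
      unfolding s_def a_def A_def
    proof (rule mutually_inverse_comp[OF _ diag_iso_inverse])
      have "mutually_inverse (MC N G) Yi Yi (Idn (MC N G) Yi) (Idn (MC N G) Yi)"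
        by (rule mutually_inverseI) (simp_all add: cat_simps)
      then show "mutually_inverse (MC L G) (pobj B G Xi Yi) (pobj B G X Yi)
          (parr B G ?rc (Idn (MC N G) Yi)) (parr B G ?lu (Idn (MC N G) Yi))"
        by (intro parr_inverse rc_lu) simp_all
    qed simp_all
    show "mutually_inverse (MC L G) (FO (Ind L i) (FO (Res L gr) Z)) (FO (Ind L i) (pobj B H (FO (Res M i) X) Y))
        (FA (Ind L i) b) (FA (Ind L i) (inv_arr (MC L H) b))"
      unfolding b_def Z_def
      using mutually_inverse_functor[OF L.ind_functor[OF J(1), simplified] _ graph_iso_inverse[OF X Y]] by simp
    show "Rp1 T M N L B i X Y \<in> homs (MC L G) (pobj B G X Yi) (FO (Ind L i) (pobj B H (FO (Res M i) X) Y))"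
      by (simp add: Rp1 homs_iff cat_simps)
    show "Lp1 T M N L B i X Y \<in> homs (MC L G) (FO (Ind L i) (pobj B H (FO (Res M i) X) Y)) (pobj B G X Yi)"
      by (simp add: Lp1 homs_iff cat_simps)
    show "Rp1 T M N L B i X Y \<cdot>\<^bsub>MC L G\<^esub> s = FA (Ind L i) b \<cdot>\<^bsub>MC L G\<^esub> (?rm \<cdot>\<^bsub>MC L G\<^esub> FA (Res L dg) ?erm)"
    proof -
      have "runit L i (pobj B G X Yi) \<cdot>\<^bsub>MC L G\<^esub> s
          = FA (Ind L i) (FA (Res L i) s) \<cdot>\<^bsub>MC L G\<^esub> runit L i (FO (Res L dg) A)"
        by (rule L.units_natural(3)) (simp_all add: homs_iff)
      then have "Rp1 T M N L B i X Y \<cdot>\<^bsub>MC L G\<^esub> s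
          = FA (Ind L i) (g \<cdot>\<^bsub>MC L H\<^esub> FA (Res L i) s) \<cdot>\<^bsub>MC L G\<^esub> runit L i (FO (Res L dg) A)"
        by (simp add: Rp1 cat_simps)
      then show ?thesis unfolding rm right by (simp add: cat_simps)
    qed
    show "Lp1 T M N L B i X Y \<cdot>\<^bsub>MC L G\<^esub> FA (Ind L i) b = s \<cdot>\<^bsub>MC L G\<^esub> (FA (Res L dg) ?elm \<cdot>\<^bsub>MC L G\<^esub> ?lm)"
    proof -
      have nat: "lcounit L i (pobj B G X Yi) \<cdot>\<^bsub>MC L G\<^esub> FA (Ind L i) (FA (Res L i) s)
          = s \<cdot>\<^bsub>MC L G\<^esub> lcounit L i (FO (Res L dg) A)"
        by (rule L.units_natural(4)) (simp_all add: homs_iff)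
      have "Lp1 T M N L B i X Y \<cdot>\<^bsub>MC L G\<^esub> FA (Ind L i) b
          = lcounit L i (pobj B G X Yi) \<cdot>\<^bsub>MC L G\<^esub> FA (Ind L i) (g' \<cdot>\<^bsub>MC L H\<^esub> b)"
        by (simp add: Lp1 cat_simps)
      also have "\<dots> = s \<cdot>\<^bsub>MC L G\<^esub> (FA (Res L dg) ?elm \<cdot>\<^bsub>MC L G\<^esub> ?lm)"
        unfolding lm left[symmetric] by (simp add: cat_simps cat_prefix[OF nat])
      finally show ?thesis .
    qed
  qed simp
qed

end

lemma (in mackey_pairing) projection_formula:
  assumes Q: "binary_products T Q" and J_prd: "\<And>i1 i2. i1 \<in> J \<Longrightarrow> i2 \<in> J \<Longrightarrow> prd1 Q i1 i2 \<in> J"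
    and J_id: "\<And>G. G \<in> Ob U \<Longrightarrow> id1 T G \<in> J"
    and bimorphism: "bimorphism R T J Q M N L B"
    and i: "i \<in> J" "i \<in> cells1 T H G" and X: "X \<in> Ob (MC M G)" and Y: "Y \<in> Ob (MC N H)"
  shows "mutually_inverse (MC L G) (pobj B G X (FO (Ind N i) Y))
    (FO (Ind L i) (pobj B H (FO (Res M i) X) Y)) (Rp1 T M N L B i X Y) (Lp1 T M N L B i X Y)"
proof -
  obtain dg gr d1 d2 s1 s2 \<gamma> where
    sq: "graph_square T G H (prd Q G G) (prd Q G H) i (pr1 Q G G) (pr2 Q G G) (pr1 Q G H) (pr2 Q G H)
      (prd1 Q (id1 T G) i) dg gr (psq1 Q (id1 T G) i) (psq2 Q (id1 T G) i) d1 d2 s1 s2 \<gamma>"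
    by (rule graph_square_exists[OF Q i(2)])
  interpret graph_square T G H "prd Q G G" "prd Q G H" i "pr1 Q G G" "pr2 Q G G" "pr1 Q G H" "pr2 Q G H"
    "prd1 Q (id1 T G) i" dg gr "psq1 Q (id1 T G) i" "psq2 Q (id1 T G) i" d1 d2 s1 s2 \<gamma>
    by (rule sq)
  interpret graph_pairing T R ic J M N L B G H "prd Q G G" "prd Q G H" i "pr1 Q G G" "pr2 Q G G"
    "pr1 Q G H" "pr2 Q G H" "prd1 Q (id1 T G) i" dg gr "psq1 Q (id1 T G) i" "psq2 Q (id1 T G) i" d1 d2 s1 s2 \<gamma>
    ..
  have "G \<in> Ob U" by simp
  with i J_prd J_id have J': "prd1 Q (id1 T G) i \<in> J" "id1 T G \<in> J" by blast+
  have ext: "ext_res T Q M N L B (id1 T G) i X' Y' = ext_iso X' Y'" for X' Y'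
    by (simp add: ext_res_def ext_iso_def Let_def)
  have bim: "\<forall>i1 \<in> J. \<forall>i2 \<in> J. \<forall>X \<in> Ob (MC M (src T i1)). \<forall>Y \<in> Ob (MC N (src T i2)).
      mutually_inverse (MC L (prd Q (trg T i1) (trg T i2)))
        (ext_obj Q M N B (trg T i1) (trg T i2) (FO (Ind M i1) X) (FO (Ind N i2) Y))
        (FO (Ind L (prd1 Q i1 i2)) (ext_obj Q M N B (src T i1) (src T i2) X Y))
        (ext_right_mate T Q M N L B i1 i2 X Y)
        (ext_left_mate T Q M N L B i1 i2 X Y)"
    using bimorphism by (simp add: bimorphism_def)
  show ?thesis
    by (rule projection_maps_inverse[OF i(1) J' X Y])
      (use bim[rule_format, OF J'(2) i(1), of X Y] X Y in
        \<open>simp add: ext_right_mate_def ext_left_mate_def ext ext_obj_def ext_arr_def Let_def\<close>)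
qed

definition swap_pairing ::
  "('g, 'h, 'o1, 'm1, 'o2, 'm2, 'o3, 'm3) pairing \<Rightarrow> ('g, 'h, 'o2, 'm2, 'o1, 'm1, 'o3, 'm3) pairing" where
  "swap_pairing B =
    \<lparr>pobj = (\<lambda>G Y X. pobj B G X Y), parr = (\<lambda>G g f. parr B G f g), pres = (\<lambda>u Y X. pres B u X Y)\<rparr>"

lemma swap_pairing_simps [simp]:
  "pobj (swap_pairing B) = (\<lambda>G Y X. pobj B G X Y)" "parr (swap_pairing B) = (\<lambda>G g f. parr B G f g)"
  "pres (swap_pairing B) = (\<lambda>u Y X. pres B u X Y)"
  by (simp_all add: swap_pairing_def)

lemma swap_prods_simps [simp]:
  "prd (swap_prods Q) G1 G2 = prd Q G2 G1" "pr1 (swap_prods Q) G1 G2 = pr2 Q G2 G1"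
  "pr2 (swap_prods Q) G1 G2 = pr1 Q G2 G1" "prd1 (swap_prods Q) u1 u2 = prd1 Q u2 u1"
  "psq1 (swap_prods Q) u1 u2 = psq2 Q u2 u1" "psq2 (swap_prods Q) u1 u2 = psq1 Q u2 u1"
  by (simp_all add: swap_prods_def)

lemma is_functor_prod_swap:
  assumes "is_functor (prod_cat C D) E \<lparr>FO = (\<lambda>(X, Y). F0 X Y), FA = (\<lambda>(f, g). F1 f g)\<rparr>"
  shows "is_functor (prod_cat D C) E \<lparr>FO = (\<lambda>(Y, X). F0 X Y), FA = (\<lambda>(g, f). F1 f g)\<rparr>"
  using assms unfolding is_functor_def prod_cat_def homs_iff by fastforce

lemma bilinear_functor_swap:
  assumes "bilinear_functor R C D E F0 F1"
  shows "bilinear_functor R D C E (\<lambda>Y X. F0 X Y) (\<lambda>g f. F1 f g)"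
  using assms by (simp add: bilinear_functor_def is_functor_prod_swap)

lemma is_pairing_swap:
  assumes B: "is_pairing R T M N L B"
  shows "is_pairing R T N M L (swap_pairing B)"
  unfolding is_pairing_def swap_pairing_simps
proof (intro conjI ballI allI impI, goal_cases)
  case (1 G)
  have "bilinear_functor R (MC M G) (MC N G) (MC L G) (pobj B G) (parr B G)"
    using conjunct1[OF B[unfolded is_pairing_def]] 1 by (rule bspec)
  from bilinear_functor_swap[OF this] show ?case .
next
  case (2 H G u Y X)
  then show ?case
    by (intro B[unfolded is_pairing_def, THEN conjunct2, THEN conjunct1, rule_format,
          THEN conjunct1, rule_format])
next
  case (3 H G u Y Y' X X' g f)
  then show ?case
    by (intro B[unfolded is_pairing_def, THEN conjunct2, THEN conjunct1, rule_format,
          THEN conjunct2, rule_format])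
next
  case (4 G Y X)
  then show ?case
    by (intro B[unfolded is_pairing_def, THEN conjunct2, THEN conjunct2, THEN conjunct1, rule_format])
next
  case (5 K H G v u Y X)
  then show ?case
    by (intro B[unfolded is_pairing_def, THEN conjunct2, THEN conjunct2, THEN conjunct2,
          THEN conjunct1, rule_format])
next
  case (6 u v \<alpha> Y X)
  then show ?case
    by (intro B[unfolded is_pairing_def, THEN conjunct2, THEN conjunct2, THEN conjunct2,
          THEN conjunct2, rule_format])
qed

text \<open>The external pairing of the exchanged pairing is formed with the exchanged products, so that the
  two external pairings live over the same objects and no symmetry isomorphism intervenes.\<close>

lemma bimorphism_swap:
  assumes "bimorphism R T J Q M N L B"
  shows "bimorphism R T J (swap_prods Q) N M L (swap_pairing B)"
  using assms is_pairing_swap[of R T M N L B]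
  unfolding bimorphism_def
  by (simp add: ext_right_mate_def ext_left_mate_def ext_res_def ext_obj_def ext_arr_def Let_def)

lemma (in two_one) id1_equivalence:
  assumes "G \<in> Ob U"
  shows "internal_equivalence T G G (id1 T G)"
proof -
  have "id2 T (id1 T G) \<in> isos V (id1 T G) (id1 T G)"
    using assms unfolding cells2_isos[symmetric] by (simp add: homs_iff)
  then show ?thesis
    using assms unfolding internal_equivalence_def
    by (auto simp: homs_iff intro!: bexI[of _ "id1 T G"])
qed

theorem theorem6p4:
  fixes R :: "('k, 'r) ring_scheme"
    and ic :: bool
    and T :: "('g, 'h, 'c) twocat"
    and J :: "'h set"
    and Q :: "('g, 'h, 'c) prods"
    and M :: "('k, 'g, 'h, 'c, 'o1, 'm1) mackey"
    and N :: "('k, 'g, 'h, 'c, 'o2, 'm2) mackey"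
    and L :: "('k, 'g, 'h, 'c, 'o3, 'm3) mackey"
    and B :: "('g, 'h, 'o1, 'm1, 'o2, 'm2, 'o3, 'm3) pairing"
  assumes "cring R"
    and "cartesian_spannable_pair T J"
    and "product_choice T Q"
    and "mackey_2functor R ic T J M"
    and "mackey_2functor R ic T J N"
    and "mackey_2functor R ic T J L"
    and "bimorphism R T J Q M N L B"
    and "i \<in> J"
    and "i \<in> cells1 T H G"
  shows "(\<forall>X \<in> Ob (MC M G). \<forall>Y \<in> Ob (MC N H).
            mutually_inverse (MC L G)
              (pobj B G X (FO (Ind N i) Y))
              (FO (Ind L i) (pobj B H (FO (Res M i) X) Y))
              (Rp1 T M N L B i X Y) (Lp1 T M N L B i X Y)) \<and>
         (\<forall>X \<in> Ob (MC N G). \<forall>Y \<in> Ob (MC M H).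
            mutually_inverse (MC L G)
              (pobj B G (FO (Ind M i) Y) X)
              (FO (Ind L i) (pobj B H Y (FO (Res N i) X)))
              (Rp2 T M N L B i Y X) (Lp2 T M N L B i Y X))"
proof -
  have spannable: "spannable_pair T J" and J_prd: "\<And>i1 i2. i1 \<in> J \<Longrightarrow> i2 \<in> J \<Longrightarrow> prd1 Q i1 i2 \<in> J"
    using assms(2,3) by (auto simp: cartesian_spannable_pair_def)
  interpret two_one T
    using spannable by unfold_locales (simp add: spannable_pair_def)
  have J_arr: "J \<subseteq> Arr U"
    using spannable unfolding spannable_pair_def by (elim conjE) assumption
  have "\<forall>a b u. internal_equivalence T a b u \<longrightarrow> u \<in> J"
    using spannable unfolding spannable_pair_def by (elim conjE) assumption
  then have J_id: "id1 T G \<in> J" if "G \<in> Ob U" for G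
    using id1_equivalence[OF that] by blast
  have Q: "binary_products T Q"
    by (rule product_choice_binary_products[OF assms(3)])
  \<comment> \<open>\<open>Rp2\<close> and \<open>Lp2\<close> are literally \<open>Rp1\<close> and \<open>Lp1\<close> of the pairing with exchanged arguments\<close>
  interpret P: mackey_pairing T R ic J M N L B
    using assms(4-7) J_arr by unfold_locales (simp_all add: bimorphism_def)
  interpret P': mackey_pairing T R ic J N M L "swap_pairing B"
    using assms(7) by unfold_locales (simp add: bimorphism_def is_pairing_swap)
  have Rp2: "Rp2 T M N L B i Y X = Rp1 T N M L (swap_pairing B) i X Y"
    and Lp2: "Lp2 T M N L B i Y X = Lp1 T N M L (swap_pairing B) i X Y" for X Y
    by (simp_all add: Rp1_def Rp2_def Lp1_def Lp2_def Let_def)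
  show ?thesis
    using P.projection_formula[OF Q J_prd J_id assms(7,8,9)]
      P'.projection_formula[OF binary_products_swap[OF Q] _ J_id bimorphism_swap[OF assms(7)] assms(8,9)]
    by (simp add: J_prd Rp2 Lp2)
qed

end
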